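(* Let $X$ be a finite set of points in the plane in general position (no three collinear), and let $G_X^{S}$ be the flip graph of plane spanning trees on $X$ (defined in the context). Then: (i) if $|X|\geq 3$, then $G_X^{S}$ has a $1$-rainbow cycle; (ii) if $|X|\geq 4$, then for every $r\in\{2,3,\dots,m\}$, where $m:=|X|-1$ if $|X|$ is odd and $m:=|X|-2$ if $|X|$ is even, $G_X^{S}$ has an $r$-rainbow cycle.
   Context: A plane spanning tree on $X$ is a spanning tree on vertex set $X$ whose edges are drawn as straight-line segments with no two edges crossing. The directed graph $G_X^{S}$ has as vertices all plane spanning trees on $X$, and an arc $(T,T')$ whenever $T'=T-e+f$ for some edge $e\in T$ and some segment $f\notin T$ (a flip); the arc $(T,T')$ is labeled $f$ (the edge entering the tree). The set of possible labels is the set $\binom{X}{2}$ of all pairs of points of $X$. For an integer $r\geq 1$, an $r$-rainbow cycle in $G_X^{S}$ is a directed cycle (no repeated vertices) along which every pair in $\binom{X}{2}$ appears exactly $r$ times as an arc label. *)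

theory Defs
  imports "HOL-Analysis.Analysis" "Graph_Theory.Graph_Theory"
begin

definition general_position :: "(real^2) set \<Rightarrow> bool" where
  "general_position X \<longleftrightarrow>
     (\<forall>a\<in>X. \<forall>b\<in>X. \<forall>c\<in>X. a \<noteq> b \<and> a \<noteq> c \<and> b \<noteq> c \<longrightarrow> \<not> collinear {a, b, c})"

definition point_pairs :: "'a set \<Rightarrow> 'a set set" where
  "point_pairs X = {e. e \<subseteq> X \<and> card e = 2}"

text \<open>
  An edge is the two-element set of its end points, drawn as the segment \<^term>\<open>convex hull e\<close>.
  Distinct edges may meet only in a common end point.
\<close>

definition crossing :: "(real^2) set \<Rightarrow> (real^2) set \<Rightarrow> bool" where
  "crossing e f \<longleftrightarrow> e \<noteq> f \<and> \<not> convex hull e \<inter> convex hull f \<subseteq> e \<inter> f"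

definition sym_digraph :: "'a set \<Rightarrow> 'a set set \<Rightarrow> ('a, 'a \<times> 'a) pre_digraph" where
  "sym_digraph X T = \<lparr>verts = X, arcs = {(u, v). {u, v} \<in> T}, tail = fst, head = snd\<rparr>"

text \<open>
  The predicate \<^const>\<open>tree\<close> forbids directed cycles only, including those of length two, so it is
  not applicable to the symmetric digraph of an undirected graph. The cycles of an undirected
  simple graph are the directed cycles of length at least three of its symmetric digraph.
\<close>

definition spanning_tree_on :: "'a set \<Rightarrow> 'a set set \<Rightarrow> bool" where
  "spanning_tree_on X T \<longleftrightarrow>
     T \<subseteq> point_pairs X \<and>
     Digraph_Component.connected (sym_digraph X T) \<and>
     \<not> (\<exists>p. pre_digraph.cycle (sym_digraph X T) p \<and> length p \<ge> 3)"

definition plane_spanning_tree :: "(real^2) set \<Rightarrow> (real^2) set set \<Rightarrow> bool" where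
  "plane_spanning_tree X T \<longleftrightarrow>
     spanning_tree_on X T \<and> (\<forall>e\<in>T. \<forall>f\<in>T. \<not> crossing e f)"

text \<open>\<open>flip T f T'\<close>: the tree \<open>T'\<close> arises from \<open>T\<close> by a flip with entering edge \<open>f\<close>;
  \<open>f\<close> is determined by \<open>T\<close> and \<open>T'\<close> and is the label of the arc \<open>(T, T')\<close>.\<close>

definition flip :: "'a set set \<Rightarrow> 'a set \<Rightarrow> 'a set set \<Rightarrow> bool" where
  "flip T f T' \<longleftrightarrow> f \<notin> T \<and> (\<exists>e\<in>T. T' = insert f (T - {e}))"

definition tree_flip_graph ::
    "(real^2) set \<Rightarrow> ((real^2) set set, (real^2) set set \<times> (real^2) set set) pre_digraph" where
  "tree_flip_graph X =
     \<lparr>verts = {T. plane_spanning_tree X T},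
      arcs = {(T, T'). plane_spanning_tree X T \<and> plane_spanning_tree X T' \<and> (\<exists>f. flip T f T')},
      tail = fst, head = snd\<rparr>"

definition rainbow_cycle ::
    "(real^2) set \<Rightarrow> nat \<Rightarrow> ((real^2) set set \<times> (real^2) set set) list \<Rightarrow> bool" where
  "rainbow_cycle X r p \<longleftrightarrow>
     pre_digraph.cycle (tree_flip_graph X) p \<and>
     (\<forall>f\<in>point_pairs X. length (filter (\<lambda>(T, T'). flip T f T') p) = r)"

end

theory Submission
  imports Defs
begin

text \<open>
  Write \<open>S\<^sub>b\<close> for the star with centre \<open>b\<close>. A star \<open>S\<^sub>a\<close> is turned into \<open>S\<^sub>b\<close> by replacing the edges
  \<open>ak\<close> by \<open>bk\<close> one after the other, in an order given by the angles at \<open>a\<close> and \<open>b\<close>; one extra flip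
  removes the edge \<open>ab\<close> and one puts it back, so that every edge at \<open>b\<close> enters exactly once.
  Moving along an Euler tour of a \<open>d\<close>-regular oriented graph on \<open>X\<close> therefore uses every label
  \<open>2 d\<close> times, and circulant graphs provide all \<open>d\<close> with \<open>2 d < |X|\<close>. A star may be visited only once;
  further passages \<open>a \<rightarrow> b \<rightarrow> c\<close> avoid it by starting the move to \<open>c\<close> before the move from \<open>a\<close> is
  complete, which is possible because the last edge of the one and the first edge of the other
  lie in different sectors between rotationally consecutive points around \<open>b\<close>.

  For \<open>r = 1\<close>, let \<open>v\<^sub>0\<close> be a vertex of the convex hull and \<open>v\<^sub>1, v\<^sub>2, \<dots>\<close> the other points in angular order
  around it. Moving from the star at \<open>v\<^sub>0\<close> through the stars of \<open>{v\<^sub>j, v\<^sub>j\<^sub>+\<^sub>1, \<dots>}\<close> at \<open>v\<^sub>j\<close> to the path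
  \<open>v\<^sub>0 v\<^sub>1 v\<^sub>2 \<dots>\<close> uses all labels without \<open>v\<^sub>0\<close>, and the edges at \<open>v\<^sub>0\<close> lead back to the star. For odd \<open>r\<close> this
  cycle is inserted into a tour that avoids certain pairs of points; for \<open>r = |X| - 2\<close> one tours a
  regular tournament without the extra flips instead. Four and five points are left to
  explicitly given cycles.
\<close>

subsection \<open>Spanning trees given by parent functions\<close>

text \<open>What has to be prevented is that a tree occurs twice. In a tour, trees are told apart by
  their vertices of degree at least two: these are a and b inside the move from a to b, one vertex
  at a star, and three vertices where a passage avoids the star or where ab is missing. So a pair of
  centres can serve for one move only, whatever its direction: the toured digraph must be oriented,
  whence 2 d < |X|, and m is the largest even number below |X|. A passage a -> b -> c needs the star
  at b only if a or c is the hull neighbour of b that is followed by no sector narrower than a half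
  turn. This point is unique and the tour uses each neighbour of b once, so the star is met at most
  once. An odd r up to |X| - 3 is 2 d + 1 with 2 d + 4 <= |X|, just enough room for a hull vertex to
  have 2 d neighbours and three non-neighbours, which keep the inserted cycle apart from the tour.
  The value |X| - 2 is odd only for odd |X|; in a regular tournament the extra flips concern every
  pair exactly once, so dropping them turns |X| - 1 into |X| - 2.\<close>

lemma cas_nth:
  assumes "pre_digraph.cas G u p v" "i < length p"
  shows "head G (p ! i) = (if Suc i < length p then tail G (p ! Suc i) else v)"
  using assms
proof (induction p arbitrary: u i)
  case Nil
  then show ?case by simp
next
  case (Cons e p)
  then have c: "pre_digraph.cas G (head G e) p v"
    by (simp add: pre_digraph.cas.simps)
  show ?case
  proof (cases i)
    case 0
    then show ?thesis
      using c by (cases p) (auto simp: pre_digraph.cas.simps)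
  next
    case (Suc j)
    then show ?thesis
      using Cons.IH[OF c, of j] Cons.prems by auto
  qed
qed

lemma cas_hd:
  assumes "pre_digraph.cas G u p v" "p \<noteq> []"
  shows "tail G (hd p) = u"
  using assms by (cases p) (auto simp: pre_digraph.cas.simps)

lemma closed_cas_nth:
  assumes "pre_digraph.cas G u p u" "i < length p"
  shows "head G (p ! i) = tail G (p ! (Suc i mod length p))"
proof (cases "Suc i < length p")
  case True
  then show ?thesis using cas_nth[OF assms] by simp
next
  case False
  then have "Suc i = length p" "p \<noteq> []" using assms by auto
  then show ?thesis
    using cas_nth[OF assms] cas_hd[OF assms(1)] by (simp add: hd_conv_nth)
qed

text \<open>Acyclicity comes from a vertex of maximal rank on a supposed cycle: its two neighbours
  there have no larger rank, so both are its parent, whereas a cycle of length at least three has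
  two different neighbours.\<close>

lemma spanning_tree_parentI:
  fixes rank :: "'a \<Rightarrow> nat"
  assumes r: "r \<in> X"
    and par: "\<And>v. v \<in> X \<Longrightarrow> v \<noteq> r \<Longrightarrow> par v \<in> X \<and> rank (par v) < rank v"
    and T: "T = (\<lambda>v. {v, par v}) ` (X - {r})"
  shows "spanning_tree_on X T"
proof -
  let ?G = "sym_digraph X T"
  have sub: "T \<subseteq> point_pairs X"
  proof
    fix e assume "e \<in> T"
    then obtain v where v: "v \<in> X" "v \<noteq> r" "e = {v, par v}" using T by auto
    then have "v \<noteq> par v" using par[of v] by auto
    then show "e \<in> point_pairs X" using v par[of v] by (auto simp: point_pairs_def)
  qed
  have ends: "arcs_ends ?G = {(u, v). {u, v} \<in> T}"
    by (auto simp: arcs_ends_def sym_digraph_def arc_to_ends_def)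
  have reach: "(v, r) \<in> rtrancl_on X (symcl (arcs_ends ?G))" if "v \<in> X" for v
    using that
  proof (induction "rank v" arbitrary: v rule: less_induct)
    case less
    show ?case
    proof (cases "v = r")
      case True
      then show ?thesis using r by auto
    next
      case False
      then have p: "par v \<in> X" "rank (par v) < rank v" using par less.prems by auto
      have "(v, par v) \<in> symcl (arcs_ends ?G)"
        using False less.prems unfolding ends symcl_def by (auto simp: T)
      with less.hyps[OF p(2,1)] less.prems show ?thesis
        by (auto intro: converse_rtrancl_on_into_rtrancl_on)
    qed
  qed
  have sym: "sym (rtrancl_on X (symcl (arcs_ends ?G)))"
    by (rule rtrancl_on_sym) (auto simp: symcl_def sym_def)
  have conn: "Digraph_Component.connected ?G"
    unfolding connected_conv
  proof (intro conjI ballI)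
    show "verts ?G \<noteq> {}" using r by (auto simp: sym_digraph_def)
  next
    fix u v assume "u \<in> verts ?G" "v \<in> verts ?G"
    then have "u \<in> X" "v \<in> X" by (auto simp: sym_digraph_def)
    then have "(u, r) \<in> rtrancl_on X (symcl (arcs_ends ?G))"
      "(r, v) \<in> rtrancl_on X (symcl (arcs_ends ?G))"
      using reach sym by (auto dest: symD)
    then have "(u, v) \<in> rtrancl_on X (symcl (arcs_ends ?G))" by (rule rtrancl_on_trans)
    then show "(u, v) \<in> rtrancl_on (verts ?G) (symcl (arcs_ends ?G))"
      by (simp add: sym_digraph_def)
  qed
  have down: "u = par v" if "{u, v} \<in> T" "rank u \<le> rank v" for u v
  proof -
    from that obtain x where x: "x \<in> X" "x \<noteq> r" "{u, v} = {x, par x}" using T by auto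
    then have "rank (par x) < rank x" using par by auto
    with x that show ?thesis by (auto simp: doubleton_eq_iff)
  qed
  have acyc: "\<not> (\<exists>p. pre_digraph.cycle ?G p \<and> length p \<ge> 3)"
  proof
    assume "\<exists>p. pre_digraph.cycle ?G p \<and> length p \<ge> 3"
    then obtain p u where p: "pre_digraph.awalk ?G u p u"
      "distinct (tl (pre_digraph.awalk_verts ?G u p))" "length p \<ge> 3"
      by (auto simp: pre_digraph.cycle_def)
    then have cas: "pre_digraph.cas ?G u p u" and arcs: "set p \<subseteq> arcs ?G"
      by (auto simp: pre_digraph.awalk_def)
    have dist: "distinct (map snd p)"
      using p(2,3) pre_digraph.awalk_verts_conv'[OF cas] by (auto simp: sym_digraph_def split: if_splits)
    let ?L = "length p"
    have L0: "?L > 0" using p by auto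
    define ranks where "ranks = (\<lambda>i. rank (snd (p ! i))) ` {..<?L}"
    have "Max ranks \<in> ranks" unfolding ranks_def using L0 by (intro Max_in) auto
    then obtain i where i: "i < ?L" "rank (snd (p ! i)) = Max ranks"
      unfolding ranks_def by auto
    have mx: "rank (snd (p ! j)) \<le> rank (snd (p ! i))" if "j < ?L" for j
      using i that unfolding ranks_def by (auto intro: Max_ge)
    \<comment> \<open>\<open>j\<close> and \<open>k\<close> are the cyclic successor and predecessor
      of \<open>i\<close>; they differ because the length is at least three.\<close>
    define j where "j = Suc i mod ?L"
    define k where "k = (if i = 0 then ?L - 1 else i - 1)"
    have jk: "j < ?L" "k < ?L" "Suc k mod ?L = i" "j \<noteq> k"
      using i p(3) L0 unfolding j_def k_def
      by (auto simp: mod_Suc)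
    have nx: "snd (p ! l) = fst (p ! (Suc l mod ?L))" if "l < ?L" for l
      using closed_cas_nth[OF cas that] by (simp add: sym_digraph_def)
    have inT: "{fst (p ! l), snd (p ! l)} \<in> T" if "l < ?L" for l
      using arcs nth_mem[OF that] by (force simp: sym_digraph_def)
    have "{snd (p ! k), snd (p ! i)} \<in> T" using inT[OF i(1)] nx[OF jk(2)] jk(3) by simp
    then have 1: "snd (p ! k) = par (snd (p ! i))" using mx jk by (intro down) auto
    have "{snd (p ! j), snd (p ! i)} \<in> T"
      using inT[OF jk(1)] nx[OF i(1)] by (simp add: j_def insert_commute)
    then have 2: "snd (p ! j) = par (snd (p ! i))" using mx jk by (intro down) auto
    have "map snd p ! j = map snd p ! k" using 1 2 jk by simp
    with dist jk(1,2,4) show False by (metis length_map nth_eq_iff_index_eq)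
  qed
  show ?thesis using sub conn acyc by (auto simp: spanning_tree_on_def)
qed

subsection \<open>Flip sequences\<close>

text \<open>A flip sequence is listed as the trees it leaves, each with the label of the flip leaving it;
  the tree it arrives at is a separate argument.\<close>

fun source :: "('t \<times> 'l) list \<Rightarrow> 't \<Rightarrow> 't" where
  "source [] T' = T'"
| "source (x # xs) T' = fst x"

fun flip_path :: "(real^2) set \<Rightarrow> ((real^2) set set \<times> (real^2) set) list \<Rightarrow> (real^2) set set \<Rightarrow> bool"
  where
  "flip_path X [] T' \<longleftrightarrow> True"
| "flip_path X ((T, f) # xs) T' \<longleftrightarrow>
     plane_spanning_tree X T \<and> flip T f (source xs T') \<and> flip_path X xs T'"

fun arcs_of :: "('t \<times> 'l) list \<Rightarrow> 't \<Rightarrow> ('t \<times> 't) list" where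
  "arcs_of [] T' = []"
| "arcs_of ((T, f) # xs) T' = (T, source xs T') # arcs_of xs T'"

lemma source_append [simp]: "source (xs @ ys) T' = source xs (source ys T')"
  by (cases xs) auto

lemma flip_path_append:
  "flip_path X (xs @ ys) T' \<longleftrightarrow> flip_path X xs (source ys T') \<and> flip_path X ys T'"
  by (induction xs) auto

lemma flip_path_concat:
  assumes "\<And>i. i < L \<Longrightarrow> B i \<noteq> []"
    and "\<And>i. i < L \<Longrightarrow> fst (hd (B i)) = s i"
    and "\<And>i. i < L \<Longrightarrow> flip_path X (B i) (s (Suc i))"
  shows "flip_path X (concat (map B [0..<L])) (s L)"
  using assms
proof (induction L)
  case 0
  then show ?case by simp
next
  case (Suc L)
  have "source (B L) T = s L" for T
    using Suc.prems(1,2)[of L] by (cases "B L") auto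
  then show ?case using Suc by (simp add: flip_path_append)
qed

lemma flip_path_map_upt:
  assumes "\<And>t. i \<le> t \<Longrightarrow> t < j \<Longrightarrow> plane_spanning_tree X (T t)"
    and "\<And>t. i \<le> t \<Longrightarrow> t < j \<Longrightarrow> flip (T t) (f t) (T (Suc t))"
  shows "flip_path X (map (\<lambda>t. (T t, f t)) [i..<j]) (T j)"
  using assms
proof (induction "j - i" arbitrary: i)
  case 0
  then show ?case by simp
next
  case (Suc m)
  then have ij: "i < j" by simp
  have "source (map (\<lambda>t. (T t, f t)) [Suc i..<j]) (T j) = T (Suc i)"
  proof (cases "Suc i < j")
    case True
    then show ?thesis by (simp add: upt_conv_Cons)
  next
    case False
    then have "j = Suc i" using ij by simp
    then show ?thesis by simp
  qed
  moreover have "flip_path X (map (\<lambda>t. (T t, f t)) [Suc i..<j]) (T j)"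
    using Suc by auto
  ultimately show ?case using Suc.prems ij by (simp add: upt_conv_Cons)
qed

text \<open>The label is the only element of the new tree outside the old one.\<close>

lemma flip_label_unique: "flip T f U \<Longrightarrow> flip T g U \<longleftrightarrow> f = g"
  unfolding flip_def by auto

lemma rainbow_cycleI:
  assumes ne: "xs \<noteq> []" and path: "flip_path X xs (fst (hd xs))"
    and dist: "distinct (map fst xs)"
    and cnt: "\<And>f. f \<in> point_pairs X \<Longrightarrow> count_list (map snd xs) f = r"
  shows "\<exists>p. rainbow_cycle X r p"
proof -
  let ?G = "tree_flip_graph X"
  have cas: "pre_digraph.cas ?G (source ys T) (arcs_of ys T) T" for ys T
    by (induction ys T rule: arcs_of.induct)
      (auto simp: pre_digraph.cas.simps tree_flip_graph_def)
  have src: "plane_spanning_tree X T \<Longrightarrow> flip_path X ys T \<Longrightarrow> plane_spanning_tree X (source ys T)"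
    for ys T by (cases ys) auto
  have arcs: "set (arcs_of ys T) \<subseteq> arcs ?G"
    if "plane_spanning_tree X T" "flip_path X ys T" for ys T
    using that
  proof (induction ys T rule: arcs_of.induct)
    case (2 T f xs T')
    then show ?case using src[of T' xs] by (auto simp: tree_flip_graph_def)
  qed simp
  have len: "length (filter (\<lambda>(T, T'). flip T f T') (arcs_of ys T)) = count_list (map snd ys) f"
    if "flip_path X ys T" for ys T f
    using that by (induction ys T rule: arcs_of.induct) (auto simp: flip_label_unique)
  obtain T f ys where xs: "xs = (T, f) # ys" using ne by (cases xs) auto
  let ?p = "arcs_of xs T"
  have T: "plane_spanning_tree X T" and path': "flip_path X xs T" using path xs by auto
  have fsts: "map fst (arcs_of zs U) = map fst zs" for zs :: "((real^2) set set \<times> (real^2) set) list" and U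
    by (induction zs U rule: arcs_of.induct) auto
  have cas': "pre_digraph.cas ?G T ?p T" using cas[of xs T] xs by simp
  have ne': "?p \<noteq> []" by (simp add: xs)
  have "tl (pre_digraph.awalk_verts ?G T ?p) = map snd ?p"
    using pre_digraph.awalk_verts_conv'[OF cas'] ne' by (simp add: tree_flip_graph_def)
  \<comment> \<open>\<open>cycle\<close> asks for distinct heads, while \<open>dist\<close> is about
    tails. The heads are the tails rotated by one place, so both lists have the same
    multiset.\<close>
  moreover have "T # map snd ?p = map fst ?p @ [T]"
    using pre_digraph.awalk_verts_conv'[OF cas'] pre_digraph.awalk_verts_conv[of ?G T ?p] ne'
      cas_nth[OF cas', of "length ?p - 1"] cas_hd[OF cas' ne']
    by (simp add: tree_flip_graph_def last_conv_nth)
  then have "mset (T # map snd ?p) = mset (map fst ?p @ [T])" by (rule arg_cong)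
  then have "mset (map snd ?p) = mset (map fst ?p)" by simp
  then have "distinct (map snd ?p)" using dist fsts[of xs T] by (metis mset_eq_imp_distinct_iff)
  ultimately have "pre_digraph.cycle ?G ?p"
    unfolding pre_digraph.cycle_def pre_digraph.awalk_def
    using cas' arcs[OF T path'] T ne' by (intro exI[of _ T]) (auto simp: tree_flip_graph_def)
  then show ?thesis
    using len[OF path'] cnt by (auto simp: rainbow_cycle_def)
qed

subsection \<open>Orientations and crossings\<close>

text \<open>Twice the signed area of the triangle \<open>p q r\<close>; positive iff
  \<open>r\<close> lies to the left of the directed line from \<open>p\<close> to
  \<open>q\<close>.\<close>

definition orient :: "real^2 \<Rightarrow> real^2 \<Rightarrow> real^2 \<Rightarrow> real" where
  "orient p q r = (q$1 - p$1) * (r$2 - p$2) - (q$2 - p$2) * (r$1 - p$1)"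

lemma orient_self [simp]: "orient a b a = 0" "orient a b b = 0" "orient a a b = 0"
  by (simp_all add: orient_def algebra_simps)

lemma orient_swap: "orient a c b = - orient a b c"
  by (simp add: orient_def algebra_simps)

lemma orient_rotate: "orient b c a = orient a b c"
  by (simp add: orient_def algebra_simps)

lemma orient_affine:
  "orient a b ((1 - u) *\<^sub>R p + u *\<^sub>R q) = (1 - u) * orient a b p + u * orient a b q"
  by (simp add: orient_def algebra_simps)

lemma collinear_if_orient_eq_0:
  assumes "orient a b c = 0" "a \<noteq> b"
  shows "collinear {a, b, c}"
proof -
  have "\<exists>u. c = u *\<^sub>R a + (1 - u) *\<^sub>R b"
  proof (cases "a$1 = b$1")
    case False
    define u where "u = (c$1 - b$1) / (a$1 - b$1)"
    have u: "u * (a$1 - b$1) = c$1 - b$1" using False by (simp add: u_def)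
    have "(a$1 - b$1) * (c$2 - b$2 - u * (a$2 - b$2)) = 0"
      using assms(1) u unfolding orient_def by algebra
    then have "c$2 - b$2 = u * (a$2 - b$2)" using False by simp
    then show ?thesis using u
      by (intro exI[of _ u]) (simp add: vec_eq_iff forall_2 algebra_simps)
  next
    case True
    then have ne: "a$2 \<noteq> b$2" using assms by (simp add: vec_eq_iff forall_2)
    define u where "u = (c$2 - b$2) / (a$2 - b$2)"
    have u: "u * (a$2 - b$2) = c$2 - b$2" using ne by (simp add: u_def)
    have "(a$2 - b$2) * (c$1 - b$1 - u * (a$1 - b$1)) = 0"
      using assms(1) u unfolding orient_def by algebra
    then have "c$1 - b$1 = u * (a$1 - b$1)" using ne by simp
    then show ?thesis using u
      by (intro exI[of _ u]) (simp add: vec_eq_iff forall_2 algebra_simps)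
  qed
  then have "collinear {a, c, b}" by (auto simp: collinear_3_expand)
  then show ?thesis by (simp add: insert_commute)
qed

lemma in_hull_pair:
  "x \<in> convex hull {p, q} \<longleftrightarrow> (\<exists>u. 0 \<le> u \<and> u \<le> 1 \<and> x = (1 - u) *\<^sub>R p + u *\<^sub>R q)"
  by (simp flip: segment_convex_hull add: in_segment)

lemma crossing_commute: "crossing e f \<longleftrightarrow> crossing f e"
  unfolding crossing_def by auto

lemma not_crossing_self [simp]: "\<not> crossing e e"
  by (simp add: crossing_def)

text \<open>The line \<open>ab\<close> separates the segments; only the second one may touch
  it.\<close>

lemma not_crossing_strict:
  assumes "orient a b p < 0" "orient a b q < 0" "orient a b r \<ge> 0" "orient a b s \<ge> 0"
  shows "\<not> crossing {p, q} {r, s}"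
proof -
  have "False" if "x \<in> convex hull {p, q}" "x \<in> convex hull {r, s}" for x
  proof -
    from that obtain u w where u: "0 \<le> u" "u \<le> 1" "x = (1 - u) *\<^sub>R p + u *\<^sub>R q"
      and w: "0 \<le> w" "w \<le> 1" "x = (1 - w) *\<^sub>R r + w *\<^sub>R s"
      by (auto simp: in_hull_pair)
    have "orient a b x \<ge> 0"
      unfolding w(3) orient_affine using w assms by (intro add_nonneg_nonneg mult_nonneg_nonneg) auto
    moreover have "orient a b x < 0"
    proof (cases "u = 0")
      case True
      then show ?thesis using u assms by simp
    next
      case False
      then have "u * orient a b q < 0" using u assms by (intro mult_pos_neg) auto
      moreover have "(1 - u) * orient a b p \<le> 0" using u assms by (intro mult_nonneg_nonpos) auto
      ultimately show ?thesis unfolding u(3) orient_affine by linarith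
    qed
    ultimately show False by linarith
  qed
  then show ?thesis unfolding crossing_def by blast
qed

text \<open>Here each segment may touch the separating line, but only in its first end point, so a
  common point is an end point of both.\<close>

lemma not_crossing_weak:
  assumes "orient a b p \<le> 0" "orient a b q < 0" "orient a b r \<ge> 0" "orient a b s > 0"
  shows "\<not> crossing {p, q} {r, s}"
proof -
  have "x \<in> {p, q} \<inter> {r, s}" if "x \<in> convex hull {p, q}" "x \<in> convex hull {r, s}" for x
  proof -
    from that obtain u w where u: "0 \<le> u" "u \<le> 1" "x = (1 - u) *\<^sub>R p + u *\<^sub>R q"
      and w: "0 \<le> w" "w \<le> 1" "x = (1 - w) *\<^sub>R r + w *\<^sub>R s"
      by (auto simp: in_hull_pair)
    have 1: "(1 - w) * orient a b r \<ge> 0" "w * orient a b s \<ge> 0"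
      using w assms by (auto intro!: mult_nonneg_nonneg)
    have 2: "(1 - u) * orient a b p \<le> 0" "u * orient a b q \<le> 0"
      using u assms by (auto intro!: mult_nonneg_nonpos)
    have "(1 - w) * orient a b r + w * orient a b s = (1 - u) * orient a b p + u * orient a b q"
      using u(3) w(3) orient_affine by metis
    then have "w * orient a b s = 0" "u * orient a b q = 0" using 1 2 by linarith+
    then have "w = 0" "u = 0" using assms by auto
    then show ?thesis using u w by simp
  qed
  then show ?thesis unfolding crossing_def by blast
qed

lemma not_crossing_common:
  assumes "orient a b c \<noteq> 0"
  shows "\<not> crossing {a, b} {a, c}"
proof -
  have "x = a" if "x \<in> convex hull {a, b}" "x \<in> convex hull {a, c}" for x
  proof -
    from that obtain u w where u: "0 \<le> u" "u \<le> 1" "x = (1 - u) *\<^sub>R a + u *\<^sub>R b"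
      and w: "0 \<le> w" "w \<le> 1" "x = (1 - w) *\<^sub>R a + w *\<^sub>R c"
      by (auto simp: in_hull_pair)
    have "orient a b x = 0" unfolding u(3) orient_affine by simp
    moreover have "orient a b x = w * orient a b c" unfolding w(3) orient_affine by simp
    ultimately have "w = 0" using assms by simp
    then show ?thesis using w by simp
  qed
  then show ?thesis unfolding crossing_def by blast
qed

section \<open>Angular orders and sweeps from one centre to another\<close>

lemma ex_sorted_key_list:
  fixes f :: "'a \<Rightarrow> real"
  assumes "finite A"
  shows "\<exists>xs. distinct xs \<and> set xs = A \<and> sorted (map f xs)"
proof -
  obtain xs where "set xs = A" "distinct xs" using finite_distinct_list[OF assms] by auto
  then show ?thesis by (intro exI[of _ "sort_key f xs"]) auto
qed

text \<open>The key is the cotangent of the angle at \<open>a\<close> between \<open>b\<close> and the point.\<close>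

lemma ex_angular_order:
  assumes fin: "finite A" and pos: "\<And>k. k \<in> A \<Longrightarrow> orient a b k > 0"
    and gp: "\<And>k l. k \<in> A \<Longrightarrow> l \<in> A \<Longrightarrow> k \<noteq> l \<Longrightarrow> orient a k l \<noteq> 0"
  shows "\<exists>xs. distinct xs \<and> set xs = A \<and> sorted_wrt (\<lambda>k l. orient a k l > 0) xs"
proof (cases "A = {}")
  case True
  then show ?thesis by auto
next
  case False
  then have "a \<noteq> b" using pos by fastforce
  then have nz: "(b$1 - a$1)\<^sup>2 + (b$2 - a$2)\<^sup>2 > 0"
    by (auto simp: vec_eq_iff forall_2 sum_power2_gt_zero_iff)
  define dt where "dt = (\<lambda>k::real^2. (b$1 - a$1) * (k$1 - a$1) + (b$2 - a$2) * (k$2 - a$2))"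
  define key where "key = (\<lambda>k. - (dt k / orient a b k))"
  obtain xs where xs: "distinct xs" "set xs = A" "sorted (map key xs)"
    using ex_sorted_key_list[OF fin] by blast
  have "orient a k l > 0" if "k \<in> A" "l \<in> A" "k \<noteq> l" "key k \<le> key l" for k l
  proof -
    have "dt l * orient a b k \<le> dt k * orient a b l"
      using that(4) pos[OF that(1)] pos[OF that(2)] unfolding key_def by (simp add: field_simps)
    \<comment> \<open>\<open>dt\<close> and \<open>orient a b\<close> are the coordinates with
      respect to \<open>b - a\<close> and its quarter turn. This change of coordinates has
      determinant \<open>|b - a|^2\<close>, the factor by which it multiplies
      \<open>orient a k l\<close>.\<close>
    moreover have "dt k * orient a b l - dt l * orient a b k
        = ((b$1 - a$1)\<^sup>2 + (b$2 - a$2)\<^sup>2) * orient a k l"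
      unfolding dt_def orient_def by algebra
    ultimately have "((b$1 - a$1)\<^sup>2 + (b$2 - a$2)\<^sup>2) * orient a k l \<ge> 0" by linarith
    then have "orient a k l \<ge> 0" using nz by (simp add: zero_le_mult_iff)
    then show ?thesis using gp[OF that(1-3)] by linarith
  qed
  then have "sorted_wrt (\<lambda>k l. orient a k l > 0) xs"
    using xs by (auto simp: sorted_wrt_iff_nth_less nth_eq_iff_index_eq)
  then show ?thesis using xs by blast
qed

text \<open>A ray turning counterclockwise about \<open>b\<close> from \<open>c\<close> meets
  \<open>z\<close> first, and does so within less than half a turn.\<close>

definition succ_of :: "(real^2) set \<Rightarrow> real^2 \<Rightarrow> real^2 \<Rightarrow> real^2 \<Rightarrow> bool" where
  "succ_of X b c z \<longleftrightarrow> z \<in> X \<and> orient b c z > 0 \<and>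
     (\<forall>k\<in>X. orient b c k > 0 \<longrightarrow> k \<noteq> z \<longrightarrow> orient b z k > 0)"

text \<open>\<open>exceptional X b p\<close> means that \<open>p\<close> precedes \<open>b\<close> in counterclockwise order on the convex hull.\<close>

definition exceptional :: "(real^2) set \<Rightarrow> real^2 \<Rightarrow> real^2 \<Rightarrow> bool" where
  "exceptional X b p \<longleftrightarrow> \<not> (\<exists>k\<in>X. orient b p k > 0)"

text \<open>A new edge at \<open>b\<close> must not cross the edges at \<open>a\<close> that are
  still to be replaced. The clauses on \<open>hd\<close> and \<open>last\<close> make the first new
  edge span the sector at \<open>a\<close> that follows \<open>b\<close>, and the last old edge the
  sector at \<open>b\<close> that follows \<open>a\<close>; the passages between moves rest on this.
  The final clause serves to place the extra flip, see \<open>loc\<close>.\<close>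

definition is_sweep :: "(real^2) set \<Rightarrow> real^2 \<Rightarrow> real^2 \<Rightarrow> (real^2) list \<Rightarrow> bool" where
  "is_sweep X a b xs \<longleftrightarrow> distinct xs \<and> set xs = X - {a, b} \<and>
     (\<forall>i j. i < j \<longrightarrow> j < length xs \<longrightarrow> \<not> crossing {b, xs ! i} {a, xs ! j}) \<and>
     (\<not> exceptional X a b \<longrightarrow> succ_of X a b (hd xs)) \<and>
     (\<not> exceptional X b a \<longrightarrow> succ_of X b a (last xs)) \<and>
     (\<forall>i j. i < j \<longrightarrow> j < length xs \<longrightarrow> orient a b (xs ! j) > 0 \<longrightarrow> orient a b (xs ! i) > 0)"

definition sweep :: "(real^2) set \<Rightarrow> real^2 \<Rightarrow> real^2 \<Rightarrow> (real^2) list" where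
  "sweep X a b = (SOME xs. is_sweep X a b xs)"

locale points =
  fixes X :: "(real^2) set"
  assumes finite_X: "finite X" and gp: "general_position X"
begin

lemma orient_nonzero:
  "a \<in> X \<Longrightarrow> b \<in> X \<Longrightarrow> c \<in> X \<Longrightarrow> a \<noteq> b \<Longrightarrow> a \<noteq> c \<Longrightarrow> b \<noteq> c \<Longrightarrow> orient a b c \<noteq> 0"
  using gp collinear_if_orient_eq_0 unfolding general_position_def by metis

lemma not_crossing_shared:
  assumes "a \<in> X" "b \<in> X" "c \<in> X" "a \<noteq> b" "a \<noteq> c"
  shows "\<not> crossing {a, b} {a, c}"
proof (cases "b = c")
  case False
  then show ?thesis using orient_nonzero assms by (intro not_crossing_common) auto
qed simp

lemma not_crossing_meet:
  assumes "e \<in> point_pairs X" "f \<in> point_pairs X" "e \<inter> f \<noteq> {}"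
  shows "\<not> crossing e f"
proof -
  obtain a where a: "a \<in> e" "a \<in> f" using assms by auto
  then obtain b where b: "e = {a, b}" "a \<noteq> b" using assms(1)
    unfolding point_pairs_def by (auto simp: card_2_iff)
  obtain c where c: "f = {a, c}" "a \<noteq> c" using assms(2) a
    unfolding point_pairs_def by (auto simp: card_2_iff)
  show ?thesis using not_crossing_shared[of a b c] b c assms by (auto simp: point_pairs_def)
qed

text \<open>Of two points, one lies strictly to the left of the ray from \<open>b\<close> to the
  other. This is what bounds the number of visits to a star.\<close>

lemma exceptional_unique:
  assumes "exceptional X b p" "exceptional X b q" "b \<in> X" "p \<in> X" "q \<in> X" "p \<noteq> b" "q \<noteq> b"
  shows "p = q"
proof (rule ccontr)
  assume "p \<noteq> q"
  then have "orient b p q \<noteq> 0" using assms orient_nonzero by auto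
  moreover have "orient b p q \<le> 0" "orient b q p \<le> 0"
    using assms unfolding exceptional_def by (auto simp: not_less)
  ultimately show False using orient_swap[of b p q] by linarith
qed

text \<open>Take the points left of \<open>ab\<close> counterclockwise around \<open>a\<close>,
  beginning at the ray \<open>ab\<close>, and then those right of \<open>ab\<close> clockwise around
  \<open>b\<close>, ending at the ray \<open>ba\<close>.\<close>

lemma ex_is_sweep:
  assumes ab: "a \<in> X" "b \<in> X" "a \<noteq> b"
  shows "\<exists>xs. is_sweep X a b xs"
proof -
  have ex: "\<exists>xs. distinct xs \<and> set xs = {k\<in>X. orient c d k > 0} \<and> sorted_wrt (\<lambda>k l. orient c k l > 0) xs"
    if "c \<in> X" "d \<in> X" for c d
    using finite_X that by (intro ex_angular_order) (auto, metis less_irrefl orient_nonzero orient_self(1))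
  obtain ls where ls: "distinct ls" "set ls = {k\<in>X. orient a b k > 0}"
    "sorted_wrt (\<lambda>k l. orient a k l > 0) ls"
    using ex[OF ab(1,2)] by blast
  obtain rs where rs: "distinct rs" "set rs = {k\<in>X. orient b a k > 0}"
    "sorted_wrt (\<lambda>k l. orient b k l > 0) rs"
    using ex[OF ab(2,1)] by blast
  have ba: "orient b a k = - orient a b k" for k
    by (simp add: orient_def algebra_simps)
  let ?xs = "ls @ rev rs"
  have set: "set ?xs = X - {a, b}"
    using ls(2) rs(2) ab orient_nonzero[of a b] unfolding ba
    by (auto simp: less_le not_less)
  have dist: "distinct ?xs" using ls rs ba by auto
  have nc: "\<not> crossing {b, ?xs ! i} {a, ?xs ! j}" if ij: "i < j" "j < length ?xs" for i j
  proof -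
    \<comment> \<open>The separating line passes through \<open>a\<close> and the later point if
      both points are left of \<open>ab\<close>, it is \<open>ab\<close> if they lie on different
      sides, and it passes through \<open>b\<close> and the earlier point if both are right of
      \<open>ab\<close>.\<close>
    consider "j < length ls" | "i < length ls" "length ls \<le> j" | "length ls \<le> i" by linarith
    then show ?thesis
    proof cases
      case 1
      then have m: "?xs ! i \<in> set ls" "?xs ! j \<in> set ls"
        using ij by (auto simp: nth_append)
      have "orient a (?xs ! i) (?xs ! j) > 0"
        using ls(3) 1 ij by (auto simp: sorted_wrt_iff_nth_less nth_append)
      moreover have "orient a b (?xs ! j) > 0" using m ls by auto
      ultimately show ?thesis
        by (intro not_crossing_strict[of a "?xs ! j"]) (auto simp: orient_swap[of a _ b] orient_swap[of a "?xs ! i" "?xs ! j"])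
    next
      case 2
      then have "?xs ! i \<in> set ls" using ij by (auto simp: nth_append)
      then have i: "orient a b (?xs ! i) > 0" using ls by auto
      have "?xs ! j \<in> set (rev rs)" using 2 ij by (auto simp: nth_append simp del: set_rev)
      then have j: "orient a b (?xs ! j) < 0" using rs ba by auto
      have "\<not> crossing {a, ?xs ! j} {b, ?xs ! i}"
        using i j by (intro not_crossing_weak[of a b]) auto
      then show ?thesis by (simp add: crossing_commute)
    next
      case 3
      define k l where "k = ?xs ! i" "l = ?xs ! j"
      have k: "k = rev rs ! (i - length ls)" and l: "l = rev rs ! (j - length ls)"
        using 3 ij by (auto simp: k_l_def nth_append)
      have "sorted_wrt (\<lambda>k l. orient b l k > 0) (rev rs)" using rs(3) by (simp add: sorted_wrt_rev)
      moreover have "i - length ls < j - length ls" "j - length ls < length (rev rs)"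
        using 3 ij by auto
      ultimately have "orient b l k > 0"
        unfolding k l by (auto simp: sorted_wrt_iff_nth_less)
      then have 4: "orient b k l < 0" using orient_swap[of b k l] by linarith
      have "k \<in> set (rev rs)" unfolding k using 3 ij by (intro nth_mem) auto
      then have "orient b a k > 0" using rs by auto
      then have 5: "orient b k a < 0" using orient_swap[of b k a] by linarith
      have "\<not> crossing {a, l} {b, k}" using 4 5 by (intro not_crossing_strict[of b k]) auto
      then show ?thesis by (simp add: crossing_commute k_l_def)
    qed
  qed
  have head: "succ_of X c d (hd zs)"
    if "distinct zs" "set zs = {k\<in>X. orient c d k > 0}" "sorted_wrt (\<lambda>k l. orient c k l > 0) zs"
      "\<not> exceptional X c d" for c d zs
  proof -
    from that(2,4) have "zs \<noteq> []" by (force simp: exceptional_def)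
    then obtain z ys where "zs = z # ys" by (cases zs) auto
    then show ?thesis using that unfolding succ_of_def by auto
  qed
  have h1: "succ_of X a b (hd ?xs)" if "\<not> exceptional X a b"
  proof -
    have "ls \<noteq> []" using that ls(2) by (force simp: exceptional_def)
    then show ?thesis using head[OF ls that] by simp
  qed
  have h2: "succ_of X b a (last ?xs)" if "\<not> exceptional X b a"
  proof -
    have "rs \<noteq> []" using that rs(2) by (force simp: exceptional_def)
    then show ?thesis using head[OF rs that] by (simp add: last_rev)
  qed
  have side: "orient a b (?xs ! i) > 0"
    if ij: "i < j" "j < length ?xs" and pos: "orient a b (?xs ! j) > 0" for i j
  proof -
    have "j < length ls"
    proof (rule ccontr)
      assume "\<not> j < length ls"
      then have "?xs ! j \<in> set (rev rs)" using ij by (auto simp: nth_append simp del: set_rev)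
      then show False using rs ba pos by auto
    qed
    then have "?xs ! i \<in> set ls" using ij by (auto simp: nth_append)
    then show ?thesis using ls by auto
  qed
  show ?thesis
    unfolding is_sweep_def using dist set nc h1 h2 side by (intro exI[of _ ?xs] conjI) blast+
qed

lemma is_sweep_sweep:
  "a \<in> X \<Longrightarrow> b \<in> X \<Longrightarrow> a \<noteq> b \<Longrightarrow> is_sweep X a b (sweep X a b)"
  unfolding sweep_def by (rule someI_ex[OF ex_is_sweep])

text \<open>The segments \<open>ay\<close> and \<open>cz\<close> span sectors between rotationally
  consecutive points around \<open>b\<close>. For \<open>a \<noteq> c\<close> these sectors are
  different, so the segments can meet only in a common end point.\<close>

lemma succ_of_pair:
  assumes y: "succ_of X b a y" and z: "succ_of X b c z"
    and X: "a \<in> X" "b \<in> X" "c \<in> X" and ne: "a \<noteq> b" "c \<noteq> b" "a \<noteq> c"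
  shows "y \<noteq> z" "\<not> (y = c \<and> z = a)" "\<not> crossing {a, y} {c, z}"
proof -
  note sw = orient_swap[of b]
  have y1: "orient b a y > 0" and y2: "\<And>k. k \<in> X \<Longrightarrow> orient b a k > 0 \<Longrightarrow> k \<noteq> y \<Longrightarrow> orient b y k > 0"
    and z1: "orient b c z > 0" and z2: "\<And>k. k \<in> X \<Longrightarrow> orient b c k > 0 \<Longrightarrow> k \<noteq> z \<Longrightarrow> orient b z k > 0"
    and yz: "y \<in> X" "z \<in> X"
    using y z by (auto simp: succ_of_def)
  have yb: "y \<noteq> b" "z \<noteq> b" "y \<noteq> a" "z \<noteq> c" using y1 z1 by auto
  have nz: "orient b k l \<noteq> 0" if "k \<in> X" "l \<in> X" "k \<noteq> b" "l \<noteq> b" "k \<noteq> l" for k l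
    using orient_nonzero[of b k l] that X by auto
  show "y \<noteq> z"
  proof
    assume "y = z"
    then show False
      using y1 y2[of c] z1 z2[of a] sw[of c a] sw[of y c] sw[of y a] nz[of a c] X ne yb
      by (cases "orient b a c > 0") auto
  qed
  show n: "\<not> (y = c \<and> z = a)" using y1 z1 sw[of a c] by auto
  show "\<not> crossing {a, y} {c, z}"
  proof (cases "y = c \<or> z = a")
    case True
    then show ?thesis
    proof
      assume "y = c"
      then show ?thesis using not_crossing_shared[of c a z] X yz n yb ne by (simp add: insert_commute)
    next
      assume "z = a"
      then show ?thesis using not_crossing_shared[of a y c] X yz n yb ne by (simp add: insert_commute)
    qed
  next
    case False
    have s: "\<not> crossing {p, q} {r, s} \<Longrightarrow> \<not> crossing {r, s} {p, q}" for p q r s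
      by (simp add: crossing_commute)
    \<comment> \<open>In these cases the separating line is \<open>by\<close>, \<open>ba\<close>,
      none and \<open>bc\<close>. The third one cannot occur: \<open>a\<close> would lie between
      \<open>c\<close> and its successor \<open>z\<close>.\<close>
    consider "orient b y c > 0" "orient b y z > 0" | "orient b a c < 0" "orient b a z < 0"
      | "orient b a c < 0" "orient b y z > 0" "orient b a z > 0" | "orient b y c > 0" "orient b a c > 0" "orient b a z < 0"
      using y2[of c] y2[of z] nz[of a c] nz[of a z] nz[of y c] nz[of y z] X yz yb ne False \<open>y \<noteq> z\<close>
      by (metis linorder_neqE_linordered_idom)
    then show ?thesis
    proof cases
      case 1
      have "orient b y a \<le> 0" using y1 sw[of y a] by linarith
      then have "\<not> crossing {y, a} {c, z}"
        using 1 sw[of a y] by (intro s[OF not_crossing_strict[of y b]]) (auto simp: orient_def algebra_simps)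
      then show ?thesis by (simp add: insert_commute)
    next
      case 2
      then show ?thesis using y1 by (intro s[OF not_crossing_strict[of b a]]) auto
    next
      case 3
      have "orient b c a > 0" using 3 sw[of c a] by linarith
      then have "orient b z a > 0" using z2[of a] X False by auto
      then show ?thesis using 3 sw[of z a] by linarith
    next
      case 4
      have "orient b c a < 0" "orient b c y < 0" using 4 sw[of c a] sw[of c y] by linarith+
      then show ?thesis using z1 by (intro not_crossing_strict[of b c]) auto
    qed
  qed
qed

section \<open>Points in angular order around a hull vertex\<close>

definition hull_order :: "(real^2) list \<Rightarrow> bool" where
  "hull_order v \<longleftrightarrow> distinct v \<and> set v = X \<and>
     (\<forall>i j. 1 \<le> i \<longrightarrow> i < j \<longrightarrow> j < length v \<longrightarrow> orient (v ! 0) (v ! i) (v ! j) > 0)"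

text \<open>The root \<open>q\<close> is the uppermost of the leftmost points. All points to the
  right of the vertical line through \<open>q\<close> are on the positive side of the ray going
  straight down from \<open>q\<close>. By general position at most one more point lies on that line;
  it is below \<open>q\<close> and is put in front of the angular order.\<close>

lemma ex_hull_order:
  assumes "X \<noteq> {}"
  shows "\<exists>v. hull_order v"
proof -
  define m where "m = Min ((\<lambda>p. p$1) ` X)"
  define Y where "Y = {p\<in>X. p$1 = m}"
  have "m \<in> (\<lambda>p. p$1) ` X" unfolding m_def using assms finite_X by (intro Min_in) auto
  then have Y: "Y \<noteq> {}" "finite Y" unfolding Y_def using finite_X by auto
  have ge: "p$1 > m" if "p \<in> X" "p \<notin> Y" for p
  proof -
    have "m \<le> p$1" unfolding m_def using that finite_X by (intro Min_le) auto
    then show ?thesis using that unfolding Y_def by auto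
  qed
  have sorted_hull: "hull_order (a # xs)"
    if "a \<in> X" "distinct xs" "set xs = X - {a}" "sorted_wrt (\<lambda>k l. orient a k l > 0) xs" for a xs
    unfolding hull_order_def using that
    by (auto simp: sorted_wrt_iff_nth_less nth_Cons split: nat.split)
  obtain q where q: "q \<in> Y" "\<And>p. p \<in> Y \<Longrightarrow> p$2 \<le> q$2"
  proof -
    have "Max ((\<lambda>p. p$2) ` Y) \<in> (\<lambda>p. p$2) ` Y" using Y by (intro Max_in) auto
    then obtain q where "q \<in> Y" "q$2 = Max ((\<lambda>p. p$2) ` Y)" by auto
    then show ?thesis using Y that[of q] by simp
  qed
  have qX: "q \<in> X" "q$1 = m" using q Y_def by auto
  have nz: "orient q k l \<noteq> 0" if "k \<in> X - {q}" "l \<in> X - {q}" "k \<noteq> l" for k l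
    using orient_nonzero[of q k l] qX that by auto
  show ?thesis
  proof (cases "Y = {q}")
    case True
    let ?b = "\<chi> i. if i = 1 then q$1 else q$2 - 1"
    have "\<exists>xs. distinct xs \<and> set xs = X - {q} \<and> sorted_wrt (\<lambda>k l. orient q k l > 0) xs"
    proof (rule ex_angular_order[where b = ?b])
      show "orient q ?b k > 0" if "k \<in> X - {q}" for k
        using ge[of k] that True qX by (simp add: orient_def)
    qed (use finite_X nz in auto)
    then show ?thesis using sorted_hull qX by blast
  next
    case False
    then obtain b where b: "b \<in> Y" "b \<noteq> q" using q(1) by blast
    then have bX: "b \<in> X" "b$1 = m" "b$2 < q$2"
      using q(2)[of b] qX by (auto simp: Y_def vec_eq_iff forall_2)
    have o: "orient q b k = (q$2 - b$2) * (k$1 - m)" for k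
      using bX qX by (simp add: orient_def algebra_simps)
    have pos: "orient q b k > 0" if "k \<in> X - {q} - {b}" for k
    proof -
      have "orient q b k \<noteq> 0" using orient_nonzero[of q b k] that qX bX b by auto
      then have "k$1 \<noteq> m" unfolding o by auto
      then have "k$1 > m" using ge[of k] that by (auto simp: Y_def)
      then show ?thesis unfolding o using bX by simp
    qed
    obtain xs where xs: "distinct xs" "set xs = X - {q} - {b}" "sorted_wrt (\<lambda>k l. orient q k l > 0) xs"
      using ex_angular_order[of "X - {q} - {b}" q b] finite_X pos nz by blast
    have "hull_order (q # b # xs)"
      using xs pos bX b qX by (intro sorted_hull) auto
    then show ?thesis by blast
  qed
qed

lemma hull_order_nth:
  assumes "hull_order v"
  shows "i < length v \<Longrightarrow> v ! i \<in> X"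
    and "i < length v \<Longrightarrow> j < length v \<Longrightarrow> v ! i = v ! j \<longleftrightarrow> i = j"
    and "length v = card X"
  using assms distinct_card[of v] unfolding hull_order_def
  by (auto simp: nth_eq_iff_index_eq)

text \<open>If \<open>i' \<noteq> k\<close>, then the line through the root and
  \<open>v ! i'\<close> separates the two index ranges.\<close>

lemma hull_order_not_crossing:
  assumes v: "hull_order v" and "i < i'" "i' \<le> k" "k < k'" "k' < length v"
  shows "\<not> crossing {v ! i, v ! i'} {v ! k, v ! k'}"
proof (cases "i' = k")
  case True
  have "\<not> crossing {v ! k, v ! i} {v ! k, v ! k'}"
    using assms True hull_order_nth[OF v] by (intro not_crossing_shared) auto
  then show ?thesis using True by (simp add: insert_commute)
next
  case False
  have pos: "orient (v ! 0) (v ! s) (v ! t) > 0" if "1 \<le> s" "s < t" "t < length v" for s t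
    using v that unfolding hull_order_def by blast
  have "orient (v ! 0) (v ! i') (v ! i) \<le> 0"
    using pos[of i i'] assms orient_swap[of "v ! 0" "v ! i" "v ! i'"] by (cases "i = 0") auto
  then show ?thesis
    using assms False pos[of i' k] pos[of i' k']
    by (subst crossing_commute, intro not_crossing_strict[of "v ! i'" "v ! 0"])
      (auto simp: orient_def algebra_simps)
qed

text \<open>All points with index strictly between 0 and \<open>m\<close> lie on one side of the
  line that carries the first edge.\<close>

lemma hull_order_not_crossing_root:
  assumes v: "hull_order v" and "1 \<le> k" "k < k'" "k' \<le> m" "m < length v"
  shows "\<not> crossing {v ! 0, v ! m} {v ! k, v ! k'}"
proof (cases "k' = m")
  case True
  have "\<not> crossing {v ! m, v ! 0} {v ! m, v ! k}"
    using assms True hull_order_nth[OF v] by (intro not_crossing_shared) auto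
  then show ?thesis using True by (simp add: insert_commute)
next
  case False
  have pos: "orient (v ! 0) (v ! s) (v ! t) > 0" if "1 \<le> s" "s < t" "t < length v" for s t
    using v that unfolding hull_order_def by blast
  have "orient (v ! 0) (v ! m) (v ! k) < 0" "orient (v ! 0) (v ! m) (v ! k') < 0"
    using pos[of k m] pos[of k' m] assms False orient_swap[of "v ! 0" "v ! m"] by auto
  then show ?thesis
    by (subst crossing_commute, intro not_crossing_strict[of "v ! 0" "v ! m"]) auto
qed

end

lemma distinct_concat_upt:
  assumes "\<And>i. i < L \<Longrightarrow> distinct (B i)"
    and "\<And>i j. i < j \<Longrightarrow> j < L \<Longrightarrow> set (B i) \<inter> set (B j) = {}"
  shows "distinct (concat (map B [0..<L]))"
  using assms
proof (induction L)
  case (Suc L)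
  have "\<forall>i<L. \<forall>x\<in>set (B i). x \<notin> set (B L)" using Suc.prems(2)[of _ L] by blast
  then have "set (concat (map B [0..<L])) \<inter> set (B L) = {}" by auto
  then show ?case using Suc by auto
qed simp

lemma count_list_distinct: "distinct xs \<Longrightarrow> count_list xs x = (if x \<in> set xs then 1 else 0)"
  by (induction xs) auto

lemma plane_spanning_treeI:
  assumes "spanning_tree_on X T" "\<And>e f. e \<in> T \<Longrightarrow> f \<in> T \<Longrightarrow> e \<noteq> f \<Longrightarrow> \<not> crossing e f"
  shows "plane_spanning_tree X T"
  using assms unfolding plane_spanning_tree_def by (metis not_crossing_self)

subsection \<open>The 1-rainbow cycle\<close>

text \<open>Coding trees by parents of indices turns most flips into a change of one value. As long
  as parents have smaller indices, the tree determines the code, see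
  \<open>ptree_eq_imp_par_eq\<close>.\<close>

definition ptree :: "'a list \<Rightarrow> (nat \<Rightarrow> nat) \<Rightarrow> 'a set set" where
  "ptree v par = (\<lambda>i. {v ! i, v ! par i}) ` {1..<length v}"

lemma ptree_cong:
  "(\<And>i. 1 \<le> i \<Longrightarrow> i < length v \<Longrightarrow> par i = par' i) \<Longrightarrow> ptree v par = ptree v par'"
  unfolding ptree_def by (intro image_cong) auto

text \<open>The rank is a parameter because parents do not always have smaller indices: in
  \<open>parZ\<close> the vertex 1 hangs below 2.\<close>

lemma spanning_tree_ptree:
  assumes v: "distinct v" "set v = X" "v \<noteq> []"
    and par: "\<And>i. 1 \<le> i \<Longrightarrow> i < length v \<Longrightarrow> par i < length v \<and> rk (par i) < (rk i :: nat)"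
  shows "spanning_tree_on X (ptree v par)"
proof -
  define idx where "idx = inv_into {..<length v} ((!) v)"
  have inj: "inj_on ((!) v) {..<length v}" using v by (auto simp: inj_on_def nth_eq_iff_index_eq)
  then have idx: "idx (v ! i) = i" if "i < length v" for i
    using that unfolding idx_def by (intro inv_into_f_f) auto
  have X: "\<exists>i<length v. x = v ! i" if "x \<in> X" for x using v that by (auto simp: in_set_conv_nth)
  have X0: "X - {v ! 0} = (!) v ` {1..<length v}"
  proof -
    have "v ! i \<noteq> v ! 0" if "1 \<le> i" "i < length v" for i
      using that v nth_eq_iff_index_eq[of v i 0] by auto
    moreover have "x \<in> (!) v ` {1..<length v}" if "x \<in> X" "x \<noteq> v ! 0" for x
      using X[OF that(1)] that(2) by (metis One_nat_def atLeastLessThan_iff image_eqI less_one linorder_not_less)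
    ultimately show ?thesis using v by auto
  qed
  show ?thesis
  proof (rule spanning_tree_parentI[where r = "v ! 0" and par = "\<lambda>x. v ! par (idx x)" and rank = "\<lambda>x. rk (idx x)"])
    show "v ! 0 \<in> X" using v by auto
  next
    fix x assume x: "x \<in> X" "x \<noteq> v ! 0"
    then have "x \<in> (!) v ` {1..<length v}" using X0 by blast
    then obtain i where "1 \<le> i" "i < length v" "x = v ! i" by auto
    then show "v ! par (idx x) \<in> X \<and> rk (idx (v ! par (idx x))) < rk (idx x)"
      using par[of i] idx v by auto
  next
    show "ptree v par = (\<lambda>x. {x, v ! par (idx x)}) ` (X - {v ! 0})"
      unfolding X0 image_image ptree_def by (intro image_cong) (auto simp: idx)
  qed
qed

lemma ptree_edge_iff:
  assumes v: "distinct v" and i: "i < length v" and q: "q < i"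
    and par: "\<And>i. 1 \<le> i \<Longrightarrow> i < length v \<Longrightarrow> par i < i"
  shows "{v ! i, v ! q} \<in> ptree v par \<longleftrightarrow> q = par i"
proof
  assume "{v ! i, v ! q} \<in> ptree v par"
  then obtain k where k: "1 \<le> k" "k < length v" "{v ! i, v ! q} = {v ! k, v ! par k}"
    unfolding ptree_def by auto
  then have "par k < k" using par by auto
  then have "i = k \<and> q = par k"
    using k v i q by (auto simp: doubleton_eq_iff nth_eq_iff_index_eq)
  then show "q = par i" by auto
next
  assume "q = par i"
  then show "{v ! i, v ! q} \<in> ptree v par" using i q unfolding ptree_def by auto
qed

lemma flip_ptree_upd:
  assumes v: "distinct v" and i: "1 \<le> i" "i < length v" and q: "q < length v"
    and f: "{v ! i, v ! q} \<notin> ptree v par"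
    and par: "\<And>i. 1 \<le> i \<Longrightarrow> i < length v \<Longrightarrow> par i < length v \<and> rk (par i) < (rk i :: nat)"
  shows "flip (ptree v par) {v ! i, v ! q} (ptree v (par(i := q)))"
  unfolding flip_def
proof (intro conjI bexI)
  show "{v ! i, v ! par i} \<in> ptree v par" using i unfolding ptree_def by auto
  have inj: "{v ! j, v ! par j} \<noteq> {v ! i, v ! par i}" if "1 \<le> j" "j < length v" "j \<noteq> i" for j
    using par[of i] par[of j] that i v by (auto simp: doubleton_eq_iff nth_eq_iff_index_eq)
  have S: "{1..<length v} = insert i ({1..<length v} - {i})" using i by auto
  have "ptree v (par(i := q)) = insert {v ! i, v ! q} ((\<lambda>j. {v ! j, v ! par j}) ` ({1..<length v} - {i}))"
    unfolding ptree_def by (subst S, subst image_insert) (auto intro!: image_cong)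
  also have "(\<lambda>j. {v ! j, v ! par j}) ` ({1..<length v} - {i}) = ptree v par - {{v ! i, v ! par i}}"
    unfolding ptree_def using inj by auto
  finally show "ptree v (par(i := q)) = insert {v ! i, v ! q} (ptree v par - {{v ! i, v ! par i}})" .
qed (rule f)

lemma ptree_eq_imp_par_eq:
  assumes "ptree v par = ptree v par'" "distinct v" "1 \<le> i" "i < length v"
    and "\<And>i. 1 \<le> i \<Longrightarrow> i < length v \<Longrightarrow> par i < i"
    and "\<And>i. 1 \<le> i \<Longrightarrow> i < length v \<Longrightarrow> par' i < i"
  shows "par i = par' i"
  using assms ptree_edge_iff[of v i "par i" par] ptree_edge_iff[of v i "par i" par'] by auto

text \<open>\<open>Or j\<close> is the order in which the later points are moved from
  \<open>v ! j\<close> to \<open>v ! Suc j\<close>: new edges must not cross the old ones that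
  remain.\<close>

locale hull_points = points +
  fixes v :: "(real^2) list" and Or :: "nat \<Rightarrow> nat list"
  assumes hull: "hull_order v"
    and card3: "card X \<ge> 3"
    and Or: "\<And>j. j < card X - 2 \<Longrightarrow> distinct (Or j) \<and> set (Or j) = {j + 2..<card X} \<and>
      sorted_wrt (\<lambda>k l. \<not> crossing {v ! Suc j, v ! k} {v ! j, v ! l}) (Or j)"
begin

abbreviation "n \<equiv> card X"

lemma v: "distinct v" "set v = X" "length v = n" "v \<noteq> []"
  using hull hull_order_nth(3)[OF hull] card3 by (auto simp: hull_order_def)

lemma v_in [simp]: "i < n \<Longrightarrow> v ! i \<in> X"
  using v by auto

lemma v_eq [simp]: "i < n \<Longrightarrow> j < n \<Longrightarrow> v ! i = v ! j \<longleftrightarrow> i = j"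
  using v by (simp add: nth_eq_iff_index_eq)

lemma length_Or: "j < n - 2 \<Longrightarrow> length (Or j) = n - 2 - j"
  using Or[of j] distinct_card[of "Or j"] by auto

text \<open>The points up to \<open>v ! Suc j\<close> form a path; of the later ones the first
  \<open>t\<close> in the order \<open>Or j\<close> already hang at \<open>v ! Suc j\<close>, the
  others still at \<open>v ! j\<close>.\<close>

definition parA :: "nat \<Rightarrow> nat \<Rightarrow> nat \<Rightarrow> nat" where
  "parA j t i = (if i \<le> Suc j then i - 1 else if i \<in> set (take t (Or j)) then Suc j else j)"

text \<open>The edge from \<open>v ! 0\<close> to \<open>v ! 1\<close> belongs to the initial star
  and stays up to the path, yet it has to enter once. So it leaves when \<open>v ! 2\<close> is
  joined to \<open>v ! 0\<close>, and in this tree it is the one edge missing; it comes back in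
  place of the edge between \<open>v ! 1\<close> and \<open>v ! 2\<close>.\<close>

definition parZ :: "nat \<Rightarrow> nat" where
  "parZ i = (if i = 1 then 2 else if i = 2 then 0 else i - 1)"

definition parF :: "nat \<Rightarrow> nat \<Rightarrow> nat" where
  "parF k i = (if i \<le> k then 0 else i - 1)"

definition stage :: "nat \<Rightarrow> ((real^2) set set \<times> (real^2) set) list" where
  "stage j = map (\<lambda>t. (ptree v (parA j t), {v ! (Or j ! t), v ! Suc j})) [0..<n - 2 - j]"

text \<open>The list stops just before \<open>parF m\<close>. For \<open>m = n - 1\<close> that tree
  is the initial star and the cycle closes; for \<open>m = n - 2\<close> one edge at
  \<open>v ! 0\<close> is still missing, which is where the merged tour branches off.\<close>

definition cyc :: "nat \<Rightarrow> ((real^2) set set \<times> (real^2) set) list" where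
  "cyc m = concat (map stage [0..<n - 2]) @
     [(ptree v (parA (n - 2) 0), {v ! 2, v ! 0}), (ptree v parZ, {v ! 1, v ! 0})] @
     map (\<lambda>k. (ptree v (parF k), {v ! Suc k, v ! 0})) [2..<m]"

lemma parA_less: "1 \<le> i \<Longrightarrow> i < n \<Longrightarrow> parA j t i < i"
  by (auto simp: parA_def)

lemma parF_less: "1 \<le> i \<Longrightarrow> parF k i < i"
  by (auto simp: parF_def)

lemma plane_ptree:
  assumes "\<And>i. 1 \<le> i \<Longrightarrow> i < n \<Longrightarrow> par i < n \<and> rk (par i) < (rk i :: nat)"
    and "\<And>i j. 1 \<le> i \<Longrightarrow> i < j \<Longrightarrow> j < n \<Longrightarrow> \<not> crossing {v ! i, v ! par i} {v ! j, v ! par j}"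
  shows "plane_spanning_tree X (ptree v par)"
proof (rule plane_spanning_treeI)
  show "spanning_tree_on X (ptree v par)"
    using assms(1) v by (intro spanning_tree_ptree[where rk = rk]) auto
next
  fix e f assume ef: "e \<in> ptree v par" "f \<in> ptree v par" "e \<noteq> f"
  then obtain i j where "i \<in> {1..<n}" "e = {v ! i, v ! par i}" "j \<in> {1..<n}" "f = {v ! j, v ! par j}"
    unfolding ptree_def v(3) by (elim imageE) blast
  then show "\<not> crossing e f"
    using assms(2)[of i j] assms(2)[of j i] crossing_commute[of e f] ef(3)
    by (cases i j rule: linorder_cases) auto
qed

lemma nc_apart: "q \<noteq> i \<Longrightarrow> i \<le> k \<Longrightarrow> q \<le> k \<Longrightarrow> k < j \<Longrightarrow> j < n \<Longrightarrow> \<not> crossing {v ! i, v ! q} {v ! j, v ! k}"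
  using hull_order_not_crossing[OF hull, of i q k j] hull_order_not_crossing[OF hull, of q i k j] v
  by (cases "i < q") (auto simp: insert_commute)

lemma nc_shared:
  "i < n \<Longrightarrow> j < n \<Longrightarrow> q < n \<Longrightarrow> q \<noteq> i \<Longrightarrow> q \<noteq> j \<Longrightarrow> \<not> crossing {v ! i, v ! q} {v ! j, v ! q}"
  using not_crossing_shared[of "v ! q" "v ! i" "v ! j"] by (auto simp: insert_commute)

text \<open>Edges with index ranges that do not overlap never cross. What remains are an edge at
  \<open>v ! j\<close> and an edge at \<open>v ! Suc j\<close>, both leading to later points, and
  these are kept apart by \<open>Or j\<close>.\<close>

lemma plane_parA:
  assumes j: "j \<le> n - 2" and t: "t \<le> n - 2 - j"
  shows "plane_spanning_tree X (ptree v (parA j t))"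
proof (rule plane_ptree[where rk = id])
  fix i assume "1 \<le> i" "i < n"
  then show "parA j t i < n \<and> id (parA j t i) < id i" using parA_less[of i j t] by auto
next
  fix a b assume ab: "1 \<le> a" "a < b" "b < n"
  show "\<not> crossing {v ! a, v ! parA j t a} {v ! b, v ! parA j t b}"
  proof (cases "a \<le> parA j t b")
    case True
    then show ?thesis using ab parA_less[of a j t] parA_less[of b j t] by (intro nc_apart) auto
  next
    case False
    then have gt: "a > parA j t b" by simp
    then have b: "b > Suc j" using ab by (auto simp: parA_def split: if_splits)
    show ?thesis
    proof (cases "parA j t a = parA j t b")
      case True
      then show ?thesis using ab gt by (simp add: nc_shared)
    next
      case False
      then have a: "a > Suc j" using ab gt b by (auto simp: parA_def split: if_splits)
      then have j': "j < n - 2" using ab by auto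
      note O = Or[OF j']
      have key: "\<not> crossing {v ! Suc j, v ! k} {v ! j, v ! l}"
        if "k \<in> set (take t (Or j))" "l \<in> set (Or j)" "l \<notin> set (take t (Or j))" for k l
      proof -
        have "l \<in> set (drop t (Or j))" using that by (metis Un_iff append_take_drop_id set_append)
        then have "sorted_wrt (\<lambda>k l. \<not> crossing {v ! Suc j, v ! k} {v ! j, v ! l}) (take t (Or j) @ drop t (Or j))"
          using O by simp
        then show ?thesis using that(1) \<open>l \<in> set (drop t (Or j))\<close> unfolding sorted_wrt_append by blast
      qed
      have m: "a \<in> set (Or j)" "b \<in> set (Or j)" using O a b ab by auto
      show ?thesis
        using key[of a b] key[of b a] m False a b crossing_commute[of "{v ! Suc j, v ! b}"]
        by (auto simp: parA_def insert_commute split: if_splits)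
    qed
  qed
qed

lemma plane_parF: "plane_spanning_tree X (ptree v (parF k))"
proof (rule plane_ptree[where rk = id])
  fix i assume "1 \<le> i" "i < n"
  then show "parF k i < n \<and> id (parF k i) < id i" using parF_less[of i k] by auto
next
  fix a b assume ab: "1 \<le> a" "a < b" "b < n"
  show "\<not> crossing {v ! a, v ! parF k a} {v ! b, v ! parF k b}"
  proof (cases "parF k b = 0")
    case True
    then have "parF k a = 0" using ab by (auto simp: parF_def split: if_splits)
    then show ?thesis using True ab by (simp add: nc_shared)
  next
    case False
    then show ?thesis using ab parF_less[of a k]
      by (intro nc_apart) (auto simp: parF_def split: if_splits)
  qed
qed

lemma plane_parZ: "plane_spanning_tree X (ptree v parZ)"
proof (rule plane_ptree[where rk = "\<lambda>i. if i = 1 then 2 else if i = 2 then 1 else i"])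
  fix i assume "1 \<le> i" "i < n"
  then show "parZ i < n \<and> (if parZ i = 1 then 2 else if parZ i = 2 then 1 else parZ i)
      < (if i = 1 then 2 else if i = 2 then 1 else i)"
    using card3 by (auto simp: parZ_def)
next
  fix a b assume ab: "1 \<le> a" "a < b" "b < n"
  show "\<not> crossing {v ! a, v ! parZ a} {v ! b, v ! parZ b}"
  proof (cases "b = 2")
    case True
    then have "a = 1" using ab by auto
    then show ?thesis using True ab(3) nc_shared[of 1 0 2]
      by (simp add: parZ_def insert_commute)
  next
    case False
    then show ?thesis using ab by (intro nc_apart) (auto simp: parZ_def)
  qed
qed

lemma parA_last: "j < n - 2 \<Longrightarrow> ptree v (parA j (n - 2 - j)) = ptree v (parA (Suc j) 0)"
  using Or[of j] length_Or[of j] v(3) by (intro ptree_cong) (auto simp: parA_def)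

lemma flip_parA:
  assumes j: "j < n - 2" and t: "t < n - 2 - j"
  shows "flip (ptree v (parA j t)) {v ! (Or j ! t), v ! Suc j} (ptree v (parA j (Suc t)))"
proof -
  have l: "t < length (Or j)" using length_Or[OF j] t by simp
  then have m: "Or j ! t \<in> {j + 2..<n}" using Or[OF j] nth_mem by blast
  have nt: "Or j ! t \<notin> set (take t (Or j))"
    using Or[OF j] l by (auto simp: in_set_conv_nth nth_eq_iff_index_eq)
  have eq: "parA j (Suc t) = (parA j t)(Or j ! t := Suc j)"
    using m l by (auto simp: parA_def take_Suc_conv_app_nth fun_eq_iff)
  show ?thesis unfolding eq
  proof (rule flip_ptree_upd[where rk = id])
    show "{v ! (Or j ! t), v ! Suc j} \<notin> ptree v (parA j t)"
      using m v(1,3) nt parA_less by (subst ptree_edge_iff) (auto simp: parA_def)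
    show "parA j t i < length v \<and> id (parA j t i) < id i" if "1 \<le> i" "i < length v" for i
      using parA_less[of i j t] that v by auto
  qed (use m v in auto)
qed

lemma flip_path_cyc:
  assumes m: "2 \<le> m" "m \<le> n - 1"
  shows "flip_path X (cyc m) (ptree v (parF m))"
proof -
  have 1: "flip_path X (concat (map stage [0..<n - 2])) (ptree v (parA (n - 2) 0))"
  proof (rule flip_path_concat)
    fix j assume j: "j < n - 2"
    then show "stage j \<noteq> []" "fst (hd (stage j)) = ptree v (parA j 0)"
      by (auto simp: stage_def hd_map)
    show "flip_path X (stage j) (ptree v (parA (Suc j) 0))"
      unfolding stage_def parA_last[OF j, symmetric] using j plane_parA flip_parA
      by (intro flip_path_map_upt) auto
  qed
  have edge: "{v ! a, v ! b} = {v ! i, v ! k} \<longleftrightarrow> (a = i \<and> b = k \<or> a = k \<and> b = i)"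
    if "a < n" "b < n" "i < n" "k < n" for a b i k
    using that by (auto simp: doubleton_eq_iff)
  \<comment> \<open>Although only one edge is exchanged, two parents change: 1 moves from 0 to 2,
    and 2 from 1 to 0. Therefore \<open>flip_ptree_upd\<close> does not apply and the edge sets are
    compared directly.\<close>
  have 2: "flip (ptree v (parA (n - 2) 0)) {v ! 2, v ! 0} (ptree v parZ)"
  proof -
    have "ptree v parZ = insert {v ! 2, v ! 0} (ptree v (parA (n - 2) 0) - {{v ! 1, v ! 0}})"
    proof -
      have S: "{1..<n} = {1, 2} \<union> {3..<n}" using card3 by auto
      have "ptree v parZ = {{v ! 1, v ! 2}, {v ! 2, v ! 0}} \<union> (\<lambda>i. {v ! i, v ! (i - 1)}) ` {3..<n}"
        unfolding ptree_def v(3) S image_Un by (auto simp: parZ_def)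
      moreover have "ptree v (parA (n - 2) 0) = {{v ! 1, v ! 0}, {v ! 2, v ! 1}} \<union> (\<lambda>i. {v ! i, v ! (i - 1)}) ` {3..<n}"
      proof -
        have "ptree v (parA (n - 2) 0) = (\<lambda>i. {v ! i, v ! (i - 1)}) ` {1..<n}"
          unfolding ptree_def v(3) by (intro image_cong) (auto simp: parA_def)
        then show ?thesis unfolding S image_Un by simp
      qed
      moreover have "{v ! 1, v ! 0} \<notin> insert {v ! 2, v ! 1} ((\<lambda>i. {v ! i, v ! (i - 1)}) ` {3..<n})"
        using card3 by (auto simp: edge)
      ultimately show ?thesis by (auto simp: insert_commute)
    qed
    moreover have "{v ! 2, v ! 0} \<notin> ptree v (parA (n - 2) 0)"
      using card3 v(1,3) parA_less by (subst ptree_edge_iff) (auto simp: parA_def)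
    moreover have "{v ! 1, v ! 0} \<in> ptree v (parA (n - 2) 0)"
      using card3 v(1,3) parA_less by (subst ptree_edge_iff) (auto simp: parA_def)
    ultimately show ?thesis unfolding flip_def by blast
  qed
  have 3: "flip (ptree v parZ) {v ! 1, v ! 0} (ptree v (parF 2))"
  proof -
    have "ptree v (parZ(1 := 0)) = ptree v (parF 2)"
      by (intro ptree_cong) (auto simp: parZ_def parF_def)
    moreover have "flip (ptree v parZ) {v ! 1, v ! 0} (ptree v (parZ(1 := 0)))"
    proof (rule flip_ptree_upd[where rk = "\<lambda>i. if i = 1 then 2 else if i = 2 then 1 else i"])
      show "{v ! 1, v ! 0} \<notin> ptree v parZ"
        using card3 v(1,3) by (auto simp: ptree_def doubleton_eq_iff parZ_def)
    qed (use card3 v(1,3) in \<open>auto simp: parZ_def\<close>)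
    ultimately show ?thesis by simp
  qed
  have 4: "flip_path X (map (\<lambda>k. (ptree v (parF k), {v ! Suc k, v ! 0})) [2..<m]) (ptree v (parF m))"
  proof (rule flip_path_map_upt[OF plane_parF])
    fix k assume k: "2 \<le> k" "k < m"
    have eq: "parF (Suc k) = (parF k)(Suc k := 0)" by (auto simp: parF_def)
    show "flip (ptree v (parF k)) {v ! Suc k, v ! 0} (ptree v (parF (Suc k)))"
      unfolding eq
    proof (rule flip_ptree_upd[where rk = id])
      show "{v ! Suc k, v ! 0} \<notin> ptree v (parF k)"
        using k m v(1,3) parF_less by (subst ptree_edge_iff) (auto simp: parF_def)
      show "parF k i < length v \<and> id (parF k i) < id i" if "1 \<le> i" "i < length v" for i
        using parF_less[of i k] that v(3) by auto
    qed (use k m v(1,3) in auto)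
  qed
  have src: "source (map (\<lambda>k. (ptree v (parF k), {v ! Suc k, v ! 0})) [2..<m]) (ptree v (parF m)) = ptree v (parF 2)"
    using m by (cases "2 < m") (auto simp: upt_conv_Cons)
  show ?thesis
    unfolding cyc_def using 1 2 3 4 src card3 by (simp add: flip_path_append plane_parA plane_parZ)
qed

text \<open>During the stages the sum of all parents grows by one with every flip.
  \<open>parZ\<close> is the only tree without the edge from \<open>v ! 0\<close> to
  \<open>v ! 1\<close>. A fan differs from a tree of the first stage in the parent of the last
  vertex and from any later one in the parent of 2.\<close>

lemma distinct_cyc:
  assumes m: "2 \<le> m" "m \<le> n - 1"
  shows "distinct (map fst (cyc m))"
proof -
  define S where "S par = (\<Sum>i=1..<n. par i)" for par :: "nat \<Rightarrow> nat"
  have S_eq: "S par = S par'" if "ptree v par = ptree v par'"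
    "\<And>i. 1 \<le> i \<Longrightarrow> i < n \<Longrightarrow> par i < i" "\<And>i. 1 \<le> i \<Longrightarrow> i < n \<Longrightarrow> par' i < i" for par par'
    unfolding S_def using ptree_eq_imp_par_eq[OF that(1)] that v(1,3) by (intro sum.cong) auto
  have S_t: "S (parA j t) = S (parA j 0) + t" if j: "j < n - 2" and t: "t \<le> n - 2 - j" for j t
    using t
  proof (induction t)
    case (Suc t)
    then have l: "t < length (Or j)" using length_Or[OF j] by simp
    then have o: "Or j ! t \<in> {j + 2..<n}" using Or[OF j] nth_mem by blast
    have nt: "Or j ! t \<notin> set (take t (Or j))"
      using Or[OF j] l by (auto simp: in_set_conv_nth nth_eq_iff_index_eq)
    have eq: "parA j (Suc t) i = parA j t i + (if i = Or j ! t then 1 else 0)" for i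
      using o l nt by (auto simp: parA_def take_Suc_conv_app_nth)
    have "S (parA j (Suc t)) = S (parA j t) + 1"
      unfolding S_def eq sum.distrib using o by (simp add: sum.delta)
    then show ?case using Suc by simp
  qed simp
  have S_Suc: "S (parA (Suc j) 0) = S (parA j 0) + (n - 2 - j)" if "j < n - 2" for j
    using S_eq[OF parA_last[OF that]] parA_less S_t[OF that, of "n - 2 - j"] by auto
  have S_mono: "S (parA i 0) \<le> S (parA j 0)" if "i \<le> j" "j \<le> n - 2" for i j
    using that
  proof (induction j)
    case (Suc j)
    then show ?case using S_Suc[of j] by (cases "i = Suc j") auto
  qed simp
  have S_less: "S (parA i t) < S (parA j s)" if "i < j" "j \<le> n - 2" "t < n - 2 - i" "s \<le> n - 2 - j" for i j s t
  proof -
    have "S (parA i t) < S (parA (Suc i) 0)" using S_t[of i t] S_Suc[of i] that by auto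
    also have "\<dots> \<le> S (parA j 0)" using that by (intro S_mono) auto
    also have "\<dots> \<le> S (parA j s)" using S_t[of j s] that by (cases "j = n - 2") auto
    finally show ?thesis .
  qed
  have neqA: "ptree v (parA i t) \<noteq> ptree v (parA j s)"
    if "i < j" "j \<le> n - 2" "t < n - 2 - i" "s \<le> n - 2 - j" for i j s t
    using S_less[OF that] S_eq[of "parA i t" "parA j s"] parA_less by fastforce
  have d1: "distinct (concat (map (\<lambda>j. map fst (stage j)) [0..<n - 2]))"
  proof (rule distinct_concat_upt)
    fix j assume j: "j < n - 2"
    have "inj_on (\<lambda>t. ptree v (parA j t)) {0..<n - 2 - j}"
    proof (rule inj_onI)
      fix t s assume "t \<in> {0..<n - 2 - j}" "s \<in> {0..<n - 2 - j}" "ptree v (parA j t) = ptree v (parA j s)"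
      then show "t = s" using S_eq[of "parA j t" "parA j s"] S_t[OF j, of t] S_t[OF j, of s] parA_less by auto
    qed
    then show "distinct (map fst (stage j))"
      by (simp add: stage_def distinct_map comp_def)
  next
    fix i j assume "i < j" "j < n - 2"
    then show "set (map fst (stage i)) \<inter> set (map fst (stage j)) = {}"
      using neqA[of i j] by (auto simp: stage_def)
  qed
  let ?A = "\<Union>j<n - 2. (\<lambda>t. ptree v (parA j t)) ` {0..<n - 2 - j}"
  have setA: "set (concat (map (\<lambda>j. map fst (stage j)) [0..<n - 2])) = ?A"
    by (auto simp: stage_def)
  have edge10: "{v ! 1, v ! 0} \<in> ptree v par" if "\<And>i. 1 \<le> i \<Longrightarrow> i < n \<Longrightarrow> par i < i" for par
    using that[of 1] ptree_edge_iff[of v 1 0 par] that v(1,3) card3 by auto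
  have eA: "{v ! 1, v ! 0} \<in> ptree v (parA j t)" for j t by (rule edge10) (rule parA_less)
  have eF: "{v ! 1, v ! 0} \<in> ptree v (parF k)" for k by (rule edge10) (rule parF_less)
  have Z: "{v ! 1, v ! 0} \<notin> ptree v parZ"
    using card3 v(1,3) by (auto simp: ptree_def doubleton_eq_iff parZ_def)
  have nF: "ptree v (parF k) \<noteq> ptree v (parA j t)"
    if "2 \<le> k" "k < m" "j \<le> n - 2" "t < n - 2 - j \<or> j = n - 2" for k j t
  proof
    assume "ptree v (parF k) = ptree v (parA j t)"
    then have eq: "parF k i = parA j t i" if "1 \<le> i" "i < n" for i
      using ptree_eq_imp_par_eq[of v "parF k" "parA j t" i] that v(1,3) parF_less parA_less by auto
    have kn: "k < n - 1" using that m by auto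
    show False
    proof (cases "j = 0")
      case True
      then show ?thesis using eq[of "n - 1"] kn that by (auto simp: parF_def parA_def split: if_splits)
    next
      case False
      then show ?thesis using eq[of 2] kn that card3 by (auto simp: parF_def parA_def split: if_splits)
    qed
  qed
  have injF: "inj_on (\<lambda>k. ptree v (parF k)) {2..<m}"
  proof -
    have "ptree v (parF k) \<noteq> ptree v (parF l)" if "2 \<le> k" "k < l" "l < m" for k l
    proof
      assume "ptree v (parF k) = ptree v (parF l)"
      then have "parF k l = parF l l"
        using ptree_eq_imp_par_eq[of v "parF k" "parF l" l] that v(1,3) parF_less m by auto
      then show False using that by (auto simp: parF_def)
    qed
    then show ?thesis by (intro inj_onI) (metis atLeastLessThan_iff linorder_neqE_nat)
  qed
  define as where "as = concat (map (\<lambda>j. map fst (stage j)) [0..<n - 2])"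
  define bs where "bs = map (\<lambda>k. ptree v (parF k)) [2..<m]"
  have as: "T \<in> set as \<longleftrightarrow> (\<exists>j t. j < n - 2 \<and> t < n - 2 - j \<and> T = ptree v (parA j t))" for T
    unfolding as_def setA UN_iff image_iff Bex_def lessThan_iff atLeastLessThan_iff using zero_le by blast
  have bs: "T \<in> set bs \<longleftrightarrow> (\<exists>k. 2 \<le> k \<and> k < m \<and> T = ptree v (parF k))" for T
    unfolding bs_def by auto
  have "map fst (cyc m) = as @ [ptree v (parA (n - 2) 0), ptree v parZ] @ bs"
    by (simp add: cyc_def map_concat comp_def as_def bs_def)
  moreover have "distinct as" using d1 by (simp add: as_def)
  moreover have "distinct bs" using injF by (simp add: bs_def distinct_map)
  moreover have "ptree v (parA (n - 2) 0) \<notin> set as"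
    unfolding as using neqA[of _ "n - 2" _ 0] by fastforce
  moreover have "ptree v parZ \<notin> set as" unfolding as using Z eA by metis
  moreover have "ptree v parZ \<noteq> ptree v (parA (n - 2) 0)" using Z eA by metis
  moreover have "ptree v parZ \<notin> set bs" unfolding bs using Z eF by metis
  moreover have "set as \<inter> set bs = {}"
  proof -
    have "T \<notin> set bs" if T: "T \<in> set as" for T
    proof
      assume "T \<in> set bs"
      then obtain k where k: "2 \<le> k" "k < m" "T = ptree v (parF k)" unfolding bs by blast
      obtain j t where "j < n - 2" "t < n - 2 - j" "T = ptree v (parA j t)" using T unfolding as by blast
      then show False using nF[of k j t] k by auto
    qed
    then show ?thesis by blast
  qed
  moreover have "ptree v (parA (n - 2) 0) \<notin> set bs" unfolding bs using nF[of _ "n - 2" 0] by auto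
  ultimately show ?thesis by simp
qed

text \<open>Written as index pairs \<open>(i, q)\<close> with \<open>q < i\<close>, the labels of
  stage \<open>j\<close> are those with \<open>q = Suc j\<close>, and the remaining flips supply
  \<open>q = 0\<close>.\<close>

lemma count_cyc:
  assumes "f \<in> point_pairs X"
  shows "count_list (map snd (cyc (n - 1))) f = 1"
proof -
  define ps where "ps = concat (map (\<lambda>j. map (\<lambda>i. (i, Suc j)) (Or j)) [0..<n - 2]) @ [(2, 0), (1, 0)] @
     map (\<lambda>k. (Suc k, 0)) [2..<n - 1]"
  have st: "map snd (stage j) = map (\<lambda>i. {v ! i, v ! Suc j}) (Or j)" if "j < n - 2" for j
    using length_Or[OF that] by (intro nth_equalityI) (auto simp: stage_def)
  have labels: "map snd (cyc (n - 1)) = map (\<lambda>(i, q). {v ! i, v ! q}) ps"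
  proof -
    have "concat (map (\<lambda>j. map snd (stage j)) [0..<n - 2]) =
        concat (map (\<lambda>j. map (\<lambda>i. {v ! i, v ! Suc j}) (Or j)) [0..<n - 2])"
      using st by (intro arg_cong[of _ _ concat] map_cong) auto
    then show ?thesis by (simp add: cyc_def ps_def map_concat comp_def)
  qed
  have set_ps: "set ps = {(i, q). q < i \<and> i < n}"
  proof -
    have "(i, q) \<in> set ps" if "q < i" "i < n" for i q
    proof (cases q)
      case 0
      have "i = 1 \<or> i = 2 \<or> (i, 0) \<in> (\<lambda>k. (Suc k, 0)) ` {2..<n - 1}"
        using that by (cases i) (auto simp: image_iff)
      then show ?thesis using 0 unfolding ps_def set_append set_map set_upt by fastforce
    next
      case (Suc j)
      then have "j < n - 2" "i \<in> set (Or j)" using Or[of j] that by auto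
      then show ?thesis using Suc by (auto simp: ps_def)
    qed
    moreover have "q < i \<and> i < n" if "(i, q) \<in> set ps" for i q
      using that Or card3 by (auto simp: ps_def)
    ultimately show ?thesis by auto
  qed
  have "distinct (concat (map (\<lambda>j. map (\<lambda>i. (i, Suc j)) (Or j)) [0..<n - 2]))"
    using Or by (intro distinct_concat_upt) (auto simp: distinct_map inj_on_def)
  then have dist: "distinct ps"
    unfolding ps_def by (auto simp: distinct_map inj_on_def)
  have "inj_on (\<lambda>(i, q). {v ! i, v ! q}) (set ps)"
    unfolding set_ps by (rule inj_onI) (auto simp: doubleton_eq_iff)
  then have "distinct (map snd (cyc (n - 1)))" using dist labels by (simp add: distinct_map)
  moreover have "f \<in> set (map snd (cyc (n - 1)))"
  proof -
    obtain x y where xy: "f = {x, y}" "x \<noteq> y" "x \<in> X" "y \<in> X"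
      using assms by (auto simp: point_pairs_def card_2_iff)
    then obtain i j where ij: "i < n" "j < n" "x = v ! i" "y = v ! j"
      using v by (metis in_set_conv_nth)
    then have "i \<noteq> j" using xy by auto
    then have "(max i j, min i j) \<in> set ps" "f = {v ! max i j, v ! min i j}"
      using set_ps xy ij by (auto simp: max_def min_def insert_commute)
    then show ?thesis unfolding labels by force
  qed
  ultimately show ?thesis by (simp add: count_list_distinct)
qed

lemma parF_star: "ptree v (parF (n - 1)) = (\<lambda>x. {v ! 0, x}) ` (X - {v ! 0})"
proof -
  have "X - {v ! 0} = (!) v ` {1..<n}"
  proof
    show "X - {v ! 0} \<subseteq> (!) v ` {1..<n}"
    proof
      fix x assume "x \<in> X - {v ! 0}"
      then obtain i where i: "i < n" "x = v ! i" "i \<noteq> 0" using v by (metis DiffD1 DiffD2 in_set_conv_nth insertI1)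
      then show "x \<in> (!) v ` {1..<n}" by auto
    qed
  qed auto
  then show ?thesis
    unfolding ptree_def v(3) by (simp add: image_image parF_def insert_commute) (intro image_cong, auto simp: insert_commute)
qed

lemma parA_star: "ptree v (parA 0 0) = ptree v (parF (n - 1))"
  using v(3) by (intro ptree_cong) (auto simp: parA_def parF_def)

lemma hd_cyc: "fst (hd (cyc m)) = ptree v (parA 0 0)"
  using card3 by (simp add: cyc_def upt_conv_Cons stage_def)

lemma rainbow_one: "\<exists>p. rainbow_cycle X 1 p"
proof (rule rainbow_cycleI)
  show "cyc (n - 1) \<noteq> []" by (simp add: cyc_def)
  show "flip_path X (cyc (n - 1)) (fst (hd (cyc (n - 1))))"
    unfolding hd_cyc parA_star using card3 by (intro flip_path_cyc) auto
  show "distinct (map fst (cyc (n - 1)))" using card3 by (intro distinct_cyc) auto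
qed (rule count_cyc)

end

text \<open>A sweep orders all points but its two centres; deleting the indices below
  \<open>j + 2\<close> preserves the condition on the pairs that are left.\<close>

lemma (in points) ex_hull_points:
  assumes "card X \<ge> 3"
  shows "\<exists>v Or. hull_points X v Or"
proof -
  have "X \<noteq> {}" using assms by auto
  then obtain v where v: "hull_order v" using ex_hull_order by blast
  then have v': "distinct v" "set v = X" "length v = card X"
    using hull_order_nth(3)[OF v] by (auto simp: hull_order_def)
  define idx where "idx = inv_into {..<length v} ((!) v)"
  have inj: "inj_on ((!) v) {..<length v}" using v' by (auto simp: inj_on_def nth_eq_iff_index_eq)
  have X: "X = (!) v ` {..<length v}" using v' by (auto simp: in_set_conv_nth)
  have idx: "idx x < length v" "v ! idx x = x" if "x \<in> X" for x
    using that inv_into_into[of x "(!) v" "{..<length v}"] f_inv_into_f[of x "(!) v" "{..<length v}"]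
    unfolding X idx_def by auto
  have idx': "idx (v ! i) = i" if "i < length v" for i
    using inj that unfolding idx_def by (intro inv_into_f_f) auto
  define Or where "Or j = filter (\<lambda>i. i \<ge> j + 2) (map idx (sweep X (v ! j) (v ! Suc j)))" for j
  have "distinct (Or j) \<and> set (Or j) = {j + 2..<card X} \<and>
      sorted_wrt (\<lambda>k l. \<not> crossing {v ! Suc j, v ! k} {v ! j, v ! l}) (Or j)" if j: "j < card X - 2" for j
  proof -
    let ?s = "sweep X (v ! j) (v ! Suc j)"
    have "v ! j \<in> X" "v ! Suc j \<in> X" "v ! j \<noteq> v ! Suc j"
      using hull_order_nth(1,2)[OF v] j v' by auto
    then have s: "is_sweep X (v ! j) (v ! Suc j) ?s" by (rule is_sweep_sweep)
    then have sX: "set ?s \<subseteq> X" and ds: "distinct ?s" by (auto simp: is_sweep_def)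
    have "inj_on idx X" by (metis idx(2) inj_onI)
    then have 1: "distinct (Or j)"
      unfolding Or_def using ds sX \<open>inj_on idx X\<close> by (simp add: distinct_map inj_on_subset)
    have 2: "set (Or j) = {j + 2..<card X}"
    proof -
      have "i \<in> idx ` set ?s" if "j + 2 \<le> i" "i < card X" for i
      proof -
        have "v ! i \<in> X - {v ! j, v ! Suc j}"
          using that v' hull_order_nth(1,2)[OF v] j by auto
        then have "v ! i \<in> set ?s" using s by (auto simp: is_sweep_def)
        then show ?thesis using idx'[of i] that v' by (metis imageI)
      qed
      moreover have "idx x < card X" if "x \<in> set ?s" for x using idx(1) sX that v' by auto
      ultimately show ?thesis by (auto simp: Or_def)
    qed
    have "sorted_wrt (\<lambda>k l. \<not> crossing {v ! Suc j, k} {v ! j, l}) ?s"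
      using s unfolding sorted_wrt_iff_nth_less is_sweep_def by blast
    then have "sorted_wrt (\<lambda>k l. \<not> crossing {v ! Suc j, v ! idx k} {v ! j, v ! idx l}) ?s"
      using idx(2) sX by (elim sorted_wrt_mono_rel[rotated]) (metis subsetD)
    then have "sorted_wrt (\<lambda>k l. \<not> crossing {v ! Suc j, v ! k} {v ! j, v ! l}) (map idx ?s)"
      by (simp add: sorted_wrt_map)
    then show ?thesis using 1 2 unfolding Or_def by (intro conjI sorted_wrt_filter) auto
  qed
  then have "hull_points X v Or"
    using v assms finite_X gp by unfold_locales auto
  then show ?thesis by blast
qed

subsection \<open>Stars and trees close to stars\<close>

definition star :: "'a \<Rightarrow> 'a set \<Rightarrow> 'a set set" where
  "star b A = (\<lambda>k. {b, k}) ` A"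

definition double_star :: "'a \<Rightarrow> 'a \<Rightarrow> 'a set \<Rightarrow> 'a set \<Rightarrow> 'a set set" where
  "double_star a b A B = insert {a, b} (star a A \<union> star b B)"

text \<open>The trees in which \<open>ab\<close> is missing: the centres are joined through
  \<open>k\<close>, which is adjacent to both.\<close>

definition linked_stars :: "'a \<Rightarrow> 'a \<Rightarrow> 'a \<Rightarrow> 'a set \<Rightarrow> 'a set \<Rightarrow> 'a set set" where
  "linked_stars a b k A B = star a (insert k A) \<union> star b (insert k B)"

text \<open>One flip away from the star at \<open>b\<close>: only \<open>y\<close> hangs at
  \<open>a\<close> instead. These are the first and the last trees of a move.\<close>

definition near_star :: "'a set \<Rightarrow> 'a \<Rightarrow> 'a \<Rightarrow> 'a \<Rightarrow> 'a set set" where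
  "near_star X b y a = insert {a, y} (star b (X - {b, y}))"

text \<open>Two points of the star at \<open>b\<close> are rehung at the same time, \<open>y\<close>
  at the centre \<open>a\<close> that the tour comes from and \<open>z\<close> at the centre
  \<open>c\<close> that it goes to.\<close>

definition detour_star :: "'a set \<Rightarrow> 'a \<Rightarrow> 'a \<Rightarrow> 'a \<Rightarrow> 'a \<Rightarrow> 'a \<Rightarrow> 'a set set" where
  "detour_star X b y a z c = insert {a, y} (insert {c, z} (star b (X - {b, y, z})))"

definition nbrs :: "'a set set \<Rightarrow> 'a \<Rightarrow> 'a set" where
  "nbrs T v = {u. {v, u} \<in> T}"

text \<open>For a tree these are the inner vertices. Spines are the main means of showing that two
  trees differ.\<close>

definition spine :: "'a set set \<Rightarrow> 'a set" where
  "spine T = {v. 2 \<le> card (nbrs T v)}"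

definition heavy :: "'a set set \<Rightarrow> 'a set" where
  "heavy T = {v. 3 \<le> card (nbrs T v)}"

lemma star_insert [simp]: "star b (insert x A) = insert {b, x} (star b A)"
  by (simp add: star_def)

lemma star_empty [simp]: "star b {} = {}"
  by (simp add: star_def)

lemma edge_star: "{x, u} \<in> star b A \<longleftrightarrow> (x = b \<and> u \<in> A) \<or> (u = b \<and> x \<in> A)"
  by (auto simp: star_def doubleton_eq_iff)

lemma star_flip: "(\<lambda>k. {k, b}) ` A = star b A"
  by (simp add: star_def insert_commute)

lemmas edge_simps = double_star_def linked_stars_def near_star_def detour_star_def edge_star doubleton_eq_iff

lemma flipI:
  assumes "T = insert e R" "T' = insert f R" "e \<notin> R" "f \<notin> R" "e \<noteq> f"
  shows "flip T f T'"
  unfolding flip_def using assms by auto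

text \<open>The direct way of moving \<open>x\<close> from \<open>a\<close> to \<open>b\<close>, and
  the way with the extra flip: first \<open>bx\<close> enters and \<open>ab\<close> leaves, then
  \<open>ab\<close> returns in place of \<open>ax\<close>.\<close>

lemma
  assumes "x \<notin> A" "x \<notin> B" "x \<noteq> a" "x \<noteq> b" "a \<noteq> b" "a \<notin> B" "b \<notin> A"
  shows flip_double_star: "flip (double_star a b (insert x A) B) {b, x} (double_star a b A (insert x B))"
    and flip_to_linked: "flip (double_star a b (insert x A) B) {b, x} (linked_stars a b x A B)"
    and flip_from_linked: "flip (linked_stars a b x A B) {a, b} (double_star a b A (insert x B))"
proof -
  show "flip (double_star a b (insert x A) B) {b, x} (double_star a b A (insert x B))"
    by (rule flipI[where e = "{a, x}" and R = "double_star a b A B"])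
      (use assms in \<open>auto simp: edge_simps\<close>)
  show "flip (double_star a b (insert x A) B) {b, x} (linked_stars a b x A B)"
    by (rule flipI[where e = "{a, b}" and R = "star a (insert x A) \<union> star b B"])
      (use assms in \<open>auto simp: edge_simps\<close>)
  show "flip (linked_stars a b x A B) {a, b} (double_star a b A (insert x B))"
    by (rule flipI[where e = "{a, x}" and R = "star a A \<union> star b (insert x B)"])
      (use assms in \<open>auto simp: edge_simps\<close>)
qed

lemma
  assumes "b \<in> X" "y \<in> X" "a \<in> X" "y \<noteq> b" "a \<noteq> b" "a \<noteq> y"
  shows flip_near_star_star: "flip (near_star X b y a) {b, y} (star b (X - {b}))"
    and flip_star_near_star: "flip (star b (X - {b})) {a, y} (near_star X b y a)"
proof -
  have X: "X - {b} = insert y (X - {b, y})" using assms by auto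
  show "flip (near_star X b y a) {b, y} (star b (X - {b}))"
    by (rule flipI[where e = "{a, y}" and R = "star b (X - {b, y})"])
      (use assms in \<open>auto simp: edge_simps X\<close>)
  show "flip (star b (X - {b})) {a, y} (near_star X b y a)"
    by (rule flipI[where e = "{b, y}" and R = "star b (X - {b, y})"])
      (use assms in \<open>auto simp: edge_simps X\<close>)
qed

text \<open>The passage that avoids the star: \<open>cz\<close> enters before \<open>by\<close>
  does. In the opposite order the tree in between would be the star at \<open>b\<close>.\<close>

lemma
  assumes "b \<in> X" "y \<in> X" "a \<in> X" "z \<in> X" "c \<in> X" "y \<noteq> b" "a \<noteq> b" "a \<noteq> y" "z \<noteq> b" "c \<noteq> b" "c \<noteq> z"
    and "y \<noteq> z" "a \<noteq> c" "\<not> (y = c \<and> z = a)"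
  shows flip_near_star_detour: "flip (near_star X b y a) {c, z} (detour_star X b y a z c)"
    and flip_detour_near_star: "flip (detour_star X b y a z c) {b, y} (near_star X b z c)"
proof -
  have X: "X - {b, y} = insert z (X - {b, y, z})" "X - {b, z} = insert y (X - {b, y, z})"
    using assms by auto
  show "flip (near_star X b y a) {c, z} (detour_star X b y a z c)"
    unfolding near_star_def detour_star_def X
    by (rule flipI[where e = "{b, z}" and R = "insert {a, y} (star b (X - {b, y, z}))"])
      (use assms in \<open>auto simp: edge_simps\<close>)
  show "flip (detour_star X b y a z c) {b, y} (near_star X b z c)"
    unfolding near_star_def detour_star_def X
    by (rule flipI[where e = "{a, y}" and R = "insert {c, z} (star b (X - {b, y, z}))"])
      (use assms in \<open>auto simp: edge_simps\<close>)
qed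

lemma near_star_eq_double_star:
  assumes "a \<in> X" "b \<in> X" "y \<in> X" "a \<noteq> b" "y \<noteq> a" "y \<noteq> b"
  shows "near_star X b y a = double_star a b {y} (X - {a, b, y})"
    and "near_star X b y a = double_star b a (X - {a, b, y}) {y}"
proof -
  have X: "X - {b, y} = insert a (X - {a, b, y})" using assms by auto
  show "near_star X b y a = double_star a b {y} (X - {a, b, y})"
    "near_star X b y a = double_star b a (X - {a, b, y}) {y}"
    unfolding near_star_def double_star_def X by (auto simp: insert_commute)
qed

section \<open>Degree invariants of trees close to stars\<close>

lemma spine_double_star:
  assumes "finite A" "finite B" "A \<noteq> {}" "B \<noteq> {}" "A \<inter> B = {}" "a \<notin> A" "a \<notin> B" "b \<notin> A" "b \<notin> B" "a \<noteq> b"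
  shows "spine (double_star a b A B) = {a, b}" "card (nbrs (double_star a b A B) b) = Suc (card B)"
proof -
  let ?T = "double_star a b A B"
  have a: "nbrs ?T a = insert b A" using assms by (auto simp: nbrs_def edge_simps)
  have b: "nbrs ?T b = insert a B" using assms by (auto simp: nbrs_def edge_simps)
  have o: "nbrs ?T x \<subseteq> {if x \<in> A then a else b}" if "x \<noteq> a" "x \<noteq> b" for x
    using assms that by (auto simp: nbrs_def edge_simps)
  have "card (nbrs ?T x) \<le> 1" if "x \<noteq> a" "x \<noteq> b" for x
    using card_mono[OF _ o[OF that]] by simp
  moreover have "card A > 0" "card B > 0" using assms by (auto simp: card_gt_0_iff)
  then have "card (nbrs ?T a) \<ge> 2" "card (nbrs ?T b) \<ge> 2" using assms by (auto simp: a b)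
  ultimately show "spine ?T = {a, b}" unfolding spine_def by fastforce
  show "card (nbrs ?T b) = Suc (card B)" using assms by (simp add: b)
qed

lemma linked_stars_nbrs:
  assumes "finite A" "finite B" "A \<noteq> {}" "B \<noteq> {}" "A \<inter> B = {}"
    "a \<notin> A" "a \<notin> B" "b \<notin> A" "b \<notin> B" "a \<noteq> b" "k \<notin> A" "k \<notin> B" "k \<noteq> a" "k \<noteq> b"
  shows "spine (linked_stars a b k A B) = {a, b, k}"
    "card (nbrs (linked_stars a b k A B) a) = Suc (card A)"
    "card (nbrs (linked_stars a b k A B) b) = Suc (card B)"
    "card (nbrs (linked_stars a b k A B) k) = 2"
    "{a, b} \<notin> linked_stars a b k A B" "{a, k} \<in> linked_stars a b k A B" "{b, k} \<in> linked_stars a b k A B"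
proof -
  let ?T = "linked_stars a b k A B"
  have a: "nbrs ?T a = insert k A" using assms by (auto simp: nbrs_def edge_simps)
  have b: "nbrs ?T b = insert k B" using assms by (auto simp: nbrs_def edge_simps)
  have k: "nbrs ?T k = {a, b}" using assms by (auto simp: nbrs_def edge_simps)
  have o: "nbrs ?T x \<subseteq> {if x \<in> A then a else b}" if "x \<noteq> a" "x \<noteq> b" "x \<noteq> k" for x
    using assms that by (auto simp: nbrs_def edge_simps)
  have "card (nbrs ?T x) \<le> 1" if "x \<noteq> a" "x \<noteq> b" "x \<noteq> k" for x
    using card_mono[OF _ o[OF that]] by simp
  moreover have "card A > 0" "card B > 0" using assms by (auto simp: card_gt_0_iff)
  then have "card (nbrs ?T a) \<ge> 2" "card (nbrs ?T b) \<ge> 2" "card (nbrs ?T k) \<ge> 2"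
    using assms by (auto simp: a b k)
  ultimately show "spine ?T = {a, b, k}" unfolding spine_def by fastforce
  show "card (nbrs ?T a) = Suc (card A)" "card (nbrs ?T b) = Suc (card B)" "card (nbrs ?T k) = 2"
    using assms by (auto simp: a b k)
  show "{a, b} \<notin> ?T" "{a, k} \<in> ?T" "{b, k} \<in> ?T" using assms by (auto simp: edge_simps)
qed

text \<open>Three of at least six points are not adjacent to \<open>b\<close>, namely
  \<open>b\<close>, \<open>y\<close> and \<open>z\<close>, so \<open>b\<close> keeps degree at least
  three, while \<open>a\<close> and \<open>c\<close> have degree two. The coincidences
  \<open>z = a\<close> and \<open>y = c\<close> are allowed one at a time; they change neighbours
  but not these degrees.\<close>

lemma detour_star_nbrs:
  assumes fin: "finite X" "card X \<ge> 6"
    and X: "b \<in> X" "y \<in> X" "a \<in> X" "z \<in> X" "c \<in> X" "y \<noteq> b" "a \<noteq> b" "a \<noteq> y" "z \<noteq> b" "c \<noteq> b" "c \<noteq> z"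
      "y \<noteq> z" "a \<noteq> c" "\<not> (y = c \<and> z = a)"
  shows "spine (detour_star X b y a z c) = {a, b, c}" "heavy (detour_star X b y a z c) = {b}"
proof -
  let ?T = "detour_star X b y a z c"
  have b: "nbrs ?T b = X - {b, y, z}" using X by (auto simp: nbrs_def edge_simps)
  have "card (X - {b, y, z}) = card X - 3"
    using X fin by (subst card_Diff_subset) auto
  then have cb: "card (nbrs ?T b) \<ge> 3" using fin by (simp add: b)
  have a: "nbrs ?T a = (if z = a then {y, c} else {y, b})" using X by (auto simp: nbrs_def edge_simps)
  have c: "nbrs ?T c = (if y = c then {z, a} else {z, b})" using X by (auto simp: nbrs_def edge_simps)
  have ca: "card (nbrs ?T a) = 2" "card (nbrs ?T c) = 2" using X by (auto simp: a c)
  have o: "nbrs ?T x \<subseteq> {if x = y then a else if x = z then c else b}" if "x \<notin> {a, b, c}" for x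
    using X that by (auto simp: nbrs_def edge_simps)
  have co: "card (nbrs ?T x) \<le> 1" if "x \<notin> {a, b, c}" for x
    using card_mono[OF _ o[OF that]] by simp
  have "x \<in> spine ?T \<longleftrightarrow> x \<in> {a, b, c}" for x
    using co[of x] cb ca by (cases "x \<in> {a, b, c}") (auto simp: spine_def)
  then show "spine ?T = {a, b, c}" by blast
  have "x \<in> heavy ?T \<longleftrightarrow> x \<in> {b}" for x
    using co[of x] cb ca by (cases "x \<in> {a, b, c}") (auto simp: heavy_def)
  then show "heavy ?T = {b}" by blast
qed

lemma spine_star:
  assumes "finite X" "card X \<ge> 3" "b \<in> X"
  shows "spine (star b (X - {b})) = {b}"
proof -
  let ?T = "star b (X - {b})"
  have b: "nbrs ?T b = X - {b}" by (auto simp: nbrs_def edge_simps)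
  have o: "nbrs ?T x \<subseteq> {b}" if "x \<noteq> b" for x using that by (auto simp: nbrs_def edge_simps)
  have "card (nbrs ?T x) \<le> 1" if "x \<noteq> b" for x using card_mono[OF _ o[OF that]] by simp
  moreover have "card (nbrs ?T b) \<ge> 2" using assms by (simp add: b)
  ultimately show ?thesis unfolding spine_def by fastforce
qed

section \<open>Planarity of trees close to stars\<close>

context points
begin

lemma star_subset: "b \<in> X \<Longrightarrow> A \<subseteq> X - {b} \<Longrightarrow> star b A \<subseteq> point_pairs X"
  by (auto simp: star_def point_pairs_def card_insert_if)

text \<open>In general position edges with a common end point do not cross, so only an edge at
  \<open>a\<close> against one at \<open>b\<close> has to be examined.\<close>

lemma plane_double_star:
  assumes ab: "a \<in> X" "b \<in> X" "a \<noteq> b" and AB: "A \<union> B = X - {a, b}" "A \<inter> B = {}"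
    and nc: "\<And>k l. k \<in> A \<Longrightarrow> l \<in> B \<Longrightarrow> \<not> crossing {b, l} {a, k}"
  shows "plane_spanning_tree X (double_star a b A B)"
proof (rule plane_spanning_treeI)
  define par where "par v = (if v = b then a else if v \<in> B then b else a)" for v
  have X: "X - {a} = insert b (A \<union> B)" using ab AB by auto
  have "(\<lambda>v. {v, par v}) ` A = (\<lambda>v. {v, a}) ` A" using AB by (intro image_cong) (auto simp: par_def)
  moreover have "(\<lambda>v. {v, par v}) ` B = (\<lambda>v. {v, b}) ` B" using AB by (intro image_cong) (auto simp: par_def)
  ultimately have T: "double_star a b A B = (\<lambda>v. {v, par v}) ` (X - {a})"
    unfolding X image_insert image_Un double_star_def star_flip by (simp add: par_def insert_commute)
  show "spanning_tree_on X (double_star a b A B)"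
    by (rule spanning_tree_parentI[OF ab(1) _ T, where rank = "\<lambda>v. if v = a then 0 else if v = b then 1 else 2"])
      (use ab AB in \<open>auto simp: par_def\<close>)
next
  fix e f assume ef: "e \<in> double_star a b A B" "f \<in> double_star a b A B" "e \<noteq> f"
  have sub: "double_star a b A B \<subseteq> point_pairs X"
    using star_subset[of a "insert b A"] star_subset[of b B] ab AB by (auto simp: double_star_def)
  show "\<not> crossing e f"
  proof (cases "e \<inter> f = {}")
    case True
    then show ?thesis
      using ef nc crossing_commute[of e f] by (auto simp: double_star_def star_def)
  next
    case False
    then show ?thesis using not_crossing_meet ef sub by blast
  qed
qed

lemma plane_linked_stars:
  assumes ab: "a \<in> X" "b \<in> X" "a \<noteq> b" "k \<in> X" "k \<noteq> a" "k \<noteq> b"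
    and AB: "A \<union> B = X - {a, b, k}" "A \<inter> B = {}"
    and nc: "\<And>x l. x \<in> insert k A \<Longrightarrow> l \<in> insert k B \<Longrightarrow> x \<noteq> l \<Longrightarrow> \<not> crossing {b, l} {a, x}"
  shows "plane_spanning_tree X (linked_stars a b k A B)"
proof (rule plane_spanning_treeI)
  define par where "par v = (if v = b then k else if v \<in> B then b else a)" for v
  have X: "X - {a} = insert b (insert k (A \<union> B))" using ab AB by auto
  have "(\<lambda>v. {v, par v}) ` A = (\<lambda>v. {v, a}) ` A" using AB by (intro image_cong) (auto simp: par_def)
  moreover have "(\<lambda>v. {v, par v}) ` B = (\<lambda>v. {v, b}) ` B" using AB by (intro image_cong) (auto simp: par_def)
  moreover have "k \<notin> B" using AB by auto
  ultimately have T: "linked_stars a b k A B = (\<lambda>v. {v, par v}) ` (X - {a})"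
    unfolding X image_insert image_Un linked_stars_def star_flip using ab by (auto simp: par_def insert_commute)
  show "spanning_tree_on X (linked_stars a b k A B)"
    by (rule spanning_tree_parentI[OF ab(1) _ T,
          where rank = "\<lambda>v. if v = a then 0 else if v = k then 1 else if v = b then 2 else 3"])
      (use ab AB in \<open>auto simp: par_def\<close>)
next
  fix e f assume ef: "e \<in> linked_stars a b k A B" "f \<in> linked_stars a b k A B" "e \<noteq> f"
  have sub: "linked_stars a b k A B \<subseteq> point_pairs X"
    using star_subset[of a "insert k A"] star_subset[of b "insert k B"] ab AB
    by (auto simp: linked_stars_def)
  show "\<not> crossing e f"
  proof (cases "e \<inter> f = {}")
    case True
    have "\<exists>x\<in>insert k A. e = {a, x} \<or> (\<exists>x\<in>insert k B. e = {b, x})"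
      "(\<exists>x\<in>insert k A. f = {a, x}) \<or> (\<exists>x\<in>insert k B. f = {b, x})"
      using ef by (auto simp: linked_stars_def star_def)
    then consider x l where "x \<in> insert k A" "l \<in> insert k B" "e = {a, x}" "f = {b, l}"
      | x l where "x \<in> insert k A" "l \<in> insert k B" "f = {a, x}" "e = {b, l}"
      using True by blast
    then show ?thesis
      by cases (use nc True crossing_commute[of e f] in \<open>auto simp del: insert_iff\<close>)
  next
    case False
    then show ?thesis using not_crossing_meet ef sub by blast
  qed
qed

lemma plane_star:
  assumes "b \<in> X" "card X \<ge> 2"
  shows "plane_spanning_tree X (star b (X - {b}))"
proof -
  have "X \<noteq> {b}" using assms by auto
  then obtain a where a: "a \<in> X" "a \<noteq> b" using assms by auto
  have "star b (X - {b}) = double_star a b {} (X - {a, b})"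
  proof -
    have "X - {b} = insert a (X - {a, b})" using a by auto
    then show ?thesis by (simp add: double_star_def insert_commute)
  qed
  then show ?thesis using plane_double_star[of a b "{}" "X - {a, b}"] a assms by auto
qed

lemma plane_detour_star:
  assumes X: "b \<in> X" "y \<in> X" "a \<in> X" "z \<in> X" "c \<in> X" "y \<noteq> b" "a \<noteq> b" "a \<noteq> y" "z \<noteq> b" "c \<noteq> b" "c \<noteq> z"
      "y \<noteq> z" "a \<noteq> c" "\<not> (y = c \<and> z = a)"
    and y: "\<And>k. k \<in> X \<Longrightarrow> k \<noteq> b \<Longrightarrow> k \<noteq> a \<Longrightarrow> k \<noteq> y \<Longrightarrow> \<not> crossing {b, k} {a, y}"
    and z: "\<And>k. k \<in> X \<Longrightarrow> k \<noteq> b \<Longrightarrow> k \<noteq> c \<Longrightarrow> k \<noteq> z \<Longrightarrow> \<not> crossing {b, k} {c, z}"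
    and yz: "\<not> crossing {a, y} {c, z}"
  shows "plane_spanning_tree X (detour_star X b y a z c)"
proof (rule plane_spanning_treeI)
  define par where "par v = (if v = y then a else if v = z then c else b)" for v
  have X': "X - {b} = insert y (insert z (X - {b, y, z}))" using X by auto
  have "(\<lambda>v. {v, par v}) ` (X - {b, y, z}) = (\<lambda>v. {v, b}) ` (X - {b, y, z})"
    by (intro image_cong) (auto simp: par_def)
  then have T: "detour_star X b y a z c = (\<lambda>v. {v, par v}) ` (X - {b})"
    unfolding X' image_insert detour_star_def star_flip using X by (auto simp: par_def insert_commute)
  \<comment> \<open>If \<open>a = z\<close>, then \<open>y\<close> hangs below \<open>z\<close>, and
    if \<open>c = y\<close>, then \<open>z\<close> hangs below \<open>y\<close>; the lower of the
    two gets rank 3. Both at once are excluded by assumption.\<close>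
  show "spanning_tree_on X (detour_star X b y a z c)"
    by (rule spanning_tree_parentI[OF X(1) _ T, where rank = "\<lambda>v. if v = b then 0
          else if v = y then (if a = z then 3 else 2) else if v = z then (if c = y then 3 else 2) else 1"])
      (use X in \<open>auto simp: par_def\<close>)
next
  fix e f assume ef: "e \<in> detour_star X b y a z c" "f \<in> detour_star X b y a z c" "e \<noteq> f"
  have pp: "{a, y} \<in> point_pairs X" "{c, z} \<in> point_pairs X" using X by (auto simp: point_pairs_def)
  have sub: "detour_star X b y a z c \<subseteq> point_pairs X"
    using star_subset[of b "X - {b, y, z}"] X pp by (auto simp: detour_star_def)
  show "\<not> crossing e f"
  proof (cases "e \<inter> f = {}")
    case True
    have y': "\<not> crossing {b, k} {a, y}" "\<not> crossing {a, y} {b, k}" if "k \<in> X - {b, y, z}" "{b, k} \<inter> {a, y} = {}" for k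
      using y[of k] that crossing_commute[of "{b, k}"] by auto
    have z': "\<not> crossing {b, k} {c, z}" "\<not> crossing {c, z} {b, k}" if "k \<in> X - {b, y, z}" "{b, k} \<inter> {c, z} = {}" for k
      using z[of k] that crossing_commute[of "{b, k}"] by auto
    have yz': "\<not> crossing {c, z} {a, y}" using yz crossing_commute by blast
    have "e = {a, y} \<or> e = {c, z} \<or> (\<exists>k\<in>X - {b, y, z}. e = {b, k})"
      "f = {a, y} \<or> f = {c, z} \<or> (\<exists>k\<in>X - {b, y, z}. f = {b, k})"
      using ef by (auto simp: detour_star_def star_def)
    then show ?thesis using True y' z' yz yz' by (elim disjE bexE) (simp_all, blast+)
  next
    case False
    then show ?thesis using not_crossing_meet ef sub by blast
  qed
qed

end

subsection \<open>Moving from star to star\<close>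

context points
begin

abbreviation "N \<equiv> card X - 2"

definition stage_tree :: "real^2 \<Rightarrow> real^2 \<Rightarrow> nat \<Rightarrow> (real^2) set set" where
  "stage_tree a b t = double_star a b (set (drop t (sweep X a b))) (set (take t (sweep X a b)))"

text \<open>The place of the extra flip. An early place leaves \<open>a\<close> with degree at least
  three, a late one \<open>b\<close>. The early one is taken if the link point is left of
  \<open>ab\<close> and the late one otherwise; this correlation is what separates link trees from
  detour stars in \<open>detour_not_link\<close>.\<close>

definition loc :: "real^2 \<Rightarrow> real^2 \<Rightarrow> nat" where
  "loc a b = (if orient a b (sweep X a b ! 1) > 0 then 2 else N - 1)"

text \<open>The point at position \<open>loc a b - 1\<close> hangs at both centres, so this tree
  comes between the stages \<open>loc a b - 1\<close> and \<open>loc a b\<close>.\<close>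

definition link_tree :: "real^2 \<Rightarrow> real^2 \<Rightarrow> (real^2) set set" where
  "link_tree a b = linked_stars a b (sweep X a b ! (loc a b - 1))
     (set (drop (loc a b) (sweep X a b))) (set (take (loc a b - 1) (sweep X a b)))"

text \<open>Position 0 and the last position are left out: the first edge at \<open>b\<close> enters
  in the connection before the move, and the last one in the connection after it. \<open>md\<close>
  switches the extra flip on.\<close>

definition core :: "bool \<Rightarrow> real^2 \<Rightarrow> real^2 \<Rightarrow> ((real^2) set set \<times> (real^2) set) list" where
  "core md a b =
     map (\<lambda>t. (stage_tree a b t, {b, sweep X a b ! t})) [1..<loc a b] @
     (if md then [(link_tree a b, {a, b})] else []) @
     map (\<lambda>t. (stage_tree a b t, {b, sweep X a b ! t})) [loc a b..<N - 1]"

end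

locale move = points +
  fixes a b :: "real^2"
  assumes card6: "card X \<ge> 6" and ab: "a \<in> X" "b \<in> X" "a \<noteq> b"
begin

abbreviation "sw \<equiv> sweep X a b"

lemma is_sw: "is_sweep X a b sw"
  using is_sweep_sweep ab by blast

lemma sw: "distinct sw" "set sw = X - {a, b}" "length sw = N"
proof -
  show d: "distinct sw" "set sw = X - {a, b}" using is_sw by (auto simp: is_sweep_def)
  have "card (X - {a, b}) = N" using ab finite_X by (subst card_Diff_subset) auto
  then show "length sw = N" using distinct_card[OF d(1)] d(2) by simp
qed

lemma sw_nth: "i < N \<Longrightarrow> sw ! i \<in> X" "i < N \<Longrightarrow> sw ! i \<noteq> a" "i < N \<Longrightarrow> sw ! i \<noteq> b"
  using nth_mem[of i sw] sw by auto

lemma not_crossing_sw: "i < j \<Longrightarrow> j < N \<Longrightarrow> \<not> crossing {b, sw ! i} {a, sw ! j}"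
  using is_sw sw(3) unfolding is_sweep_def by auto

lemma in_take_drop:
  "x \<in> set (take t sw) \<longleftrightarrow> (\<exists>i<N. i < t \<and> x = sw ! i)"
  "x \<in> set (drop t sw) \<longleftrightarrow> (\<exists>i<N. t \<le> i \<and> x = sw ! i)"
proof -
  show "x \<in> set (take t sw) \<longleftrightarrow> (\<exists>i<N. i < t \<and> x = sw ! i)"
    by (auto simp: in_set_conv_nth sw(3))
  show "x \<in> set (drop t sw) \<longleftrightarrow> (\<exists>i<N. t \<le> i \<and> x = sw ! i)"
  proof
    assume "x \<in> set (drop t sw)"
    then obtain j where "j < length (drop t sw)" "x = drop t sw ! j" by (metis in_set_conv_nth)
    then show "\<exists>i<N. t \<le> i \<and> x = sw ! i" using sw(3) by (intro exI[of _ "t + j"]) auto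
  next
    assume "\<exists>i<N. t \<le> i \<and> x = sw ! i"
    then obtain i where "i < N" "t \<le> i" "x = sw ! i" by blast
    then have "i - t < length (drop t sw)" "drop t sw ! (i - t) = x" using sw(3) by auto
    then show "x \<in> set (drop t sw)" by (metis nth_mem)
  qed
qed

lemma take_drop_partition:
  "set (drop t sw) \<union> set (take t sw) = X - {a, b}" "set (drop t sw) \<inter> set (take t sw) = {}"
proof -
  show "set (drop t sw) \<union> set (take t sw) = X - {a, b}"
    using sw(2) append_take_drop_id[of t sw] by (metis set_append sup_commute)
  show "set (drop t sw) \<inter> set (take t sw) = {}"
    using set_take_disj_set_drop_if_distinct[OF sw(1), of t t] by auto
qed

text \<open>For \<open>s = Suc t\<close> the two parts share the point at position \<open>t\<close>;
  this is the situation of the link tree.\<close>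

lemma not_crossing_take_drop:
  assumes "k \<in> set (drop t sw)" "l \<in> set (take s sw)" "s \<le> Suc t" "k \<noteq> l"
  shows "\<not> crossing {b, l} {a, k}"
proof -
  obtain i j where "i < N" "t \<le> i" "k = sw ! i" "j < N" "j < s" "l = sw ! j"
    using assms by (auto simp: in_take_drop)
  moreover have "j \<noteq> i" using assms(4) calculation by auto
  ultimately show ?thesis using assms(3) not_crossing_sw[of j i] by simp
qed

lemma loc_bounds: "2 \<le> loc a b" "loc a b \<le> N - 1"
  using card6 by (auto simp: loc_def)

lemma split_drop: "t < N \<Longrightarrow> set (drop t sw) = insert (sw ! t) (set (drop (Suc t) sw))"
  using sw(3) Cons_nth_drop_Suc[of t sw] by (metis list.simps(15))

lemma split_take: "t < N \<Longrightarrow> set (take (Suc t) sw) = insert (sw ! t) (set (take t sw))"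
  using sw(3) by (simp add: take_Suc_conv_app_nth)

lemma fresh: "t < N \<Longrightarrow> sw ! t \<notin> set (drop (Suc t) sw)" "t < N \<Longrightarrow> sw ! t \<notin> set (take t sw)"
  unfolding in_take_drop using nth_eq_iff_index_eq[OF sw(1)] sw(3) by auto

lemma not_in: "a \<notin> set (take t sw)" "b \<notin> set (take t sw)" "a \<notin> set (drop t sw)" "b \<notin> set (drop t sw)"
  using take_drop_partition(1)[of t] by auto

lemma plane_stage_tree: "plane_spanning_tree X (stage_tree a b t)"
  unfolding stage_tree_def using take_drop_partition[of t]
  by (intro plane_double_star ab not_crossing_take_drop[of _ t _ t]) auto

lemma link_sets:
  "insert (sw ! (loc a b - 1)) (set (drop (loc a b) sw)) = set (drop (loc a b - 1) sw)"
  "insert (sw ! (loc a b - 1)) (set (take (loc a b - 1) sw)) = set (take (loc a b) sw)"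
  "sw ! (loc a b - 1) \<notin> set (drop (loc a b) sw)" "sw ! (loc a b - 1) \<notin> set (take (loc a b - 1) sw)"
proof -
  have l: "loc a b - 1 < N" "Suc (loc a b - 1) = loc a b" using loc_bounds card6 by auto
  show "insert (sw ! (loc a b - 1)) (set (drop (loc a b) sw)) = set (drop (loc a b - 1) sw)"
    "insert (sw ! (loc a b - 1)) (set (take (loc a b - 1) sw)) = set (take (loc a b) sw)"
    "sw ! (loc a b - 1) \<notin> set (drop (loc a b) sw)" "sw ! (loc a b - 1) \<notin> set (take (loc a b - 1) sw)"
    using split_drop[OF l(1)] split_take[OF l(1)] fresh[OF l(1)] l(2) by simp_all
qed

lemma plane_link_tree: "plane_spanning_tree X (link_tree a b)"
  unfolding link_tree_def
proof (rule plane_linked_stars)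
  have l: "loc a b - 1 < N" using loc_bounds card6 by auto
  show "sw ! (loc a b - 1) \<in> X" "sw ! (loc a b - 1) \<noteq> a" "sw ! (loc a b - 1) \<noteq> b" using sw_nth[OF l] .
  show "set (drop (loc a b) sw) \<union> set (take (loc a b - 1) sw) = X - {a, b, sw ! (loc a b - 1)}"
    using take_drop_partition[of "loc a b"] link_sets by auto
  show "set (drop (loc a b) sw) \<inter> set (take (loc a b - 1) sw) = {}"
    using take_drop_partition[of "loc a b"] link_sets by auto
  show "\<not> crossing {b, l} {a, x}" if "x \<in> insert (sw ! (loc a b - 1)) (set (drop (loc a b) sw))"
    "l \<in> insert (sw ! (loc a b - 1)) (set (take (loc a b - 1) sw))" "x \<noteq> l" for x l
    using that loc_bounds unfolding link_sets by (intro not_crossing_take_drop[of x "loc a b - 1" l "loc a b"]) auto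
qed (rule ab)+

lemma flip_stage:
  assumes "t < N"
  shows "flip (stage_tree a b t) {b, sw ! t} (stage_tree a b (Suc t))"
  unfolding stage_tree_def split_drop[OF assms] split_take[OF assms]
  using fresh[OF assms] sw_nth[OF assms] not_in ab by (intro flip_double_star) auto

lemma flip_stage_link: "flip (stage_tree a b (loc a b - 1)) {b, sw ! (loc a b - 1)} (link_tree a b)"
  and flip_link_stage: "flip (link_tree a b) {a, b} (stage_tree a b (loc a b))"
proof -
  have l: "loc a b - 1 < N" using loc_bounds card6 by auto
  show "flip (stage_tree a b (loc a b - 1)) {b, sw ! (loc a b - 1)} (link_tree a b)"
    unfolding stage_tree_def link_tree_def link_sets(1)[symmetric]
    using link_sets(3,4) sw_nth[OF l] not_in ab by (intro flip_to_linked) auto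
  show "flip (link_tree a b) {a, b} (stage_tree a b (loc a b))"
    unfolding stage_tree_def link_tree_def link_sets(2)[symmetric]
    using link_sets(3,4) sw_nth[OF l] not_in ab by (intro flip_from_linked) auto
qed

lemma flip_path_core: "flip_path X (core md a b) (stage_tree a b (N - 1))"
proof -
  let ?l = "loc a b"
  note l = loc_bounds
  have 2: "flip_path X (map (\<lambda>t. (stage_tree a b t, {b, sw ! t})) [?l..<N - 1]) (stage_tree a b (N - 1))"
    using plane_stage_tree flip_stage by (intro flip_path_map_upt) auto
  have src: "source (map (\<lambda>t. (stage_tree a b t, {b, sw ! t})) [?l..<N - 1]) (stage_tree a b (N - 1)) = stage_tree a b ?l"
  proof (cases "?l < N - 1")
    case False
    then have "?l = N - 1" using l by simp
    then show ?thesis by simp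
  qed (simp add: upt_conv_Cons)
  show ?thesis
  proof (cases md)
    case False
    have "flip_path X (map (\<lambda>t. (stage_tree a b t, {b, sw ! t})) [1..<?l]) (stage_tree a b ?l)"
      using plane_stage_tree flip_stage l by (intro flip_path_map_upt) auto
    then show ?thesis using 2 src False by (simp add: core_def flip_path_append)
  next
    case True
    \<comment> \<open>Replacing the stage at position \<open>?l\<close> by the link tree lets the
      first run of flips end there; the extra flip then leads from it to the genuine stage.\<close>
    let ?T = "\<lambda>t. if t = ?l then link_tree a b else stage_tree a b t"
    have "flip_path X (map (\<lambda>t. (?T t, {b, sw ! t})) [1..<?l]) (?T ?l)"
    proof (rule flip_path_map_upt)
      fix t assume t: "1 \<le> t" "t < ?l"
      then show "flip (?T t) {b, sw ! t} (?T (Suc t))"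
      proof (cases "Suc t = ?l")
        case True
        then have "t = ?l - 1" by simp
        then have "flip (stage_tree a b t) {b, sw ! t} (link_tree a b)" using flip_stage_link by simp
        then show ?thesis using t True by simp
      next
        case False
        then show ?thesis using flip_stage[of t] t l by simp
      qed
    qed (use plane_stage_tree plane_link_tree in auto)
    then have fp: "flip_path X (map (\<lambda>t. (?T t, {b, sw ! t})) [1..<?l]) (link_tree a b)" by simp
    have eq: "map (\<lambda>t. (?T t, {b, sw ! t})) [1..<?l] = map (\<lambda>t. (stage_tree a b t, {b, sw ! t})) [1..<?l]"
      by (rule map_cong) auto
    have "flip_path X (map (\<lambda>t. (stage_tree a b t, {b, sw ! t})) [1..<?l]) (link_tree a b)"
      using fp unfolding eq .
    then show ?thesis using 2 src True plane_link_tree flip_link_stage by (simp add: core_def flip_path_append)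
  qed
qed

lemma hd_last_sw: "hd sw = sw ! 0" "last sw = sw ! (N - 1)"
proof -
  have "sw \<noteq> []" using sw(3) card6 by auto
  then show "hd sw = sw ! 0" "last sw = sw ! (N - 1)" using sw(3) by (auto simp: hd_conv_nth last_conv_nth)
qed

lemma stage_tree_first: "stage_tree a b 1 = near_star X a (hd sw) b"
proof -
  have 0: "0 < N" using card6 by auto
  have "set (take 1 sw) = {sw ! 0}" using split_take[OF 0] by simp
  moreover have "set (drop 1 sw) = X - {b, a, sw ! 0}"
    using take_drop_partition[of 1] calculation by auto
  ultimately show ?thesis
    using near_star_eq_double_star(2)[of b X a "sw ! 0"] sw_nth[OF 0] ab
    by (simp add: stage_tree_def hd_last_sw)
qed

lemma stage_tree_last: "stage_tree a b (N - 1) = near_star X b (last sw) a"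
proof -
  have 0: "N - 1 < N" "Suc (N - 1) = N" using card6 by auto
  have "set (drop (N - 1) sw) = {sw ! (N - 1)}" using split_drop[OF 0(1)] 0(2) sw(3) by simp
  moreover have "set (take (N - 1) sw) = X - {a, b, sw ! (N - 1)}"
    using take_drop_partition[of "N - 1"] calculation by auto
  ultimately show ?thesis
    using near_star_eq_double_star(1)[of a X b "sw ! (N - 1)"] sw_nth[OF 0(1)] ab
    by (simp add: stage_tree_def hd_last_sw)
qed

text \<open>The spine gives back the unordered pair of centres, and the degree of \<open>b\<close>
  the number of the stage.\<close>

lemma stage_spine:
  assumes "1 \<le> t" "t \<le> N - 1"
  shows "spine (stage_tree a b t) = {a, b}" "card (nbrs (stage_tree a b t) b) = Suc t"
proof -
  have ne: "set (drop t sw) \<noteq> {}" "set (take t sw) \<noteq> {}" using assms sw(3) card6 by auto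
  have "card (set (take t sw)) = t" using sw assms by (subst distinct_card) auto
  then show "spine (stage_tree a b t) = {a, b}" "card (nbrs (stage_tree a b t) b) = Suc t"
    unfolding stage_tree_def using spine_double_star[OF _ _ ne _ not_in(3,1,4,2) ab(3)] take_drop_partition(2)
    by auto
qed

lemma link_props:
  defines "k \<equiv> sw ! (loc a b - 1)"
  shows "spine (link_tree a b) = {a, b, k}"
    "card (nbrs (link_tree a b) a) = Suc (N - loc a b)" "card (nbrs (link_tree a b) b) = loc a b"
    "card (nbrs (link_tree a b) k) = 2"
    "{a, b} \<notin> link_tree a b" "{a, k} \<in> link_tree a b" "{b, k} \<in> link_tree a b" "k \<in> X" "k \<noteq> a" "k \<noteq> b"
proof -
  have l: "loc a b - 1 < N" using loc_bounds card6 by auto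
  show k: "k \<in> X" "k \<noteq> a" "k \<noteq> b" using sw_nth[OF l] unfolding k_def by auto
  have ne: "set (drop (loc a b) sw) \<noteq> {}" "set (take (loc a b - 1) sw) \<noteq> {}"
    using loc_bounds sw(3) card6 by auto
  have disj: "set (drop (loc a b) sw) \<inter> set (take (loc a b - 1) sw) = {}"
    using take_drop_partition[of "loc a b"] link_sets by auto
  have c: "card (set (drop (loc a b) sw)) = N - loc a b" "card (set (take (loc a b - 1) sw)) = loc a b - 1"
    using sw l by (auto simp: distinct_card)
  note * = linked_stars_nbrs[OF _ _ ne disj not_in(3,1,4,2) ab(3) link_sets(3,4) k(2,3)[unfolded k_def], folded link_tree_def]
  show "spine (link_tree a b) = {a, b, k}"
    "card (nbrs (link_tree a b) a) = Suc (N - loc a b)" "card (nbrs (link_tree a b) b) = loc a b"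
    "card (nbrs (link_tree a b) k) = 2"
    "{a, b} \<notin> link_tree a b" "{a, k} \<in> link_tree a b" "{b, k} \<in> link_tree a b"
    using * loc_bounds unfolding k_def c by auto
qed

lemma spine_link_card: "card (spine (link_tree a b)) = 3"
proof -
  have "a \<noteq> sw ! (loc a b - 1)" "b \<noteq> sw ! (loc a b - 1)" using link_props(9,10) by simp_all
  then show ?thesis unfolding link_props(1) using ab(3) by simp
qed

text \<open>In a sweep the points left of \<open>ab\<close> come first. If the second point is not
  among them, then neither is the last but one, which is the link point for the late
  position.\<close>

lemma loc_side:
  "loc a b = 2 \<Longrightarrow> orient a b (sw ! (loc a b - 1)) > 0"
  "loc a b \<noteq> 2 \<Longrightarrow> loc a b = N - 1 \<and> orient a b (sw ! (loc a b - 1)) \<le> 0"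
proof -
  show "loc a b = 2 \<Longrightarrow> orient a b (sw ! (loc a b - 1)) > 0"
    using card6 by (auto simp: loc_def split: if_splits)
  assume *: "loc a b \<noteq> 2"
  then have 1: "\<not> orient a b (sw ! 1) > 0" "loc a b = N - 1" by (auto simp: loc_def split: if_splits)
  have "\<not> orient a b (sw ! (N - 2)) > 0"
  proof
    assume "orient a b (sw ! (N - 2)) > 0"
    moreover have "1 < N - 2" "N - 2 < length sw" using card6 sw(3) by auto
    ultimately have "orient a b (sw ! 1) > 0" using is_sw unfolding is_sweep_def by blast
    then show False using 1 by simp
  qed
  then show "loc a b = N - 1 \<and> orient a b (sw ! (loc a b - 1)) \<le> 0"
    using 1 by (simp add: diff_diff_add numeral_eq_Suc)
qed

lemma core_trees: "T \<in> set (map fst (core md a b)) \<Longrightarrow> T = link_tree a b \<or> (\<exists>t. 1 \<le> t \<and> t < N - 1 \<and> T = stage_tree a b t)"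
proof -
  assume "T \<in> set (map fst (core md a b))"
  moreover have "set (map fst (core md a b)) \<subseteq> insert (link_tree a b) (stage_tree a b ` ({1..<loc a b} \<union> {loc a b..<N - 1}))"
    by (auto simp: core_def image_Un)
  moreover have "{1..<loc a b} \<union> {loc a b..<N - 1} \<subseteq> {1..<N - 1}" using loc_bounds by auto
  ultimately have "T \<in> insert (link_tree a b) (stage_tree a b ` {1..<N - 1})" by blast
  then show ?thesis by auto
qed

lemma stage_inj: "1 \<le> t \<Longrightarrow> t \<le> N - 1 \<Longrightarrow> 1 \<le> s \<Longrightarrow> s \<le> N - 1 \<Longrightarrow> stage_tree a b t = stage_tree a b s \<Longrightarrow> t = s"
  using stage_spine(2)[of t] stage_spine(2)[of s] by (metis Suc_inject)

lemma stage_not_link: "1 \<le> t \<Longrightarrow> t \<le> N - 1 \<Longrightarrow> stage_tree a b t \<noteq> link_tree a b"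
proof
  assume "1 \<le> t" "t \<le> N - 1" "stage_tree a b t = link_tree a b"
  then have "card {a, b} = 3" using stage_spine(1)[of t] spine_link_card by simp
  then show False using ab(3) by simp
qed

lemma distinct_core: "distinct (map fst (core md a b @ [(stage_tree a b (N - 1), f)]))"
proof -
  let ?st = "stage_tree a b"
  have sp: "[1..<N] = [1..<loc a b] @ [loc a b..<N]" "[loc a b..<N] = [loc a b..<N - 1] @ [N - 1]"
  proof -
    show "[1..<N] = [1..<loc a b] @ [loc a b..<N]"
      using upt_add_eq_append[of 1 "loc a b" "N - loc a b"] loc_bounds by simp
    have "N = Suc (N - 1)" using card6 by simp
    then show "[loc a b..<N] = [loc a b..<N - 1] @ [N - 1]" using loc_bounds by (metis upt_Suc)
  qed
  have "inj_on ?st (set [1..<N])" by (rule inj_onI) (use stage_inj in auto)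
  then have "distinct (map ?st [1..<N])" by (simp add: distinct_map)
  then have d: "distinct (map ?st [1..<loc a b] @ map ?st [loc a b..<N - 1] @ [?st (N - 1)])"
    unfolding sp by simp
  have "link_tree a b \<notin> ?st ` set [1..<N]" using stage_not_link by fastforce
  then have "link_tree a b \<notin> set (map ?st [1..<loc a b] @ map ?st [loc a b..<N - 1] @ [?st (N - 1)])"
    unfolding sp by (simp add: image_Un)
  moreover have "map fst (core md a b @ [(?st (N - 1), f)]) =
      map ?st [1..<loc a b] @ (if md then [link_tree a b] else []) @ map ?st [loc a b..<N - 1] @ [?st (N - 1)]"
    by (simp add: core_def comp_def)
  ultimately show ?thesis using d by (cases md) simp_all
qed

text \<open>Together with the first and the last edge, which enter in the connections, a move lets
  every edge at \<open>b\<close> enter once, with \<open>ab\<close> depending on the extra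
  flip.\<close>

lemma count_core:
  assumes f: "f \<in> point_pairs X"
  shows "count_list (map snd (core md a b)) f +
    (if f = {b, hd sw} then 1 else 0) + (if f = {b, last sw} then 1 else 0) =
    (if b \<in> f \<and> (md \<or> f \<noteq> {a, b}) then 1 else 0)"
proof -
  let ?g = "\<lambda>t. {b, sw ! t}"
  have sp: "[0..<N] = 0 # ([1..<loc a b] @ [loc a b..<N - 1]) @ [N - 1]"
  proof -
    have "[1..<loc a b] @ [loc a b..<N - 1] = [1..<N - 1]"
      using upt_add_eq_append[of 1 "loc a b" "N - 1 - loc a b"] loc_bounds by simp
    moreover have "N = Suc (N - 1)" using card6 by simp
    then have "[0..<N] = [0..<N - 1] @ [N - 1]" by (metis upt_Suc zero_le)
    moreover have "[0..<N - 1] = 0 # [1..<N - 1]" using card6 by (simp add: upt_conv_Cons)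
    ultimately show ?thesis by simp
  qed
  have m: "map ?g [0..<N] = map (\<lambda>k. {b, k}) sw"
    using sw(3) by (intro nth_equalityI) auto
  have "distinct (map (\<lambda>k. {b, k}) sw)"
    using sw by (auto simp: distinct_map inj_on_def doubleton_eq_iff)
  moreover have "f \<in> set (map (\<lambda>k. {b, k}) sw) \<longleftrightarrow> b \<in> f \<and> f \<noteq> {a, b}"
  proof -
    obtain x y where "f = {x, y}" "x \<noteq> y" "x \<in> X" "y \<in> X"
      using f by (auto simp: point_pairs_def card_2_iff)
    then show ?thesis using sw(2) ab by (auto simp: doubleton_eq_iff image_iff)
  qed
  ultimately have "count_list (map ?g [0..<N]) f = (if b \<in> f \<and> f \<noteq> {a, b} then 1 else 0)"
    unfolding m by (simp add: count_list_distinct)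
  then have 1: "count_list (map ?g [1..<loc a b] @ map ?g [loc a b..<N - 1]) f +
      (if f = ?g 0 then 1 else 0) + (if f = ?g (N - 1) then 1 else 0) = (if b \<in> f \<and> f \<noteq> {a, b} then 1 else 0)"
    unfolding sp by (simp add: count_list_append split: if_splits)
  have 2: "count_list (map snd (core md a b)) f =
      count_list (map ?g [1..<loc a b] @ map ?g [loc a b..<N - 1]) f + (if md \<and> f = {a, b} then 1 else 0)"
    by (simp add: core_def comp_def count_list_append)
  have 3: "(if b \<in> f \<and> f \<noteq> {a, b} then 1 else 0) + (if md \<and> f = {a, b} then 1 else 0) =
      (if b \<in> f \<and> (md \<or> f \<noteq> {a, b}) then 1 else (0::nat))"
    by auto
  show ?thesis unfolding hd_last_sw 2 3[symmetric] 1[symmetric] by (simp only: ac_simps)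
qed

lemma hd_core: "core md a b \<noteq> []" "fst (hd (core md a b)) = stage_tree a b 1"
  using loc_bounds by (auto simp: core_def upt_conv_Cons)

end

subsection \<open>Tours of stars\<close>

text \<open>If the spine is a path on three vertices, these are its end points. For a link tree they
  are the two centres, so that these can be recovered from it.\<close>

definition ends :: "'a set set \<Rightarrow> 'a set" where
  "ends T = {x\<in>spine T. \<exists>u\<in>spine T. u \<noteq> x \<and> {x, u} \<notin> T}"

lemma (in move) ends_link: "ends (link_tree a b) = {a, b}"
proof -
  have "{b, a} \<notin> link_tree a b" "{sw ! (loc a b - 1), a} \<in> link_tree a b" "{sw ! (loc a b - 1), b} \<in> link_tree a b"
    using link_props by (simp_all add: insert_commute)
  then show ?thesis
    unfolding ends_def link_props(1) using link_props(5-10) ab by auto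
qed

context points
begin

text \<open>Both branches perform the same two flips, in opposite orders. The second one needs the
  sectors at \<open>b\<close> following \<open>a\<close> and \<open>c\<close>, hence that neither of
  these points is exceptional.\<close>

definition conn :: "real^2 \<Rightarrow> real^2 \<Rightarrow> real^2 \<Rightarrow> ((real^2) set set \<times> (real^2) set) list" where
  "conn a b c = (if exceptional X b a \<or> exceptional X b c
     then [(stage_tree a b (N - 1), {b, last (sweep X a b)}), (star b (X - {b}), {c, hd (sweep X b c)})]
     else [(stage_tree a b (N - 1), {c, hd (sweep X b c)}),
           (detour_star X b (last (sweep X a b)) a (hd (sweep X b c)) c, {b, last (sweep X a b)})])"

lemma
  assumes m: "move X a b" "move X b c" and ac: "a \<noteq> c"
  shows flip_path_conn: "flip_path X (conn a b c) (stage_tree b c 1)"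
    and conn_extra: "T \<in> set (map fst (tl (conn a b c))) \<Longrightarrow>
      (T = star b (X - {b}) \<and> spine T = {b} \<and> (exceptional X b a \<or> exceptional X b c)) \<or>
      (T = detour_star X b (last (sweep X a b)) a (hd (sweep X b c)) c \<and> spine T = {a, b, c} \<and> heavy T = {b} \<and>
       \<not> exceptional X b a \<and> \<not> exceptional X b c)"
proof -
  interpret m1: move X a b by fact
  interpret m2: move X b c by fact
  let ?y = "last (sweep X a b)" and ?z = "hd (sweep X b c)"
  have lt: "N - 1 < N" "0 < N" using m1.card6 by auto
  have y: "?y \<in> X" "?y \<noteq> a" "?y \<noteq> b" using m1.sw_nth[OF lt(1)] m1.hd_last_sw by auto
  have z: "?z \<in> X" "?z \<noteq> b" "?z \<noteq> c" using m2.sw_nth[OF lt(2)] m2.hd_last_sw by auto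
  have X: "b \<in> X" "?y \<in> X" "a \<in> X" "?z \<in> X" "c \<in> X" "?y \<noteq> b" "a \<noteq> b" "a \<noteq> ?y" "?z \<noteq> b" "c \<noteq> b" "c \<noteq> ?z"
    using m1.ab m2.ab y z by auto
  have pst: "plane_spanning_tree X (near_star X b ?y a)"
    using m1.plane_stage_tree[of "N - 1"] m1.stage_tree_last by simp
  have s: "plane_spanning_tree X (star b (X - {b}))" using m1.card6 m1.ab by (intro plane_star) auto
  \<comment> \<open>When neither neighbour is exceptional, the definition of a sweep makes
    \<open>?y\<close> and \<open>?z\<close> the rotational successors of \<open>a\<close> and
    \<open>c\<close> around \<open>b\<close>.\<close>
  have det: "?y \<noteq> ?z \<and> \<not> (?y = c \<and> ?z = a) \<and> \<not> crossing {a, ?y} {c, ?z}"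
    if "\<not> exceptional X b a" "\<not> exceptional X b c"
    using succ_of_pair[of b a ?y c ?z] m1.is_sw m2.is_sw that X ac unfolding is_sweep_def by auto
  have cy: "\<not> crossing {b, k} {a, ?y}" if k: "k \<in> X" "k \<noteq> b" "k \<noteq> a" "k \<noteq> ?y" for k
  proof -
    have "k \<in> set (sweep X a b)" using m1.sw(2) k by auto
    then obtain i where i: "i < N" "k = sweep X a b ! i" using m1.sw(3) by (metis in_set_conv_nth)
    then have "i \<noteq> N - 1" using k m1.hd_last_sw by auto
    then show ?thesis using m1.not_crossing_sw[of i "N - 1"] i m1.hd_last_sw by auto
  qed
  have cz: "\<not> crossing {b, k} {c, ?z}" if k: "k \<in> X" "k \<noteq> b" "k \<noteq> c" "k \<noteq> ?z" for k
  proof -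
    have "k \<in> set (sweep X b c)" using m2.sw(2) k by auto
    then obtain i where i: "i < N" "k = sweep X b c ! i" using m2.sw(3) by (metis in_set_conv_nth)
    then have "i \<noteq> 0" using k m2.hd_last_sw by (metis)
    then show ?thesis using m2.not_crossing_sw[of 0 i] i m2.hd_last_sw crossing_commute by simp
  qed
  show "flip_path X (conn a b c) (stage_tree b c 1)"
  proof (cases "exceptional X b a \<or> exceptional X b c")
    case True
    then show ?thesis
      unfolding conn_def m1.stage_tree_last m2.stage_tree_first
      using pst s flip_near_star_star[of b X ?y a] flip_star_near_star[of b X ?z c] X by simp
  next
    case False
    then have d: "?y \<noteq> ?z" "\<not> (?y = c \<and> ?z = a)" "\<not> crossing {a, ?y} {c, ?z}" using det by auto
    have "plane_spanning_tree X (detour_star X b ?y a ?z c)"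
      by (rule plane_detour_star) (use X d ac cy cz in auto)
    then show ?thesis
      unfolding conn_def m1.stage_tree_last m2.stage_tree_first
      using False pst flip_near_star_detour[of b X ?y a ?z c] flip_detour_near_star[of b X ?y a ?z c] X d ac by simp
  qed
  assume T: "T \<in> set (map fst (tl (conn a b c)))"
  show "(T = star b (X - {b}) \<and> spine T = {b} \<and> (exceptional X b a \<or> exceptional X b c)) \<or>
      (T = detour_star X b ?y a ?z c \<and> spine T = {a, b, c} \<and> heavy T = {b} \<and> \<not> exceptional X b a \<and> \<not> exceptional X b c)"
  proof (cases "exceptional X b a \<or> exceptional X b c")
    case True
    then show ?thesis using T spine_star[of X b] finite_X m1.card6 m1.ab by (auto simp: conn_def)
  next
    case False
    then have d: "?y \<noteq> ?z" "\<not> (?y = c \<and> ?z = a)" using det by auto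
    then show ?thesis
      using T False detour_star_nbrs[OF finite_X m1.card6 X d(1) ac d(2)] by (auto simp: conn_def)
  qed
qed

end

lemma count_list_concat_upt:
  "count_list (map g (concat (map B [0..<L]))) f = (\<Sum>i<L. count_list (map g (B i)) f)"
  by (induction L) (auto simp: count_list_append)

lemma sum_cyclic_shift:
  fixes g :: "nat \<Rightarrow> nat"
  shows "(\<Sum>i<L. g (Suc i mod L)) = (\<Sum>i<L. g i)"
proof (cases L)
  case (Suc m)
  have "(\<Sum>i<m. g (Suc i mod Suc m)) = (\<Sum>i<m. g (Suc i))" by (intro sum.cong) auto
  then show ?thesis unfolding Suc using sum.lessThan_Suc_shift[of g m] by simp
qed simp

text \<open>Distinct arcs and \<open>antisym\<close> together let the unordered pair of centres
  identify the arc, and they make any two passages through a point use four different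
  neighbours.\<close>

locale tour = points +
  fixes es :: "((real^2) \<times> (real^2)) list" and md :: bool
  assumes card6: "card X \<ge> 6" and es_ne: "es \<noteq> []" and es_distinct: "distinct es"
    and es_X: "\<And>a b. (a, b) \<in> set es \<Longrightarrow> a \<in> X \<and> b \<in> X \<and> a \<noteq> b"
    and antisym: "\<And>a b. (a, b) \<in> set es \<Longrightarrow> (b, a) \<notin> set es"
    and closed: "\<And>i. i < length es \<Longrightarrow> snd (es ! i) = fst (es ! (Suc i mod length es))"
begin

abbreviation "A i \<equiv> fst (es ! i)"
abbreviation "H i \<equiv> snd (es ! i)"
abbreviation "nx i \<equiv> Suc i mod length es"

lemma move: "(a, b) \<in> set es \<Longrightarrow> move X a b"
  using es_X card6 by unfold_locales auto

lemma arc: "i < length es \<Longrightarrow> (A i, H i) \<in> set es"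
  using nth_mem[of i es] by simp

lemma arc_nx: "i < length es \<Longrightarrow> (H i, H (nx i)) \<in> set es"
  using arc[of "nx i"] closed[of i] es_ne by auto

lemma arc_inj: "i < length es \<Longrightarrow> j < length es \<Longrightarrow> A i = A j \<Longrightarrow> H i = H j \<Longrightarrow> i = j"
  using es_distinct by (metis nth_eq_iff_index_eq prod.collapse)

lemma nx_inj: "i < length es \<Longrightarrow> j < length es \<Longrightarrow> nx i = nx j \<Longrightarrow> i = j"
  by (metis Suc_inject mod_less mod_self not_less_eq not_less_less_Suc_eq Suc_lessI nat.distinct(1))

lemma A_neq: "i < length es \<Longrightarrow> A i \<noteq> H (nx i)"
  using arc[of i] arc_nx[of i] antisym by fastforce

text \<open>If the trees agreed, the heavy vertex \<open>b\<close> would be a centre of the link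
  tree, and the two centres of a link tree are not adjacent. This forces
  \<open>last (sweep X a b) = c\<close> or \<open>hd (sweep X b c) = a\<close>, which fixes the side
  of the arc on which the link point lies. The choice of \<open>loc\<close> puts it on the opposite
  side.\<close>

lemma detour_not_link:
  assumes ab: "(a, b) \<in> set es" "(b, c) \<in> set es" and ab': "(a', b') \<in> set es"
    and T: "T = detour_star X b (last (sweep X a b)) a (hd (sweep X b c)) c"
      "spine T = {a, b, c}" "heavy T = {b}" "\<not> exceptional X b a" "\<not> exceptional X b c"
  shows "T \<noteq> link_tree a' b'"
proof
  assume eq: "T = link_tree a' b'"
  interpret m1: move X a b using ab move by blast
  interpret m2: move X b c using ab move by blast
  interpret m': move X a' b' using ab' move by blast
  let ?k = "sweep X a' b' ! (loc a' b' - 1)"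
  have ac: "a \<noteq> c" using ab antisym by auto
  have sp: "{a', b', ?k} = {a, b, c}" using m'.link_props(1) T eq by simp
  have edge: "{a', b'} \<notin> T" using m'.link_props(5) eq by simp
  have lt: "N - 1 < N" "0 < N" using card6 by auto
  have y: "last (sweep X a b) \<noteq> b" using m1.sw_nth[OF lt(1)] m1.hd_last_sw by auto
  have z: "hd (sweep X b c) \<noteq> b" "hd (sweep X b c) \<noteq> c" using m2.sw_nth[OF lt(2)] m2.hd_last_sw by auto
  show False
  proof (cases "loc a' b' = 2")
    case True
    have "card (nbrs T a') \<ge> 3" using m'.link_props(2) eq True card6 by simp
    then have a': "a' = b" using T(3) by (auto simp: heavy_def)
    then have "b' \<noteq> a" using ab ab' antisym by auto
    then have bk: "b' = c" "?k = a" using sp a' m'.ab m'.link_props(9,10) m1.ab m2.ab ac by auto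
    have "last (sweep X a b) = c"
      using edge a' bk z m1.ab m2.ab unfolding T(1) detour_star_def by (auto simp: edge_star)
    then have "orient b a c > 0" using m1.is_sw T(4) by (auto simp: is_sweep_def succ_of_def)
    moreover have "orient a' b' a > 0" using m'.loc_side(1)[OF True] by (subst bk(2)[symmetric]) blast
    then have "orient b c a > 0" using a' bk(1) by simp
    ultimately show False using orient_swap[of b a c] by linarith
  next
    case False
    note l = m'.loc_side(2)[OF False]
    have "card (nbrs T b') \<ge> 3" using m'.link_props(3) eq l card6 by simp
    then have b': "b' = b" using T(3) by (auto simp: heavy_def)
    then have "a' \<noteq> c" using ab ab' antisym by auto
    then have ak: "a' = a" "?k = c" using sp b' m'.ab m'.link_props(9,10) m1.ab m2.ab ac by auto
    have "hd (sweep X b c) = a"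
      using edge b' ak y m1.ab m2.ab m1.sw_nth[OF lt(1)] m1.hd_last_sw unfolding T(1) detour_star_def
      by (auto simp: edge_star)
    then have "orient b c a > 0" using m2.is_sw T(5) by (auto simp: is_sweep_def succ_of_def)
    moreover have "orient a' b' c \<le> 0" using l by (subst ak(2)[symmetric]) blast
    then have "orient a b c \<le> 0" using b' ak(1) by simp
    ultimately show False using orient_rotate[of b c a] by linarith
  qed
qed

lemma conn_cases:
  assumes i: "i < length es" and T: "T \<in> set (map fst (tl (conn (A i) (H i) (H (nx i)))))"
  obtains (star) "T = star (H i) (X - {H i})" "spine T = {H i}" "card (spine T) = 1"
      "exceptional X (H i) (A i) \<or> exceptional X (H i) (H (nx i))"
    | (detour) "T = detour_star X (H i) (last (sweep X (A i) (H i))) (A i) (hd (sweep X (H i) (H (nx i)))) (H (nx i))"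
      "spine T = {A i, H i, H (nx i)}" "heavy T = {H i}" "card (spine T) = 3"
      "\<not> exceptional X (H i) (A i)" "\<not> exceptional X (H i) (H (nx i))"
proof -
  have ne: "A i \<noteq> H i" "H i \<noteq> H (nx i)" "A i \<noteq> H (nx i)"
    using es_X[OF arc[OF i]] es_X[OF arc_nx[OF i]] A_neq[OF i] by auto
  then have c3: "card {A i, H i, H (nx i)} = 3" by simp
  note c = conn_extra[OF move[OF arc[OF i]] move[OF arc_nx[OF i]] A_neq[OF i] T]
  show thesis
  proof (cases "T = star (H i) (X - {H i}) \<and> spine T = {H i} \<and> (exceptional X (H i) (A i) \<or> exceptional X (H i) (H (nx i)))")
    case True
    then show ?thesis by (intro star) auto
  next
    case False
    then show ?thesis using c detour c3 by metis
  qed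
qed

lemma conn_not_stage:
  assumes i: "i < length es" and T: "T \<in> set (map fst (tl (conn (A i) (H i) (H (nx i)))))"
    and ab: "(a, b) \<in> set es"
  shows "spine T \<noteq> {a, b}" "T \<noteq> link_tree a b"
proof -
  interpret m: move X a b using ab move by blast
  have c: "card {a, b} = 2" using m.ab by simp
  from i T show "spine T \<noteq> {a, b}"
    by (cases rule: conn_cases) (use c in auto)
  from i T show "T \<noteq> link_tree a b"
  proof (cases rule: conn_cases)
    case star
    then show ?thesis using m.spine_link_card by auto
  next
    case detour
    show ?thesis by (rule detour_not_link[OF arc[OF i] arc_nx[OF i] ab detour(1-3,5,6)])
  qed
qed

text \<open>Two passages through the same centre have no neighbour in common. So only one of them
  can involve its exceptional point and use the star, and detour stars with the same centre have
  different spines.\<close>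

lemma conn_disjoint:
  assumes i: "i < length es" and j: "j < length es" and ij: "i \<noteq> j"
    and T: "T \<in> set (map fst (tl (conn (A i) (H i) (H (nx i)))))"
  shows "T \<notin> set (map fst (tl (conn (A j) (H j) (H (nx j)))))"
proof
  assume T': "T \<in> set (map fst (tl (conn (A j) (H j) (H (nx j)))))"
  note X = es_X[OF arc[OF i]] es_X[OF arc[OF j]] es_X[OF arc_nx[OF i]] es_X[OF arc_nx[OF j]]
  have neq: "A i \<noteq> A j" "H (nx i) \<noteq> H (nx j)" "A i \<noteq> H (nx j)" "A j \<noteq> H (nx i)" if b: "H i = H j"
  proof -
    show "A i \<noteq> A j" using arc_inj[OF i j] b ij by auto
    have "nx i < length es" "nx j < length es" "nx i \<noteq> nx j" using es_ne nx_inj[OF i j] ij by auto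
    then show "H (nx i) \<noteq> H (nx j)" using arc_inj[of "nx i" "nx j"] closed[OF i] closed[OF j] b by auto
    show "A i \<noteq> H (nx j)" using arc[OF i] arc_nx[OF j] b antisym by metis
    show "A j \<noteq> H (nx i)" using arc[OF j] arc_nx[OF i] b antisym by metis
  qed
  from i T show False
  proof (cases rule: conn_cases)
    case star
    from j T' show False
    proof (cases rule: conn_cases)
      case star': star
      have b: "H i = H j" using star(2) star'(2) by simp
      obtain p q where "exceptional X (H i) p" "p \<in> {A i, H (nx i)}" "exceptional X (H i) q" "q \<in> {A j, H (nx j)}"
        using star(4) star'(4) unfolding b by blast
      moreover have "p \<noteq> q" using neq[OF b] calculation(2,4) by auto
      moreover have "p \<in> X" "p \<noteq> H i" using X(1,3) calculation(2) by auto
      moreover have "q \<in> X" "q \<noteq> H i" using X(2,4) calculation(4) b by auto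
      ultimately show False using exceptional_unique[of "H i" p q] X(1) by blast
    next
      case detour
      show False using star(3) detour(4) by simp
    qed
  next
    case detour
    from j T' show False
    proof (cases rule: conn_cases)
      case star
      show False using star(3) detour(4) by simp
    next
      case detour': detour
      have b: "H i = H j" using detour(3) detour'(3) by simp
      have "A i \<in> {A j, H j, H (nx j)}" using detour(2) detour'(2) by (metis insertI1)
      then show False using neq[OF b] X(1) b by auto
    qed
  qed
qed

text \<open>The connections are a parameter so that one of them can be replaced by a detour through
  the 1-rainbow cycle; \<open>ex\<close> counts the labels that such a replacement adds.\<close>

lemma tour_rainbow:
  fixes cn :: "nat \<Rightarrow> ((real^2) set set \<times> (real^2) set) list" and ex :: "nat \<Rightarrow> (real^2) set \<Rightarrow> nat"
  assumes hd: "\<And>i. i < length es \<Longrightarrow> cn i \<noteq> [] \<and> fst (hd (cn i)) = stage_tree (A i) (H i) (N - 1)"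
    and path: "\<And>i. i < length es \<Longrightarrow> flip_path X (cn i) (stage_tree (H i) (H (nx i)) 1)"
    and dist: "\<And>i. i < length es \<Longrightarrow> distinct (map fst (tl (cn i)))"
    and extra: "\<And>i T a b. i < length es \<Longrightarrow> T \<in> set (map fst (tl (cn i))) \<Longrightarrow> (a, b) \<in> set es \<Longrightarrow>
      spine T \<noteq> {a, b} \<and> T \<noteq> link_tree a b"
    and disj: "\<And>i j T. i < j \<Longrightarrow> j < length es \<Longrightarrow> T \<in> set (map fst (tl (cn i))) \<Longrightarrow> T \<notin> set (map fst (tl (cn j)))"
    and count: "\<And>i f. i < length es \<Longrightarrow> f \<in> point_pairs X \<Longrightarrow> count_list (map snd (cn i)) f =
      (if f = {H i, last (sweep X (A i) (H i))} then 1 else 0) +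
      (if f = {H (nx i), hd (sweep X (H i) (H (nx i)))} then 1 else 0) + ex i f"
    and r: "\<And>f. f \<in> point_pairs X \<Longrightarrow>
      card {(a, b) \<in> set es. b \<in> f \<and> (md \<or> f \<noteq> {a, b})} + (\<Sum>i<length es. ex i f) = r"
  shows "\<exists>p. rainbow_cycle X r p"
proof -
  let ?L = "length es"
  define blk where "blk i = core md (A i) (H i) @ cn i" for i
  define xs where "xs = concat (map blk [0..<?L])"
  define s where "s i = stage_tree (A (i mod ?L)) (H (i mod ?L)) 1" for i
  have L: "?L > 0" using es_ne by auto
  have cn: "\<exists>f. cn i = (stage_tree (A i) (H i) (N - 1), f) # tl (cn i)" if "i < ?L" for i
    using hd[OF that] by (cases "cn i") auto
  have b1: "blk i \<noteq> []" "fst (List.hd (blk i)) = s i" if "i < ?L" for i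
    using move.hd_core[OF move[OF arc[OF that]], of md] that by (auto simp: blk_def s_def)
  have b2: "flip_path X (blk i) (s (Suc i))" if "i < ?L" for i
  proof -
    have "source (cn i) T = stage_tree (A i) (H i) (N - 1)" for T
      using cn[OF that] by (metis source.simps(2) fst_conv)
    moreover have "s (Suc i) = stage_tree (H i) (H (nx i)) 1" using closed[OF that] by (simp add: s_def)
    ultimately show ?thesis
      using move.flip_path_core[OF move[OF arc[OF that]], of md] path[OF that]
      by (simp add: blk_def flip_path_append)
  qed
  have xs_ne: "xs \<noteq> []" and xs_hd: "fst (List.hd xs) = s 0"
    using b1[OF L] L unfolding xs_def by (auto simp: upt_conv_Cons)
  have "flip_path X xs (s ?L)" unfolding xs_def using b1 b2 by (intro flip_path_concat) auto
  then have p: "flip_path X xs (fst (List.hd xs))" using xs_hd by (simp add: s_def)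
  have trees: "(\<exists>t. 1 \<le> t \<and> t \<le> N - 1 \<and> T = stage_tree (A i) (H i) t) \<or> T = link_tree (A i) (H i) \<or>
      T \<in> set (map fst (tl (cn i)))"
    if "i < ?L" "T \<in> set (map fst (blk i))" for i T
  proof -
    have "T \<in> set (map fst (core md (A i) (H i))) \<or> T = stage_tree (A i) (H i) (N - 1) \<or> T \<in> set (map fst (tl (cn i)))"
      using that(2) cn[OF that(1)] unfolding blk_def
      by (metis (no_types, lifting) Un_iff fst_conv list.simps(9) map_append set_ConsD set_append)
    then show ?thesis
    proof (elim disjE)
      assume "T \<in> set (map fst (core md (A i) (H i)))"
      then show ?thesis
        using move.core_trees[OF move[OF arc[OF that(1)]], of T md] less_imp_le by blast
    next
      assume "T = stage_tree (A i) (H i) (N - 1)"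
      moreover have "1 \<le> N - 1" using card6 by simp
      ultimately show ?thesis by blast
    qed simp
  qed
  have stage_extra: "stage_tree a b t \<notin> set (map fst (tl (cn i)))" "link_tree a b \<notin> set (map fst (tl (cn i)))"
    if "i < ?L" "(a, b) \<in> set es" "1 \<le> t" "t \<le> N - 1" for i a b t
    using extra[OF that(1) _ that(2)] move.stage_spine(1)[OF move[OF that(2)] that(3,4)] by blast+
  have N1: "1 \<le> N - 1" using card6 by simp
  have d1: "distinct (map fst (blk i))" if i: "i < ?L" for i
  proof -
    obtain f where f: "cn i = (stage_tree (A i) (H i) (N - 1), f) # tl (cn i)" using cn[OF i] by blast
    have e: "map fst (blk i) = map fst (core md (A i) (H i) @ [(stage_tree (A i) (H i) (N - 1), f)]) @ map fst (tl (cn i))"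
      unfolding blk_def by (subst f) simp
    have "T \<notin> set (map fst (tl (cn i)))"
      if "T \<in> set (map fst (core md (A i) (H i) @ [(stage_tree (A i) (H i) (N - 1), f)]))" for T
    proof -
      have "T = stage_tree (A i) (H i) (N - 1) \<or> T \<in> set (map fst (core md (A i) (H i)))" using that by auto
      then show ?thesis
        using move.core_trees[OF move[OF arc[OF i]], of T md] stage_extra[OF i arc[OF i]] N1
        by (metis less_imp_le order_refl)
    qed
    then show ?thesis
      unfolding e using move.distinct_core[OF move[OF arc[OF i]]] dist[OF i] by (subst distinct_append) blast
  qed
  have d2: "set (map fst (blk i)) \<inter> set (map fst (blk j)) = {}" if ij: "i < j" "j < ?L" for i j
  proof (rule ccontr)
    assume "\<not> ?thesis"
    then obtain T where T: "T \<in> set (map fst (blk i))" "T \<in> set (map fst (blk j))" by blast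
    have i: "i < ?L" using ij by simp
    \<comment> \<open>Two arcs on the same pair of points are equal or opposite, and neither is
      possible for different positions.\<close>
    have ne: "{A i, H i} \<noteq> {A j, H j}"
    proof
      assume "{A i, H i} = {A j, H j}"
      then have "A i = A j \<and> H i = H j \<or> A i = H j \<and> H i = A j" by (auto simp: doubleton_eq_iff)
      then show False using arc_inj[OF i ij(2)] ij(1) arc[OF i] arc[OF ij(2)] antisym by (metis less_irrefl)
    qed
    have st: "spine (stage_tree (A k) (H k) t) = {A k, H k}" if "k < ?L" "1 \<le> t" "t \<le> N - 1" for k t
      using move.stage_spine(1)[OF move[OF arc[OF that(1)]]] that by auto
    have ln: "card (spine (link_tree (A k) (H k))) = 3" "ends (link_tree (A k) (H k)) = {A k, H k}" if "k < ?L" for k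
      using move.spine_link_card[OF move[OF arc[OF that]]] move.ends_link[OF move[OF arc[OF that]]] by auto
    have c2: "card {A k, H k} = 2" if "k < ?L" for k using es_X[OF arc[OF that]] by simp
    from trees[OF i T(1)] trees[OF ij(2) T(2)] show False
    proof (elim disjE exE conjE)
      fix t u assume "1 \<le> t" "t \<le> N - 1" "T = stage_tree (A i) (H i) t" "1 \<le> u" "u \<le> N - 1" "T = stage_tree (A j) (H j) u"
      then show False using st[OF i] st[OF ij(2)] ne by metis
    next
      fix t assume "1 \<le> t" "t \<le> N - 1" "T = stage_tree (A i) (H i) t" "T = link_tree (A j) (H j)"
      then show False using st[OF i, of t] ln(1)[OF ij(2)] c2[OF i] by simp
    next
      fix t assume "1 \<le> t" "t \<le> N - 1" "T = stage_tree (A i) (H i) t" "T \<in> set (map fst (tl (cn j)))"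
      then show False using stage_extra[OF ij(2) arc[OF i]] by blast
    next
      fix t assume "1 \<le> t" "t \<le> N - 1" "T = stage_tree (A j) (H j) t" "T = link_tree (A i) (H i)"
      then show False using st[OF ij(2), of t] ln(1)[OF i] c2[OF ij(2)] by simp
    next
      assume "T = link_tree (A i) (H i)" "T = link_tree (A j) (H j)"
      then show False using ln(2)[OF i] ln(2)[OF ij(2)] ne by simp
    next
      assume "T = link_tree (A i) (H i)" "T \<in> set (map fst (tl (cn j)))"
      then show False using stage_extra(2)[OF ij(2) arc[OF i] N1] by auto
    next
      fix t assume "1 \<le> t" "t \<le> N - 1" "T = stage_tree (A j) (H j) t" "T \<in> set (map fst (tl (cn i)))"
      then show False using stage_extra[OF i arc[OF ij(2)]] by blast
    next
      assume "T = link_tree (A j) (H j)" "T \<in> set (map fst (tl (cn i)))"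
      then show False using stage_extra(2)[OF i arc[OF ij(2)] N1] by auto
    next
      assume "T \<in> set (map fst (tl (cn i)))" "T \<in> set (map fst (tl (cn j)))"
      then show False using disj[OF ij] by blast
    qed
  qed
  have d: "distinct (map fst xs)"
  proof -
    have "map fst xs = concat (map (\<lambda>i. map fst (blk i)) [0..<?L])" by (simp add: xs_def map_concat comp_def)
    then show ?thesis using d1 d2 distinct_concat_upt[of ?L "\<lambda>i. map fst (blk i)"] by simp
  qed
  have cnt: "count_list (map snd xs) f = r" if f: "f \<in> point_pairs X" for f
  proof -
    define h where "h i = (if f = {H i, List.hd (sweep X (A i) (H i))} then 1 else 0 :: nat)" for i
    define c where "c i = count_list (map snd (core md (A i) (H i))) f + (if f = {H i, last (sweep X (A i) (H i))} then 1 else 0)" for i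
    define g where "g e = (if snd e \<in> f \<and> (md \<or> f \<noteq> {fst e, snd e}) then 1 else 0 :: nat)" for e
    have "count_list (map snd xs) f = (\<Sum>i<?L. c i + h (nx i) + ex i f)"
      unfolding xs_def count_list_concat_upt
    proof (intro sum.cong refl)
      fix i assume "i \<in> {..<?L}"
      then have i: "i < ?L" by simp
      show "count_list (map snd (blk i)) f = c i + h (nx i) + ex i f"
        using count[OF i f] closed[OF i] by (simp add: blk_def c_def h_def count_list_append)
    qed
    also have "\<dots> = (\<Sum>i<?L. c i) + (\<Sum>i<?L. h (nx i)) + (\<Sum>i<?L. ex i f)" by (simp add: sum.distrib)
    \<comment> \<open>The first edge of a move enters in the preceding connection; shifting
      cyclically charges it to its own arc, where \<open>count_core\<close> expects it.\<close>
    also have "(\<Sum>i<?L. h (nx i)) = (\<Sum>i<?L. h i)" by (rule sum_cyclic_shift)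
    also have "(\<Sum>i<?L. c i) + (\<Sum>i<?L. h i) = (\<Sum>i<?L. g (es ! i))"
      unfolding sum.distrib[symmetric]
    proof (intro sum.cong refl)
      fix i assume "i \<in> {..<?L}"
      then have i: "i < ?L" by simp
      show "c i + h i = g (es ! i)"
        using move.count_core[OF move[OF arc[OF i]] f, of md] by (simp add: c_def h_def g_def)
    qed
    also have "\<dots> = sum_list (map g es)" by (simp add: sum_list_sum_nth atLeast0LessThan)
    also have "\<dots> = sum g (set es)" using es_distinct by (simp add: sum_list_distinct_conv_sum_set)
    also have "\<dots> = card {e \<in> set es. snd e \<in> f \<and> (md \<or> f \<noteq> {fst e, snd e})}"
      unfolding g_def by (simp add: sum.If_cases Int_def)
    also have "{e \<in> set es. snd e \<in> f \<and> (md \<or> f \<noteq> {fst e, snd e})} = {(a, b) \<in> set es. b \<in> f \<and> (md \<or> f \<noteq> {a, b})}"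
      by auto
    finally show ?thesis using r[OF f] by simp
  qed
  show ?thesis by (rule rainbow_cycleI[OF xs_ne p d cnt])
qed

lemma count_conn:
  "count_list (map snd (conn a b c)) f = (if f = {b, last (sweep X a b)} then 1 else 0) +
     (if f = {c, hd (sweep X b c)} then 1 else 0)"
  by (auto simp: conn_def)

lemma hd_conn: "conn a b c \<noteq> [] \<and> fst (hd (conn a b c)) = stage_tree a b (N - 1)"
  by (simp add: conn_def)

lemma rainbow_plain:
  assumes "\<And>f. f \<in> point_pairs X \<Longrightarrow> card {(a, b) \<in> set es. b \<in> f \<and> (md \<or> f \<noteq> {a, b})} = r"
  shows "\<exists>p. rainbow_cycle X r p"
proof (rule tour_rainbow[where cn = "\<lambda>i. conn (A i) (H i) (H (nx i))" and ex = "\<lambda>i f. 0"])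
  fix i assume i: "i < length es"
  show "flip_path X (conn (A i) (H i) (H (nx i))) (stage_tree (H i) (H (nx i)) 1)"
    using move[OF arc[OF i]] move[OF arc_nx[OF i]] A_neq[OF i] by (rule flip_path_conn)
  show "distinct (map fst (tl (conn (A i) (H i) (H (nx i)))))" by (simp add: conn_def)
  show "conn (A i) (H i) (H (nx i)) \<noteq> [] \<and>
      fst (hd (conn (A i) (H i) (H (nx i)))) = stage_tree (A i) (H i) (N - 1)"
    by (rule hd_conn)
  fix T a b assume "T \<in> set (map fst (tl (conn (A i) (H i) (H (nx i)))))" "(a, b) \<in> set es"
  then show "spine T \<noteq> {a, b} \<and> T \<noteq> link_tree a b" using conn_not_stage[OF i] by blast
next
  fix i j T assume "i < j" "j < length es" "T \<in> set (map fst (tl (conn (A i) (H i) (H (nx i)))))"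
  then show "T \<notin> set (map fst (tl (conn (A j) (H j) (H (nx j)))))"
    by (intro conn_disjoint[of i j]) auto
next
  fix f assume "f \<in> point_pairs X"
  then show "card {(a, b) \<in> set es. b \<in> f \<and> (md \<or> f \<noteq> {a, b})} + (\<Sum>i<length es. 0) = r"
    using assms by simp
qed (simp add: count_conn)

end

subsection \<open>Circulant digraphs and their Euler tours\<close>

text \<open>The circulant digraph with arcs from \<open>i\<close> to the \<open>d\<close> residues
  following it modulo \<open>n\<close>, written without remainders.\<close>

definition circ :: "nat \<Rightarrow> nat \<Rightarrow> (nat \<times> nat) set" where
  "circ n d = {(i, j). i < n \<and> j < n \<and> (i < j \<and> j \<le> i + d \<or> j < i \<and> j + n \<le> i + d)}"

lemma card_circ_in:
  assumes "j < n" "2 * d < n"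
  shows "card {i. (i, j) \<in> circ n d} = d"
proof -
  have "{i. (i, j) \<in> circ n d} = {j - d..<j} \<union> {j + n - d..<n}"
    using assms by (auto simp: circ_def)
  moreover have "card ({j - d..<j} \<union> {j + n - d..<n}) = card {j - d..<j} + card {j + n - d..<n}"
    using assms by (intro card_Un_disjoint) auto
  ultimately show ?thesis using assms by auto
qed

lemma card_circ_out:
  assumes "i < n" "2 * d < n"
  shows "card {j. (i, j) \<in> circ n d} = d"
proof -
  have "{j. (i, j) \<in> circ n d} = {Suc i..<min (Suc (i + d)) n} \<union> {0..<Suc (i + d) - n}"
    using assms by (auto simp: circ_def)
  moreover have "card ({Suc i..<min (Suc (i + d)) n} \<union> {0..<Suc (i + d) - n})
      = card {Suc i..<min (Suc (i + d)) n} + card {0..<Suc (i + d) - n}"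
    using assms by (intro card_Un_disjoint) auto
  ultimately show ?thesis using assms by auto
qed

lemma finite_circ: "finite (circ n d)"
  by (rule finite_subset[of _ "{..<n} \<times> {..<n}"]) (auto simp: circ_def)

text \<open>All in- and out-degrees equal \<open>d\<close>, and the arcs from \<open>k\<close> to
  \<open>Suc k\<close> connect the digraph, so Euler's theorem applies.\<close>

lemma ex_circ_tour:
  assumes d: "1 \<le> d" "2 * d < n"
  shows "\<exists>p. p \<noteq> [] \<and> distinct p \<and> set p = circ n d \<and>
    (\<forall>i<length p. snd (p ! i) = fst (p ! (Suc i mod length p)))"
proof -
  define G where "G = \<lparr>verts = {..<n}, arcs = circ n d, tail = fst, head = snd\<rparr>"
  interpret G: fin_digraph G
    by unfold_locales (auto simp: G_def circ_def finite_circ[unfolded circ_def])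
  have deg: "in_degree G u = d" "out_degree G u = d" if "u \<in> verts G" for u
  proof -
    have u: "u < n" using that by (simp add: G_def)
    have "in_arcs G u = (\<lambda>i. (i, u)) ` {i. (i, u) \<in> circ n d}"
      by (auto simp: in_arcs_def G_def)
    then show "in_degree G u = d"
      unfolding in_degree_def using card_circ_in[OF u d(2)] by (simp add: card_image inj_on_def)
    have "out_arcs G u = (\<lambda>j. (u, j)) ` {j. (u, j) \<in> circ n d}"
      by (auto simp: out_arcs_def G_def)
    then show "out_degree G u = d"
      unfolding out_degree_def using card_circ_out[OF u d(2)] by (simp add: card_image inj_on_def)
  qed
  have ends: "arcs_ends G = circ n d"
    by (auto simp: arcs_ends_def arc_to_ends_def G_def)
  have reach: "(0, k) \<in> rtrancl_on {..<n} (symcl (circ n d))" if "k < n" for k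
    using that
  proof (induction k)
    case (Suc k)
    have "(k, Suc k) \<in> symcl (circ n d)" using Suc.prems d by (auto simp: symcl_def circ_def)
    then show ?case using Suc by (auto intro: rtrancl_on_into_rtrancl_on)
  qed auto
  have sym: "sym (rtrancl_on {..<n} (symcl (circ n d)))"
    by (rule rtrancl_on_sym) (auto simp: symcl_def sym_def)
  have "Digraph_Component.connected G"
    unfolding connected_conv ends
  proof (intro conjI ballI)
    show "verts G \<noteq> {}" using d by (auto simp: G_def)
    fix u w assume "u \<in> verts G" "w \<in> verts G"
    then have "u < n" "w < n" by (auto simp: G_def)
    then have "(u, 0) \<in> rtrancl_on {..<n} (symcl (circ n d))" "(0, w) \<in> rtrancl_on {..<n} (symcl (circ n d))"
      using reach sym by (auto dest: symD)
    then have "(u, w) \<in> rtrancl_on {..<n} (symcl (circ n d))" by (rule rtrancl_on_trans)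
    then show "(u, w) \<in> rtrancl_on (verts G) (symcl (circ n d))" by (simp add: G_def)
  qed
  then obtain u p where "G.euler_trail u p u" using G.closed_euler1 deg by auto
  then have p: "G.awalk u p u" "distinct p" "set p = circ n d"
    unfolding G.euler_trail_def G.trail_def by (auto simp: G_def)
  then have "G.cas u p u" by (auto simp: G.awalk_def)
  then have cl: "snd (p ! i) = fst (p ! (Suc i mod length p))" if "i < length p" for i
    using closed_cas_nth[of G u p i] that by (simp add: G_def)
  have "(0, 1) \<in> circ n d" using d by (auto simp: circ_def)
  then have "p \<noteq> []" using p(3) by auto
  then show ?thesis using p cl by blast
qed

lemma circ_antisym: "2 * d < n \<Longrightarrow> (i, j) \<in> circ n d \<Longrightarrow> (j, i) \<notin> circ n d"
  by (auto simp: circ_def)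

lemma circ_tournament: "i < 2 * d + 1 \<Longrightarrow> j < 2 * d + 1 \<Longrightarrow> i \<noteq> j \<Longrightarrow>
    (i, j) \<in> circ (2 * d + 1) d \<or> (j, i) \<in> circ (2 * d + 1) d"
  by (auto simp: circ_def)

text \<open>The in-degrees of \<open>i\<close> and \<open>j\<close> add up. For
  \<open>n = 2 * d + 1\<close> exactly one arc joins the two, and it is the one left out of the
  second count.\<close>

lemma card_circ_into_pair:
  assumes "i < n" "j < n" "i \<noteq> j" "2 * d < n"
  shows "card {(k, l) \<in> circ n d. l \<in> {i, j}} = 2 * d"
    and "n = 2 * d + 1 \<Longrightarrow> card {(k, l) \<in> circ n d. l \<in> {i, j} \<and> {i, j} \<noteq> {k, l}} = 2 * d - 1"
proof -
  let ?S = "{(k, l) \<in> circ n d. l \<in> {i, j}}"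
  have fin: "finite ?S" by (rule finite_subset[OF _ finite_circ]) auto
  have fin': "finite {k. (k, l) \<in> circ n d}" for l
    by (rule finite_subset[of _ "{..<n}"]) (auto simp: circ_def)
  have "?S = (\<lambda>k. (k, i)) ` {k. (k, i) \<in> circ n d} \<union> (\<lambda>k. (k, j)) ` {k. (k, j) \<in> circ n d}" by auto
  moreover have "card ((\<lambda>k. (k, i)) ` {k. (k, i) \<in> circ n d} \<union> (\<lambda>k. (k, j)) ` {k. (k, j) \<in> circ n d})
      = card ((\<lambda>k. (k, i)) ` {k. (k, i) \<in> circ n d}) + card ((\<lambda>k. (k, j)) ` {k. (k, j) \<in> circ n d})"
    using assms(3) fin' by (intro card_Un_disjoint) auto
  ultimately show c: "card ?S = 2 * d"
    using card_circ_in[OF assms(1,4)] card_circ_in[OF assms(2,4)] by (simp add: card_image inj_on_def)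
  assume n: "n = 2 * d + 1"
  obtain e where e: "e \<in> circ n d" "e = (i, j) \<or> e = (j, i)"
    using circ_tournament[of i d j] assms n by auto
  have S: "{(k, l) \<in> circ n d. l \<in> {i, j} \<and> {i, j} \<noteq> {k, l}} = ?S - {e}"
    using e circ_antisym[OF assms(4)] by (auto simp: doubleton_eq_iff)
  have "e \<in> ?S" using e by auto
  then show "card {(k, l) \<in> circ n d. l \<in> {i, j} \<and> {i, j} \<noteq> {k, l}} = 2 * d - 1"
    unfolding S by (simp only: card_Diff_singleton c)
qed

text \<open>The labelling \<open>w\<close> is left open: for even \<open>r\<close> and for the
  tournament any will do, while \<open>rainbow_odd\<close> uses it to make chosen pairs of points
  non-adjacent.\<close>

locale labelled_points = points +
  fixes w :: "nat \<Rightarrow> real^2" and d :: nat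
  assumes w: "bij_betw w {..<card X} X" and d1: "1 \<le> d" and d2: "2 * d < card X" and c6: "card X \<ge> 6"
begin

definition warcs :: "((real^2) \<times> (real^2)) set" where
  "warcs = map_prod w w ` circ (card X) d"

lemma w_eq: "i < card X \<Longrightarrow> j < card X \<Longrightarrow> w i = w j \<longleftrightarrow> i = j"
  using w by (auto simp: bij_betw_def inj_on_def)

lemma w_in: "i < card X \<Longrightarrow> w i \<in> X"
  using w by (auto simp: bij_betw_def)

lemma warcs_iff: "i < card X \<Longrightarrow> j < card X \<Longrightarrow> (w i, w j) \<in> warcs \<longleftrightarrow> (i, j) \<in> circ (card X) d"
  by (auto simp: warcs_def circ_def w_eq)

lemma ex_tour: "\<exists>es. tour X es \<and> set es = warcs"
proof -
  obtain p where p: "p \<noteq> []" "distinct p" "set p = circ (card X) d"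
    "\<And>i. i < length p \<Longrightarrow> snd (p ! i) = fst (p ! (Suc i mod length p))"
    using ex_circ_tour[OF d1 d2] by blast
  have inj: "inj_on (map_prod w w) (circ (card X) d)"
    by (rule inj_onI) (auto simp: circ_def w_eq)
  have "tour X (map (map_prod w w) p)"
  proof
    show "distinct (map (map_prod w w) p)" using p inj by (simp add: distinct_map)
    fix a b assume "(a, b) \<in> set (map (map_prod w w) p)"
    then obtain i j where ij: "(i, j) \<in> circ (card X) d" "a = w i" "b = w j" using p by auto
    then show "a \<in> X \<and> b \<in> X \<and> a \<noteq> b" by (auto simp: circ_def w_eq w_in)
    have "(w j, w i) \<notin> warcs"
      using circ_antisym[OF d2 ij(1)] ij(1) warcs_iff[of j i] by (auto simp: circ_def)
    then show "(b, a) \<notin> set (map (map_prod w w) p)" using p ij by (simp add: warcs_def)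
  next
    fix i assume i: "i < length (map (map_prod w w) p)"
    then have "Suc i mod length p < length p" using p(1) by auto
    then show "snd (map (map_prod w w) p ! i) = fst (map (map_prod w w) p ! (Suc i mod length (map (map_prod w w) p)))"
      using p(4)[of i] i by simp
  qed (use c6 p in auto)
  moreover have "set (map (map_prod w w) p) = warcs" using p by (simp add: warcs_def)
  ultimately show ?thesis by blast
qed

text \<open>The disjunctions with \<open>True\<close> and \<open>False\<close> are the two instances
  of \<open>md\<close> in \<open>rainbow_plain\<close>.\<close>

lemma card_warcs:
  assumes f: "f \<in> point_pairs X"
  shows "card {(a, b) \<in> warcs. b \<in> f \<and> (True \<or> f \<noteq> {a, b})} = 2 * d"
    and "card X = 2 * d + 1 \<Longrightarrow> card {(a, b) \<in> warcs. b \<in> f \<and> (False \<or> f \<noteq> {a, b})} = 2 * d - 1"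
proof -
  obtain x y where xy: "f = {x, y}" "x \<noteq> y" "x \<in> X" "y \<in> X"
    using f by (auto simp: point_pairs_def card_2_iff)
  then obtain i j where ij: "i < card X" "j < card X" "x = w i" "y = w j"
    using w unfolding bij_betw_def by (metis imageE lessThan_iff)
  have inj: "inj_on (map_prod w w) S" if "S \<subseteq> circ (card X) d" for S
  proof (rule inj_on_subset[OF _ that])
    show "inj_on (map_prod w w) (circ (card X) d)" by (rule inj_onI) (auto simp: circ_def w_eq)
  qed
  have ne: "i \<noteq> j" using xy ij by auto
  have "{(a, b) \<in> warcs. b \<in> f \<and> (True \<or> f \<noteq> {a, b})} = map_prod w w ` {(k, l) \<in> circ (card X) d. l \<in> {i, j}}"
    unfolding warcs_def xy ij(3,4) using ij(1,2) by (auto simp: w_eq circ_def)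
  then show "card {(a, b) \<in> warcs. b \<in> f \<and> (True \<or> f \<noteq> {a, b})} = 2 * d"
    using card_circ_into_pair(1)[OF ij(1,2) ne d2] inj[of "{(k, l) \<in> circ (card X) d. l \<in> {i, j}}"]
    by (simp add: card_image subset_iff)
  assume n: "card X = 2 * d + 1"
  have "{(a, b) \<in> warcs. b \<in> f \<and> (False \<or> f \<noteq> {a, b})}
      = map_prod w w ` {(k, l) \<in> circ (card X) d. l \<in> {i, j} \<and> {i, j} \<noteq> {k, l}}"
    unfolding warcs_def xy ij(3,4) using ij(1,2) by (auto simp: w_eq circ_def doubleton_eq_iff)
  then show "card {(a, b) \<in> warcs. b \<in> f \<and> (False \<or> f \<noteq> {a, b})} = 2 * d - 1"
    using card_circ_into_pair(2)[OF ij(1,2) ne d2 n]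
      inj[of "{(k, l) \<in> circ (card X) d. l \<in> {i, j} \<and> {i, j} \<noteq> {k, l}}"]
    by (simp add: card_image subset_iff)
qed

lemma rainbow_even: "\<exists>p. rainbow_cycle X (2 * d) p"
proof -
  obtain es where es: "tour X es" "set es = warcs" using ex_tour by blast
  then interpret tour X es True by simp
  show ?thesis by (rule rainbow_plain) (use card_warcs(1) es(2) in simp)
qed

lemma rainbow_tournament: "card X = 2 * d + 1 \<Longrightarrow> \<exists>p. rainbow_cycle X (2 * d - 1) p"
proof -
  assume n: "card X = 2 * d + 1"
  obtain es where es: "tour X es" "set es = warcs" using ex_tour by blast
  then interpret tour X es False by simp
  show ?thesis by (rule rainbow_plain) (use card_warcs(2)[OF _ n] es(2) in simp)
qed

end

subsection \<open>Inserting the 1-rainbow cycle into a tour\<close>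

lemma two_le_card: "finite S \<Longrightarrow> x \<in> S \<Longrightarrow> y \<in> S \<Longrightarrow> x \<noteq> y \<Longrightarrow> 2 \<le> card S"
  using card_mono[of S "{x, y}"] by simp

lemma three_le_card:
  "finite S \<Longrightarrow> x \<in> S \<Longrightarrow> y \<in> S \<Longrightarrow> z \<in> S \<Longrightarrow> x \<noteq> y \<Longrightarrow> x \<noteq> z \<Longrightarrow> y \<noteq> z \<Longrightarrow> 3 \<le> card S"
  using card_mono[of S "{x, y, z}"] by simp

lemma card_le_1: "S \<subseteq> {x} \<Longrightarrow> \<not> 2 \<le> card S"
  using card_mono[of "{x}" S] by simp

context hull_points
begin

section \<open>Degrees in the trees of the 1-rainbow cycle\<close>

lemma edge_iff:
  "a < n \<Longrightarrow> b < n \<Longrightarrow> i < n \<Longrightarrow> k < n \<Longrightarrow> {v ! a, v ! b} = {v ! i, v ! k} \<longleftrightarrow> (a = i \<and> b = k \<or> a = k \<and> b = i)"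
  by (auto simp: doubleton_eq_iff)

lemma nbrs_ptree:
  assumes "\<forall>i\<in>{1..<n}. par i < n" "i < n"
  shows "nbrs (ptree v par) (v ! i) =
    (if i = 0 then {} else {v ! par i}) \<union> (!) v ` {c\<in>{1..<n}. par c = i}" (is "?L = ?R")
proof
  show "?L \<subseteq> ?R"
  proof
    fix u assume "u \<in> ?L"
    then obtain c where c: "1 \<le> c" "c < n" "{v ! i, u} = {v ! c, v ! par c}"
      unfolding nbrs_def ptree_def v(3) by auto
    then have "v ! i = v ! c \<and> u = v ! par c \<or> v ! i = v ! par c \<and> u = v ! c"
      by (auto simp: doubleton_eq_iff)
    then have "i = c \<and> u = v ! par c \<or> i = par c \<and> u = v ! c"
      using v_eq[of i c] v_eq[of i "par c"] assms c(1,2) by auto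
    then show "u \<in> ?R" using c by auto
  qed
  show "?R \<subseteq> ?L"
    unfolding nbrs_def ptree_def v(3) using assms(2) by (auto simp: insert_commute image_iff)
qed

lemma finite_nbrs:
  assumes "\<forall>i\<in>{1..<n}. par i < n" "i < n"
  shows "finite (nbrs (ptree v par) (v ! i))"
  using nbrs_ptree[OF assms] by simp

lemma nbrs_outside:
  assumes "\<forall>i\<in>{1..<n}. par i < n" "x \<notin> X"
  shows "nbrs (ptree v par) x = {}"
proof -
  have "x \<noteq> v ! i" if "i < n" for i using that assms(2) by auto
  then show ?thesis unfolding nbrs_def ptree_def v(3) using assms(1) by (auto simp: doubleton_eq_iff)
qed

lemma spine_ptree:
  assumes par: "\<forall>i\<in>{1..<n}. par i < n" "I \<subseteq> {..<n}"
    and "\<And>i. i \<in> I \<Longrightarrow> 2 \<le> card (nbrs (ptree v par) (v ! i))"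
    and "\<And>i. i < n \<Longrightarrow> i \<notin> I \<Longrightarrow> \<not> 2 \<le> card (nbrs (ptree v par) (v ! i))"
  shows "spine (ptree v par) = (!) v ` I"
proof
  show "spine (ptree v par) \<subseteq> (!) v ` I"
  proof
    fix x assume x: "x \<in> spine (ptree v par)"
    then have "x \<in> X" using nbrs_outside[OF par(1), of x] by (force simp: spine_def)
    then obtain i where "i < n" "x = v ! i" using v by (metis in_set_conv_nth)
    then show "x \<in> (!) v ` I" using assms(4) x by (auto simp: spine_def)
  qed
qed (use assms in \<open>auto simp: spine_def\<close>)

lemma nbr_parent: "\<forall>i\<in>{1..<n}. par i < n \<Longrightarrow> 1 \<le> i \<Longrightarrow> i < n \<Longrightarrow> v ! par i \<in> nbrs (ptree v par) (v ! i)"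
  using nbrs_ptree[of par i] by auto

lemma nbr_child: "\<forall>i\<in>{1..<n}. par i < n \<Longrightarrow> 1 \<le> c \<Longrightarrow> c < n \<Longrightarrow> v ! c \<in> nbrs (ptree v par) (v ! par c)"
  using nbrs_ptree[of par "par c"] by auto

lemma parA_bound: "\<forall>i\<in>{1..<n}. parA j t i < n"
proof
  fix i assume i: "i \<in> {1..<n}"
  then have "parA j t i < i" by (intro parA_less) auto
  then show "parA j t i < n" using i by auto
qed

text \<open>For \<open>j \<ge> 1\<close> the root is a leaf at \<open>v ! 1\<close>, and
  \<open>v ! Suc j\<close> becomes an inner vertex with the first edge that is moved to it.\<close>

lemma spine_parA:
  assumes j: "1 \<le> j" "j \<le> n - 2" and t: "t < n - 2 - j \<or> t = 0"
  shows "spine (ptree v (parA j t)) = (!) v ` {1..if t = 0 then j else Suc j}"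
proof (rule spine_ptree)
  show p: "\<forall>i\<in>{1..<n}. parA j t i < n" by (rule parA_bound)
  show "{1..if t = 0 then j else Suc j} \<subseteq> {..<n}" using j card3 by auto
next
  fix i assume i: "i \<in> {1..if t = 0 then j else Suc j}"
  have p: "\<forall>i\<in>{1..<n}. parA j t i < n" by (rule parA_bound)
  have i': "1 \<le> i" "i < n" using i j card3 by (auto split: if_splits)
  obtain c where c: "1 \<le> c" "c < n" "parA j t c = i"
  proof (cases "i \<le> j")
    case True
    then show ?thesis using that[of "Suc i"] j card3 by (auto simp: parA_def)
  next
    case False
    then have t0: "t \<noteq> 0" "i = Suc j" using i by (auto split: if_splits)
    then have j': "j < n - 2" using t by auto
    then have "0 < length (Or j)" using length_Or by simp
    then have "Or j ! 0 \<in> set (take t (Or j))" "Or j ! 0 \<in> set (Or j)"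
      using t0 nth_mem[of 0 "take t (Or j)"] by auto
    moreover have "set (Or j) = {j + 2..<n}" using Or[OF j'] by blast
    ultimately have "Or j ! 0 \<in> set (take t (Or j))" "Or j ! 0 \<in> {j + 2..<n}" by simp_all
    then show ?thesis using that[of "Or j ! 0"] t0 by (auto simp: parA_def)
  qed
  have "parA j t c < c" by (rule parA_less[OF c(1,2)])
  then show "2 \<le> card (nbrs (ptree v (parA j t)) (v ! i))"
    using nbr_parent[OF p i'] nbr_child[OF p c(1,2)] finite_nbrs[OF p i'(2)] c i' parA_less[OF i', of j t]
    by (intro two_le_card[of _ "v ! parA j t i" "v ! c"]) auto
next
  fix i assume i: "i < n" "i \<notin> {1..if t = 0 then j else Suc j}"
  have p: "\<forall>i\<in>{1..<n}. parA j t i < n" by (rule parA_bound)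
  have "nbrs (ptree v (parA j t)) (v ! i) \<subseteq> {if i = 0 then v ! 1 else v ! parA j t i}"
    unfolding nbrs_ptree[OF p i(1)] using i j by (auto simp: parA_def split: if_splits)
  then show "\<not> 2 \<le> card (nbrs (ptree v (parA j t)) (v ! i))" by (rule card_le_1)
qed

lemma spine_parA_0:
  assumes t: "t < n - 2"
  shows "spine (ptree v (parA 0 t)) = (if t = 0 then {v ! 0} else {v ! 0, v ! 1})"
proof -
  have p: "\<forall>i\<in>{1..<n}. parA 0 t i < n" by (rule parA_bound)
  have l: "length (Or 0) = n - 2" using length_Or[of 0] card3 by simp
  have "0 < n - 2" using t by simp
  note O' = Or[OF this]
  have O: "set (Or 0) = {2..<n}" "distinct (Or 0)"
    using conjunct1[OF conjunct2[OF O']] conjunct1[OF O'] by (simp_all add: numeral_2_eq_2)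
  have "spine (ptree v (parA 0 t)) = (!) v ` {0..if t = 0 then 0 else 1}"
  proof (rule spine_ptree[OF p])
    show "{0..if t = 0 then 0 else 1} \<subseteq> {..<n}" using card3 by auto
    fix i :: nat assume i: "i \<in> {0..if t = 0 then 0 else 1}"
    show "2 \<le> card (nbrs (ptree v (parA 0 t)) (v ! i))"
    proof (cases "i = 0")
      case True
      let ?c = "Or 0 ! t"
      have "?c \<in> set (Or 0)" using l t by auto
      moreover have "?c \<notin> set (take t (Or 0))" using O(2) l t by (auto simp: in_set_conv_nth nth_eq_iff_index_eq)
      ultimately have c: "2 \<le> ?c" "?c < n" "parA 0 t ?c = 0" using O(1) by (auto simp: parA_def)
      have "parA 0 t 1 = 0" by (simp add: parA_def)
      then have "v ! 1 \<in> nbrs (ptree v (parA 0 t)) (v ! 0)" using nbr_child[OF p, of 1] card3 by simp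
      moreover have "v ! ?c \<in> nbrs (ptree v (parA 0 t)) (v ! 0)" using nbr_child[OF p, of ?c] c by simp
      moreover have "v ! 1 \<noteq> v ! ?c" using c card3 by simp
      moreover have "finite (nbrs (ptree v (parA 0 t)) (v ! 0))" using card3 by (intro finite_nbrs[OF p]) simp
      ultimately show ?thesis unfolding True by (intro two_le_card)
    next
      case False
      then have i1: "i = 1" "t \<noteq> 0" using i by (auto split: if_splits)
      let ?c = "Or 0 ! 0"
      have "0 < length (Or 0)" using l t by simp
      then have "?c \<in> set (take t (Or 0))" "?c \<in> set (Or 0)"
        using i1 nth_mem[of 0 "take t (Or 0)"] by auto
      then have c: "2 \<le> ?c" "?c < n" "parA 0 t ?c = 1" using O(1) by (auto simp: parA_def)
      have "parA 0 t 1 = 0" by (simp add: parA_def)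
      then have "v ! 0 \<in> nbrs (ptree v (parA 0 t)) (v ! 1)" using nbr_parent[OF p, of 1] card3 by simp
      moreover have "v ! ?c \<in> nbrs (ptree v (parA 0 t)) (v ! 1)" using nbr_child[OF p, of ?c] c by simp
      moreover have "v ! 0 \<noteq> v ! ?c" using c card3 by (subst v_eq) auto
      moreover have "finite (nbrs (ptree v (parA 0 t)) (v ! 1))" using card3 by (intro finite_nbrs[OF p]) simp
      ultimately show ?thesis unfolding i1 by (intro two_le_card)
    qed
  next
    fix i assume i: "i < n" "i \<notin> {0..if t = 0 then 0 else 1}"
    have "parA 0 t c \<le> (if t = 0 then 0 else 1)" if "1 \<le> c" for c using that by (auto simp: parA_def)
    then have e: "{c\<in>{1..<n}. parA 0 t c = i} = {}" using i(2) by fastforce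
    have "nbrs (ptree v (parA 0 t)) (v ! i) \<subseteq> {v ! parA 0 t i}"
      unfolding nbrs_ptree[OF p i(1)] e by simp
    then show "\<not> 2 \<le> card (nbrs (ptree v (parA 0 t)) (v ! i))" by (rule card_le_1)
  qed
  moreover have "{0..1::nat} = {0, 1}" by auto
  ultimately show ?thesis by simp
qed

text \<open>The last tree before the cycle returns to the star is a near-star at the root, so the
  cycle can be left through a detour star.\<close>

lemma parF_near_star: "ptree v (parF (n - 2)) = near_star X (v ! 0) (v ! (n - 1)) (v ! (n - 2))"
proof -
  have S: "{1..<n} = insert (n - 1) {1..<n - 1}" using card3 by auto
  have X: "X - {v ! 0, v ! (n - 1)} = (!) v ` {1..<n - 1}"
  proof
    show "X - {v ! 0, v ! (n - 1)} \<subseteq> (!) v ` {1..<n - 1}"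
    proof
      fix x assume x: "x \<in> X - {v ! 0, v ! (n - 1)}"
      then obtain i where i: "i < n" "x = v ! i" using v by (metis DiffD1 in_set_conv_nth)
      then have "i \<noteq> 0" "i \<noteq> n - 1" using x by auto
      then show "x \<in> (!) v ` {1..<n - 1}" using i by auto
    qed
  qed (use card3 in auto)
  have "(\<lambda>i. {v ! i, v ! parF (n - 2) i}) ` {1..<n - 1} = (\<lambda>i. {v ! 0, v ! i}) ` {1..<n - 1}"
    by (intro image_cong) (auto simp: parF_def insert_commute)
  moreover have "parF (n - 2) (n - 1) = n - 2" using card3 by (auto simp: parF_def)
  ultimately show ?thesis
    unfolding near_star_def star_def X ptree_def v(3) S image_insert image_image by (simp add: insert_commute)
qed

text \<open>A coarse description by degrees and a few missing edges that still keeps these trees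
  apart from a tour. The clauses describe, in turn, the stages from the second one on with the path,
  the star, the rest of the first stage, the fan \<open>parF 2\<close>, the tree \<open>parZ\<close>
  (\<open>u = v ! 2\<close>) and the middle fans (\<open>u = v ! 0\<close>), and the fan
  \<open>parF (n - 2)\<close>. For \<open>m = 3\<close> the spine might be that of a link tree; the
  missing edge excludes this.\<close>

definition cyc_class :: "(real^2) set set \<Rightarrow> bool" where
  "cyc_class T \<longleftrightarrow>
     (\<exists>m. 1 \<le> m \<and> m < n \<and> spine T = (!) v ` {1..m} \<and> (m = 3 \<longrightarrow> {v ! 1, v ! 3} \<notin> T)) \<or>
     spine T = {v ! 0} \<or> spine T = {v ! 0, v ! 1} \<or> 4 \<le> card (spine T) \<or>
     (\<exists>u\<in>{v ! 0, v ! 2}. u \<in> heavy T \<and> v ! (n - 2) \<in> spine T \<and> {u, v ! (n - 2)} \<notin> T) \<or>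
     spine T = {v ! 0, v ! (n - 2)}"

lemma cyc_class_cyc:
  assumes c6: "n \<ge> 6" and T: "T \<in> set (map fst (cyc (n - 1)))"
  shows "cyc_class T"
proof -
  have pF: "\<forall>i\<in>{1..<n}. parF k i < n" for k by (auto simp: parF_def)
  have pZ: "\<forall>i\<in>{1..<n}. parZ i < n" using c6 by (auto simp: parZ_def)
  have A: "cyc_class (ptree v (parA j t))" if j: "j \<le> n - 2" "t < n - 2 - j \<or> t = 0" for j t
  proof (cases "j = 0")
    case True
    then have "spine (ptree v (parA j t)) = {v ! 0} \<or> spine (ptree v (parA j t)) = {v ! 0, v ! 1}"
      using spine_parA_0[of t] j c6 by (cases "t = 0") simp_all
    then show ?thesis unfolding cyc_class_def by blast
  next
    case False
    define m where "m = (if t = 0 then j else Suc j)"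
    have m: "1 \<le> m" "m < n" using False j c6 by (auto simp: m_def)
    have "spine (ptree v (parA j t)) = (!) v ` {1..m}"
      using spine_parA[of j t] False j unfolding m_def by auto
    moreover have "{v ! 1, v ! 3} \<notin> ptree v (parA j t)" if "m = 3"
    proof -
      have "parA j t 3 = 2" using that by (auto simp: m_def parA_def split: if_splits)
      then have "{v ! 3, v ! 1} \<notin> ptree v (parA j t)"
        using ptree_edge_iff[of v 3 1 "parA j t"] v(1,3) c6 parA_less by auto
      then show ?thesis by (simp add: insert_commute)
    qed
    ultimately show ?thesis using m unfolding cyc_class_def by blast
  qed
  have Z: "cyc_class (ptree v parZ)"
  proof -
    have z: "parZ 2 = 0" "parZ 1 = 2" "parZ 3 = 2" "parZ (n - 2) = n - 3" "parZ (n - 1) = n - 2"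
      using c6 by (auto simp: parZ_def)
    have "v ! 2 \<in> heavy (ptree v parZ)"
      unfolding heavy_def mem_Collect_eq
      using nbr_parent[OF pZ, of 2] nbr_child[OF pZ, of 1] nbr_child[OF pZ, of 3] finite_nbrs[OF pZ, of 2] c6
      unfolding z by (intro three_le_card[of _ "v ! 0" "v ! 1" "v ! 3"]) auto
    moreover have "v ! (n - 2) \<in> spine (ptree v parZ)"
      unfolding spine_def mem_Collect_eq
      using nbr_parent[OF pZ, of "n - 2"] nbr_child[OF pZ, of "n - 1"] finite_nbrs[OF pZ, of "n - 2"] c6
      unfolding z by (intro two_le_card[of _ "v ! (n - 3)" "v ! (n - 1)"]) auto
    moreover have "{v ! 2, v ! (n - 2)} \<notin> ptree v parZ"
    proof
      assume "{v ! 2, v ! (n - 2)} \<in> ptree v parZ"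
      then obtain i where i: "i \<in> {1..<n}" "{v ! 2, v ! (n - 2)} = {v ! i, v ! parZ i}"
        unfolding ptree_def v(3) by (elim imageE)
      then have "2 = i \<and> n - 2 = parZ i \<or> 2 = parZ i \<and> n - 2 = i"
        using edge_iff[of 2 "n - 2" i "parZ i"] pZ c6 by auto
      then show False using c6 by (auto simp: parZ_def split: if_splits)
    qed
    ultimately show ?thesis unfolding cyc_class_def by blast
  qed
  have F: "cyc_class (ptree v (parF k))" if k: "2 \<le> k" "k < n - 1" for k
  proof -
    have f: "parF k 1 = 0" "parF k 2 = 0" using k by (auto simp: parF_def)
    consider "k = 2" | "3 \<le> k" "k \<le> n - 3" | "k = n - 2" using k by linarith
    then show ?thesis
    proof cases
      case 1
      have sp: "v ! i \<in> spine (ptree v (parF k))" if "i \<in> {2, 3, 4}" for i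
      proof -
        have "1 \<le> i" "i < n" "parF k (Suc i) = i" "Suc i < n" using that c6 1 by (auto simp: parF_def)
        then show ?thesis
          unfolding spine_def mem_Collect_eq
          using nbr_parent[OF pF[of k], of i] nbr_child[OF pF[of k], of "Suc i"] finite_nbrs[OF pF[of k], of i] parF_less[of i k]
          by (intro two_le_card[of _ "v ! parF k i" "v ! Suc i"]) auto
      qed
      have "v ! 0 \<in> spine (ptree v (parF k))"
        unfolding spine_def mem_Collect_eq
        using nbr_child[OF pF[of k], of 1] nbr_child[OF pF[of k], of 2] finite_nbrs[OF pF[of k], of 0] c6
        unfolding f by (intro two_le_card[of _ "v ! 1" "v ! 2"]) auto
      then have "(!) v ` {0, 2, 3, 4} \<subseteq> spine (ptree v (parF k))" using sp by auto
      moreover have "finite (spine (ptree v (parF k)))"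
      proof (rule finite_subset[OF _ finite_X])
        show "spine (ptree v (parF k)) \<subseteq> X"
          using nbrs_outside[OF pF[of k], of _] by (force simp: spine_def)
      qed
      moreover have "card ((!) v ` {0, 2, 3, 4}) = 4"
        using c6 by (subst card_image) (auto simp: inj_on_def)
      ultimately have "4 \<le> card (spine (ptree v (parF k)))" using card_mono by metis
      then show ?thesis by (simp add: cyc_class_def)
    next
      case 2
      have f3: "parF k 3 = 0" using 2 by (auto simp: parF_def)
      have "v ! 0 \<in> heavy (ptree v (parF k))"
        unfolding heavy_def mem_Collect_eq
        using nbr_child[OF pF[of k], of 1] nbr_child[OF pF[of k], of 2] nbr_child[OF pF[of k], of 3] finite_nbrs[OF pF[of k], of 0] c6
        unfolding f f3 by (intro three_le_card[of _ "v ! 1" "v ! 2" "v ! 3"]) auto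
      moreover have e: "parF k (n - 1) = n - 2" using 2 c6 by (auto simp: parF_def)
      have "v ! (n - 2) \<in> spine (ptree v (parF k))"
        unfolding spine_def mem_Collect_eq
      proof (rule two_le_card[of _ "v ! parF k (n - 2)" "v ! (n - 1)"])
        have "1 \<le> n - 2" using c6 by simp
        then have "parF k (n - 2) < n - 2" by (rule parF_less)
        then have "parF k (n - 2) < n - 1" by linarith
        then show "v ! parF k (n - 2) \<noteq> v ! (n - 1)" using v_eq[of "parF k (n - 2)" "n - 1"] c6 by simp
        show "v ! (n - 1) \<in> nbrs (ptree v (parF k)) (v ! (n - 2))"
          using nbr_child[OF pF[of k], of "n - 1"] c6 unfolding e by simp
        show "v ! parF k (n - 2) \<in> nbrs (ptree v (parF k)) (v ! (n - 2))"
          using c6 by (intro nbr_parent[OF pF[of k]]) auto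
      qed (use finite_nbrs[OF pF[of k], of "n - 2"] c6 in auto)
      moreover have "{v ! (n - 2), v ! 0} \<notin> ptree v (parF k)"
        using ptree_edge_iff[of v "n - 2" 0 "parF k"] v(1,3) c6 parF_less 2 by (auto simp: parF_def)
      moreover have "{v ! (n - 2), v ! 0} = {v ! 0, v ! (n - 2)}" by (rule insert_commute)
      ultimately have "\<exists>u\<in>{v ! 0, v ! 2}. u \<in> heavy (ptree v (parF k)) \<and>
          v ! (n - 2) \<in> spine (ptree v (parF k)) \<and> {u, v ! (n - 2)} \<notin> ptree v (parF k)"
        by (intro bexI[of _ "v ! 0"]) simp_all
      then show ?thesis unfolding cyc_class_def by blast
    next
      case 3
      have "spine (double_star (v ! (n - 2)) (v ! 0) {v ! (n - 1)} (X - {v ! (n - 2), v ! 0, v ! (n - 1)})) = {v ! (n - 2), v ! 0}"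
      proof (rule spine_double_star(1))
        have "v ! 1 \<in> X - {v ! (n - 2), v ! 0, v ! (n - 1)}" using c6 by auto
        then show "X - {v ! (n - 2), v ! 0, v ! (n - 1)} \<noteq> {}" by blast
      qed (use c6 finite_X in auto)
      moreover have "near_star X (v ! 0) (v ! (n - 1)) (v ! (n - 2)) =
          double_star (v ! (n - 2)) (v ! 0) {v ! (n - 1)} (X - {v ! (n - 2), v ! 0, v ! (n - 1)})"
        using c6 by (intro near_star_eq_double_star(1)) auto
      ultimately have "spine (ptree v (parF k)) = {v ! 0, v ! (n - 2)}"
        unfolding 3 parF_near_star by (simp add: insert_commute)
      then show ?thesis unfolding cyc_class_def by blast
    qed
  qed
  from T consider j t where "j < n - 2" "t < n - 2 - j" "T = ptree v (parA j t)" | "T = ptree v (parA (n - 2) 0)"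
    | "T = ptree v parZ" | k where "2 \<le> k" "k < n - 1" "T = ptree v (parF k)"
    by (auto simp: cyc_def stage_def)
  then show ?thesis
    by cases (use A Z F c6 in auto)
qed

text \<open>\<open>v ! (n - 1)\<close>, \<open>v ! 0\<close> and \<open>v ! 1\<close> are
  consecutive on the convex hull.\<close>

lemma exceptional_hull:
  "exceptional X (v ! 1) (v ! 0)" "exceptional X (v ! 0) (v ! (n - 1))"
proof -
  have pos: "orient (v ! 0) (v ! s) (v ! t) > 0" if "1 \<le> s" "s < t" "t < n" for s t
    using hull that v(3) unfolding hull_order_def by auto
  have "\<not> orient (v ! 1) (v ! 0) (v ! k) > 0" if "k < n" for k
  proof -
    have "orient (v ! 1) (v ! 0) (v ! k) = - orient (v ! 0) (v ! 1) (v ! k)" by (simp add: orient_def algebra_simps)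
    moreover have "k = 0 \<or> k = 1 \<or> 1 < k" by auto
    ultimately show ?thesis using pos[of 1 k] that by (auto simp: orient_def)
  qed
  then show "exceptional X (v ! 1) (v ! 0)" unfolding exceptional_def using v by (metis in_set_conv_nth)
  have "\<not> orient (v ! 0) (v ! (n - 1)) (v ! k) > 0" if "k < n" for k
  proof (cases "k = 0 \<or> k = n - 1")
    case False
    then have "1 \<le> k" "k < n - 1" "n - 1 < n" using that by linarith+
    then show ?thesis using pos[of k "n - 1"] orient_swap[of "v ! 0" "v ! (n - 1)" "v ! k"] by simp
  qed auto
  then show "exceptional X (v ! 0) (v ! (n - 1))" unfolding exceptional_def using v by (metis in_set_conv_nth)
qed

text \<open>A sweep starts with the rotational successor of its target, and around the root the
  points follow each other by index.\<close>

lemma hd_sweep_root: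
  assumes "n \<ge> 6"
  shows "hd (sweep X (v ! 0) (v ! 2)) = v ! 3"
proof -
  have pos: "orient (v ! 0) (v ! s) (v ! t) > 0" if "1 \<le> s" "s < t" "t < n" for s t
    using hull that v(3) unfolding hull_order_def by auto
  have "is_sweep X (v ! 0) (v ! 2) (sweep X (v ! 0) (v ! 2))"
    using assms by (intro is_sweep_sweep) auto
  moreover have "\<not> exceptional X (v ! 0) (v ! 2)"
    unfolding exceptional_def using pos[of 2 3] assms v_in[of 3] by auto
  ultimately have s: "succ_of X (v ! 0) (v ! 2) (hd (sweep X (v ! 0) (v ! 2)))" by (simp add: is_sweep_def)
  then obtain i where i: "i < n" "hd (sweep X (v ! 0) (v ! 2)) = v ! i"
    using v unfolding succ_of_def by (metis in_set_conv_nth)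
  have o: "orient (v ! 0) (v ! 2) (v ! i) > 0" using s i by (simp add: succ_of_def)
  have "i \<ge> 3"
  proof (rule ccontr)
    assume "\<not> i \<ge> 3"
    then consider "i = 0" | "i = 1" | "i = 2" by linarith
    then show False
      by cases (use o pos[of 1 2] assms orient_swap[of "v ! 0" "v ! 1" "v ! 2"] in auto)
  qed
  moreover have "\<not> 3 < i"
  proof
    assume "3 < i"
    then have "orient (v ! 0) (v ! i) (v ! 3) > 0"
      using s i pos[of 2 3] assms unfolding succ_of_def by auto
    then show False using pos[of 3 i] \<open>3 < i\<close> i orient_swap[of "v ! 0" "v ! 3" "v ! i"] by auto
  qed
  ultimately show ?thesis using i by (metis le_neq_implies_less)
qed

text \<open>Seen from the root, no point lies between two consecutive ones, so an edge at the root
  passes beside the segment that joins them.\<close>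

lemma nc_root_side:
  assumes "1 \<le> p" "Suc p < n" "k \<in> X" "k \<noteq> v ! 0" "k \<noteq> v ! p" "k \<noteq> v ! Suc p"
  shows "\<not> crossing {v ! 0, k} {v ! p, v ! Suc p}"
proof -
  obtain i where i: "i < n" "k = v ! i" using v assms(3) by (metis in_set_conv_nth)
  then have "i \<noteq> 0" "i \<noteq> p" "i \<noteq> Suc p" using assms by auto
  then consider "i < p" | "Suc p < i" by linarith
  then show ?thesis
  proof cases
    case 1
    then show ?thesis
      using hull_order_not_crossing[OF hull, of 0 i p "Suc p"] assms i v(3) \<open>i \<noteq> 0\<close> by auto
  next
    case 2
    then show ?thesis
      using hull_order_not_crossing_root[OF hull, of p "Suc p" i] assms i v(3) by auto
  qed
qed

end

text \<open>The pairs in \<open>nonadj\<close> are those whose arcs could produce a tree of the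
  inserted cycle. The hull neighbours of the root are excluded to keep the tour from the stars at
  \<open>v ! 0\<close> and \<open>v ! 1\<close>, the pairs at \<open>v ! 1\<close> because of spines
  formed by the first points, and the pairs at \<open>v ! (n - 2)\<close> because of
  \<open>parZ\<close>, the fans and \<open>bridge\<close>. The arc in \<open>start\<close> follows
  the passage into which the cycle is inserted.\<close>

locale merge = tour X es True + hull_points X v Or
  for X :: "(real^2) set" and es and v and Or +
  assumes nonadj: "\<And>x y. (x, y) \<in> {(v ! 0, v ! 1), (v ! 1, v ! 2), (v ! 1, v ! 3), (v ! 0, v ! (card X - 2)),
      (v ! 2, v ! (card X - 2)), (v ! 0, v ! (card X - 1))} \<Longrightarrow> (x, y) \<notin> set es \<and> (y, x) \<notin> set es"
    and start: "(v ! 0, v ! 2) \<in> set es"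
begin

section \<open>Separating the inserted trees from those of the tour\<close>

lemma index_bounds: "0 < n" "1 < n" "2 < n" "3 < n" "n - 2 < n" "n - 1 < n"
  using card6 by auto

lemma v_less_neq: "i < j \<Longrightarrow> j < n \<Longrightarrow> v ! i \<noteq> v ! j"
  using v_eq[of i j] by simp

lemma hull_points_distinct: "v ! 0 \<noteq> v ! 1" "v ! 0 \<noteq> v ! 2" "v ! 0 \<noteq> v ! 3" "v ! 1 \<noteq> v ! 2" "v ! 1 \<noteq> v ! 3" "v ! 2 \<noteq> v ! 3"
    "v ! 0 \<noteq> v ! (n - 2)" "v ! 1 \<noteq> v ! (n - 2)" "v ! 2 \<noteq> v ! (n - 2)" "v ! 3 \<noteq> v ! (n - 2)"
    "v ! 0 \<noteq> v ! (n - 1)" "v ! 1 \<noteq> v ! (n - 1)" "v ! 2 \<noteq> v ! (n - 1)" "v ! 3 \<noteq> v ! (n - 1)"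
    "v ! (n - 2) \<noteq> v ! (n - 1)"
  by (rule v_less_neq; (use card6 in simp))+

lemma adj_pair:
  assumes "(a, b) \<in> set es" "x \<in> {a, b}" "y \<in> {a, b}" "x \<noteq> y"
  shows "(x, y) \<in> set es \<or> (y, x) \<in> set es"
  using assms by auto

text \<open>A passage uses the star only next to an exceptional neighbour of its centre. For
  \<open>v ! 0\<close> and \<open>v ! 1\<close> this is a hull neighbour, and the arcs to it are
  excluded.\<close>

lemma no_star:
  assumes i: "i < length es" and e: "exceptional X (H i) (A i) \<or> exceptional X (H i) (H (nx i))"
  shows "H i \<noteq> v ! 0" "H i \<noteq> v ! 1"
proof -
  obtain q where q: "exceptional X (H i) q" "q \<in> X" "q \<noteq> H i" "(q, H i) \<in> set es \<or> (H i, q) \<in> set es"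
    using e es_X[OF arc[OF i]] es_X[OF arc_nx[OF i]] arc[OF i] arc_nx[OF i] by metis
  show "H i \<noteq> v ! 0"
  proof
    assume h: "H i = v ! 0"
    have "q = v ! (n - 1)"
      using exceptional_unique[of "v ! 0" q "v ! (n - 1)"] q(1-3) exceptional_hull(2) index_bounds hull_points_distinct unfolding h by simp
    then show False using q(4) nonadj[of "v ! 0" "v ! (n - 1)"] unfolding h by auto
  qed
  show "H i \<noteq> v ! 1"
  proof
    assume h: "H i = v ! 1"
    have "q = v ! 0"
      using exceptional_unique[of "v ! 1" q "v ! 0"] q(1-3) exceptional_hull(1) index_bounds hull_points_distinct unfolding h by simp
    then show False using q(4) nonadj[of "v ! 0" "v ! 1"] unfolding h by auto
  qed
qed

lemma card_image_v: "m < n \<Longrightarrow> card ((!) v ` {1..m}) = m"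
  by (subst card_image) (auto simp: inj_on_def)

lemma far_vertex:
  assumes u: "u \<in> {v ! 0, v ! 2}"
  shows "u \<noteq> v ! (n - 2)" "(u, v ! (n - 2)) \<notin> set es" "(v ! (n - 2), u) \<notin> set es"
proof -
  show "u \<noteq> v ! (n - 2)" using u index_bounds hull_points_distinct by auto
  have "(u, v ! (n - 2)) \<notin> set es \<and> (v ! (n - 2), u) \<notin> set es" using u by (intro nonadj) auto
  then show "(u, v ! (n - 2)) \<notin> set es" "(v ! (n - 2), u) \<notin> set es" by auto
qed

lemma class_cases:
  assumes "cyc_class T"
  obtains (path) m where "1 \<le> m" "m < n" "spine T = (!) v ` {1..m}" "card (spine T) = m" "m = 3 \<Longrightarrow> {v ! 1, v ! 3} \<notin> T"
    | (root) "spine T = {v ! 0}"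
    | (root_edge) "spine T = {v ! 0, v ! 1}" "card (spine T) = 2"
    | (big) "4 \<le> card (spine T)"
    | (far) u where "u \<in> {v ! 0, v ! 2}" "u \<in> heavy T" "v ! (n - 2) \<in> spine T" "{u, v ! (n - 2)} \<notin> T"
    | (far_edge) "spine T = {v ! 0, v ! (n - 2)}" "card (spine T) = 2"
proof -
  have c: "card {v ! 0, v ! 1} = 2" "card {v ! 0, v ! (n - 2)} = 2" using index_bounds hull_points_distinct by auto
  show thesis
    using assms unfolding cyc_class_def
  proof (elim disjE exE conjE bexE)
    fix m assume "1 \<le> m" "m < n" "spine T = (!) v ` {1..m}" "m = 3 \<longrightarrow> {v ! 1, v ! 3} \<notin> T"
    then show thesis using card_image_v[of m] by (intro path[of m]) auto
  next
    fix u assume "u \<in> {v ! 0, v ! 2}" "u \<in> heavy T" "v ! (n - 2) \<in> spine T" "{u, v ! (n - 2)} \<notin> T"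
    then show thesis by (rule far)
  qed (use root root_edge big far_edge c in auto)
qed

lemma heavy_spine: "heavy T \<subseteq> spine T"
  by (auto simp: heavy_def spine_def)

lemma atLeastAtMost_small: "{1..2::nat} = {1, 2}" "{1..3::nat} = {1, 2, 3}"
  by auto

lemma class_not_arc:
  assumes T: "cyc_class T" and ab: "(a, b) \<in> set es"
  shows "spine T \<noteq> {a, b}"
proof
  assume eq: "spine T = {a, b}"
  have c2: "card {a, b} = 2" using es_X[OF ab] by simp
  have contr: False if "{x, y} = {a, b}" "x \<noteq> y" "(x, y) \<in> {(v ! 0, v ! 1), (v ! 1, v ! 2), (v ! 1, v ! 3), (v ! 0, v ! (n - 2)),
      (v ! 2, v ! (n - 2)), (v ! 0, v ! (n - 1))}" for x y
    using adj_pair[OF ab, of x y] nonadj[OF that(3)] that by blast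
  from T show False
  proof (cases rule: class_cases)
    case (path m)
    then have "m = 2" using eq c2 by simp
    then have "{v ! 1, v ! 2} = {a, b}" using path(3) eq atLeastAtMost_small by simp
    then show False using contr[of "v ! 1" "v ! 2"] index_bounds hull_points_distinct by auto
  next
    case root
    then show False using eq c2 by simp
  next
    case root_edge
    then show False using contr[of "v ! 0" "v ! 1"] eq index_bounds hull_points_distinct by auto
  next
    case big
    then show False using eq c2 by simp
  next
    case (far u)
    then have "u \<in> spine T" using heavy_spine[of T] by blast
    then have "u \<in> {a, b}" "v ! (n - 2) \<in> {a, b}" using eq far(3) by simp_all
    then show False using adj_pair[OF ab] far_vertex[OF far(1)] by blast
  next
    case far_edge
    then show False using contr[of "v ! 0" "v ! (n - 2)"] eq index_bounds hull_points_distinct by auto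
  qed
qed

text \<open>The link point has degree two and is adjacent to both centres. If the spine consists of
  \<open>v ! 1\<close>, \<open>v ! 2\<close> and \<open>v ! 3\<close>, then \<open>v ! 1\<close> is
  on no arc with the others and must be the link point, but it is not adjacent to
  \<open>v ! 3\<close>. If \<open>u\<close> is heavy, it is a centre, so \<open>v ! (n - 2)\<close>
  is the link point, but it is not adjacent to \<open>u\<close>.\<close>

lemma class_not_link:
  assumes T: "cyc_class T" and ab: "(a, b) \<in> set es"
  shows "T \<noteq> link_tree a b"
proof
  assume eq: "T = link_tree a b"
  interpret m: move X a b using ab move by blast
  obtain k where k: "spine T = {a, b, k}" "card (nbrs T k) = 2" "{a, b} \<notin> T" "{a, k} \<in> T" "{b, k} \<in> T"
    using m.link_props eq by blast
  have c3: "card (spine T) = 3" using m.spine_link_card eq by simp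
  have kh: "k \<notin> heavy T" using k(2) by (simp add: heavy_def)
  from T show False
  proof (cases rule: class_cases)
    case (path m)
    then have "m = 3" using c3 by simp
    then have sp: "{a, b, k} = {v ! 1, v ! 2, v ! 3}" and e: "{v ! 1, v ! 3} \<notin> T"
      using path(3,5) k(1) atLeastAtMost_small by simp_all
    have n1: "(v ! 1, v ! 2) \<notin> set es" "(v ! 2, v ! 1) \<notin> set es" "(v ! 1, v ! 3) \<notin> set es" "(v ! 3, v ! 1) \<notin> set es"
      using nonadj[of "v ! 1" "v ! 2"] nonadj[of "v ! 1" "v ! 3"] by auto
    have "v ! 1 \<in> {a, b, k}" "v ! 3 \<in> {a, b, k}" using sp by auto
    have a1: "a \<noteq> v ! 1" "b \<noteq> v ! 1"
      using ab n1 sp m.ab(3) by (metis insertCI insertE singletonD)+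
    then have k1: "k = v ! 1" using sp by auto
    have "v ! 3 \<noteq> v ! 1" using index_bounds hull_points_distinct by auto
    then have "v ! 3 = a \<or> v ! 3 = b" using \<open>v ! 3 \<in> {a, b, k}\<close> k1 by auto
    then show False using k(4,5) e k1 by (auto simp: insert_commute)
  next
    case (far u)
    then have "u \<in> spine T" "u \<noteq> k" using heavy_spine[of T] kh by blast+
    then have "u \<in> {a, b}" using k(1) by simp
    moreover have "v ! (n - 2) \<in> {a, b, k}" using far k(1) by auto
    moreover have "v ! (n - 2) \<notin> {a, b}" using adj_pair[OF ab] far_vertex[OF far(1)] calculation(1) by blast
    ultimately have "v ! (n - 2) = k" by auto
    then show False using far(4) k(4,5) \<open>u \<in> {a, b}\<close> by auto
  next
    case root
    then show False using c3 by simp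
  next
    case root_edge
    then show False using c3 by simp
  next
    case big
    then show False using c3 by simp
  next
    case far_edge
    then show False using c3 by simp
  qed
qed

text \<open>The centre of a detour star is its only heavy vertex, and it is joined by arcs of the
  tour to the other two vertices of the spine. The excluded pairs contradict this; the stars are
  dealt with by \<open>no_star\<close>.\<close>

lemma class_not_conn:
  assumes T: "cyc_class T" and i: "i < length es"
  shows "T \<notin> set (map fst (tl (conn (A i) (H i) (H (nx i)))))"
proof
  assume "T \<in> set (map fst (tl (conn (A i) (H i) (H (nx i)))))"
  with i show False
  proof (cases rule: conn_cases)
    case star
    note ns = no_star[OF i star(4)]
    from T show False
    proof (cases rule: class_cases)
      case (path m)
      then have "m = 1" using star by simp
      then have "spine T = {v ! 1}" using path(3) by simp
      then show False using star(2) ns(2) by simp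
    next
      case root
      then show False using star(2) ns(1) by simp
    next
      case root_edge
      then show False using star(3) by simp
    next
      case big
      then show False using star(3) by simp
    next
      case (far u)
      then have "u = H i" "v ! (n - 2) = H i" using star(2) heavy_spine[of T] by auto
      then show False using far_vertex(1)[OF far(1)] by simp
    next
      case far_edge
      then show False using star(3) by simp
    qed
  next
    case detour
    define a b c where abc: "a = A i" "b = H i" "c = H (nx i)"
    have ar: "(a, b) \<in> set es" "(b, c) \<in> set es" "a \<noteq> b" "b \<noteq> c"
      unfolding abc using arc[OF i] arc_nx[OF i] es_X by blast+
    from T show False
    proof (cases rule: class_cases)
      case (path m)
      then have "m = 3" using detour(4) by simp
      then have sp: "{A i, H i, H (nx i)} = {v ! 1, v ! 2, v ! 3}"
        using path(3) detour(2) atLeastAtMost_small by simp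
      have n1: "(v ! 1, v ! 2) \<notin> set es" "(v ! 2, v ! 1) \<notin> set es" "(v ! 1, v ! 3) \<notin> set es" "(v ! 3, v ! 1) \<notin> set es"
        using nonadj[of "v ! 1" "v ! 2"] nonadj[of "v ! 1" "v ! 3"] by auto
      have H: "b \<in> {v ! 1, v ! 2, v ! 3}" "a \<in> {v ! 1, v ! 2, v ! 3}" "c \<in> {v ! 1, v ! 2, v ! 3}"
        using sp unfolding abc by auto
      have "a \<noteq> v ! 1" using ar(1,3) H(1) n1 by auto
      moreover have "b \<noteq> v ! 1" using ar(2,4) H(3) n1 by auto
      moreover have "c \<noteq> v ! 1" using ar(2,4) H(1) n1 by auto
      moreover have "v ! 1 \<in> {a, b, c}" unfolding abc sp by simp
      ultimately show False by simp
    next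
      case (far u)
      then have "u = b" "v ! (n - 2) \<in> {a, b, c}" using detour(2,3) unfolding abc by auto
      then show False using far_vertex[OF far(1)] ar by auto
    next
      case root
      then show False using detour(4) by simp
    next
      case root_edge
      then show False using detour(4) by simp
    next
      case big
      then show False using detour(4) by simp
    next
      case far_edge
      then show False using detour(4) by simp
    qed
  qed
qed

text \<open>The inserted cycle starts with the star at the root, so leaving it towards
  \<open>v ! 2\<close> has to avoid that star. This is the detour star between the fan
  \<open>parF (n - 2)\<close> and the first tree of the move to \<open>v ! 2\<close>.\<close>

definition bridge :: "(real^2) set set" where
  "bridge = detour_star X (v ! 0) (v ! (n - 1)) (v ! (n - 2)) (v ! 3) (v ! 2)"

lemma bridge_points:
  "v ! 0 \<in> X" "v ! (n - 1) \<in> X" "v ! (n - 2) \<in> X" "v ! 3 \<in> X" "v ! 2 \<in> X"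
  "v ! (n - 1) \<noteq> v ! 0" "v ! (n - 2) \<noteq> v ! 0" "v ! (n - 2) \<noteq> v ! (n - 1)" "v ! 3 \<noteq> v ! 0" "v ! 2 \<noteq> v ! 0" "v ! 2 \<noteq> v ! 3"
  "v ! (n - 1) \<noteq> v ! 3" "v ! (n - 2) \<noteq> v ! 2" "\<not> (v ! (n - 1) = v ! 2 \<and> v ! 3 = v ! (n - 2))"
  using hull_points_distinct v_in[OF index_bounds(1)] v_in[OF index_bounds(3)] v_in[OF index_bounds(4)] v_in[OF index_bounds(5)] v_in[OF index_bounds(6)] by metis+

lemma bridge_spine: "spine bridge = {v ! (n - 2), v ! 0, v ! 2}" "heavy bridge = {v ! 0}" "card (spine bridge) = 3"
proof -
  show sp: "spine bridge = {v ! (n - 2), v ! 0, v ! 2}" and "heavy bridge = {v ! 0}"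
    unfolding bridge_def using detour_star_nbrs[OF finite_X card6 bridge_points] by auto
  show "card (spine bridge) = 3" unfolding sp using bridge_points by simp
qed

lemma plane_bridge: "plane_spanning_tree X bridge"
  unfolding bridge_def
proof (rule plane_detour_star[OF bridge_points])
  have s: "Suc (n - 2) = n - 1" using card6 by simp
  fix k assume k: "k \<in> X" "k \<noteq> v ! 0"
  show "\<not> crossing {v ! 0, k} {v ! (n - 2), v ! (n - 1)}" if "k \<noteq> v ! (n - 2)" "k \<noteq> v ! (n - 1)"
    using nc_root_side[of "n - 2" k] k that card6 unfolding s by simp
  show "\<not> crossing {v ! 0, k} {v ! 2, v ! 3}" if "k \<noteq> v ! 2" "k \<noteq> v ! 3"
    using nc_root_side[of 2 k] k that card6 by simp
next
  have "\<not> crossing {v ! 2, v ! 3} {v ! (n - 2), v ! (n - 1)}"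
    using hull_order_not_crossing[OF hull, of 2 3 "n - 2" "n - 1"] card6 v(3) by auto
  then show "\<not> crossing {v ! (n - 2), v ! (n - 1)} {v ! 2, v ! 3}" by (simp add: crossing_commute)
qed

lemma bridge_edges: "{v ! 0, v ! (n - 2)} \<in> bridge" "{v ! 2, v ! (n - 2)} \<notin> bridge"
proof -
  have "v ! (n - 2) \<noteq> v ! 3" "v ! (n - 1) \<noteq> v ! 2" using hull_points_distinct(10,13) by metis+
  then show "{v ! 0, v ! (n - 2)} \<in> bridge" "{v ! 2, v ! (n - 2)} \<notin> bridge"
    unfolding bridge_def detour_star_def insert_iff edge_star doubleton_eq_iff
    using bridge_points by simp_all
qed

text \<open>The spine has three elements and contains the root, which leaves only the clause with
  \<open>heavy\<close>. There \<open>u\<close> is the root, but the root is adjacent to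
  \<open>v ! (n - 2)\<close>.\<close>

lemma bridge_not_class: "\<not> cyc_class bridge"
proof
  assume "cyc_class bridge"
  then show False
  proof (cases rule: class_cases)
    case (path m)
    then have "v ! 0 \<in> (!) v ` {1..m}" using bridge_spine(1) by auto
    then obtain i where "1 \<le> i" "i \<le> m" "v ! 0 = v ! i" by auto
    then show False using v_eq[of 0 i] path(2) index_bounds(1) by simp
  next
    case (far u)
    then have "u = v ! 0" using bridge_spine(2) by simp
    then show False using far(4) bridge_edges(1) by simp
  qed (use bridge_spine(3) in auto)
qed

text \<open>The root is heavy and thus a centre. It is on no arc with \<open>v ! (n - 2)\<close>, so
  this would be the link point and adjacent to the other centre \<open>v ! 2\<close>.\<close>

lemma bridge_not_link:
  assumes ab: "(a, b) \<in> set es"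
  shows "bridge \<noteq> link_tree a b"
proof
  assume eq: "bridge = link_tree a b"
  interpret m: move X a b using ab move by blast
  define k where "k = sweep X a b ! (loc a b - 1)"
  have k: "spine bridge = {a, b, k}" "card (nbrs bridge k) = 2" "{a, k} \<in> bridge" "{b, k} \<in> bridge"
    unfolding k_def eq using m.link_props(1,4,6,7) by simp_all
  have mem: "v ! 0 \<in> {a, b, k}" "v ! (n - 2) \<in> {a, b, k}" "v ! 2 \<in> {a, b, k}"
    unfolding k(1)[symmetric] bridge_spine(1) by simp_all
  have "3 \<le> card (nbrs bridge (v ! 0))" using bridge_spine(2) unfolding heavy_def by blast
  then have "k \<noteq> v ! 0" using k(2) by auto
  then have 0: "v ! 0 \<in> {a, b}" using mem(1) by simp
  have "v ! (n - 2) \<notin> {a, b}" using adj_pair[OF ab] far_vertex[of "v ! 0"] 0 by blast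
  then have kk: "k = v ! (n - 2)" using mem(2) by simp
  then have "v ! 2 \<in> {a, b}" using mem(3) bridge_points(13) by simp
  then show False using k(3,4) kk bridge_edges(2) by auto
qed

lemma bridge_not_conn:
  assumes i: "i < length es"
  shows "bridge \<notin> set (map fst (tl (conn (A i) (H i) (H (nx i)))))"
proof
  assume "bridge \<in> set (map fst (tl (conn (A i) (H i) (H (nx i)))))"
  with i show False
  proof (cases rule: conn_cases)
    case star
    then show False using bridge_spine(3) by simp
  next
    case detour
    then have H: "H i = v ! 0" using bridge_spine(2) by simp
    have "v ! (n - 2) \<in> {A i, H i, H (nx i)}" unfolding detour(2)[symmetric] bridge_spine(1) by simp
    then have "v ! (n - 2) = A i \<or> v ! (n - 2) = H (nx i)" using H bridge_points by auto
    then have "(v ! (n - 2), v ! 0) \<in> set es \<or> (v ! 0, v ! (n - 2)) \<in> set es"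
      using arc[OF i] arc_nx[OF i] H by metis
    then show False using far_vertex[of "v ! 0"] by blast
  qed
qed

text \<open>The tour enters the star at the root and then follows the 1-rainbow cycle up to
  \<open>parF (n - 2)\<close>. The closing flip of that cycle, by which \<open>v ! (n - 1)\<close>
  is joined to the root, is made only after the edge from \<open>v ! 2\<close> to
  \<open>v ! 3\<close> has entered; so it leads to the first tree of the move to
  \<open>v ! 2\<close> instead of back to the star. Beyond the labels of an ordinary passage every
  label occurs once.\<close>

lemma rainbow_merge:
  assumes r: "\<And>f. f \<in> point_pairs X \<Longrightarrow> card {(a, b) \<in> set es. b \<in> f \<and> (True \<or> f \<noteq> {a, b})} = r"
  shows "\<exists>p. rainbow_cycle X (Suc r) p"
proof -
  let ?L = "length es"
  obtain j where j: "j < ?L" "es ! j = (v ! 0, v ! 2)" using start by (metis in_set_conv_nth)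
  \<comment> \<open>The cyclic predecessor of \<open>j\<close>: the arc by which the tour reaches
    the root before leaving it for \<open>v ! 2\<close>.\<close>
  define i0 where "i0 = (if j = 0 then ?L - 1 else j - 1)"
  have i0: "i0 < ?L" "nx i0 = j" using j(1) by (auto simp: i0_def)
  have Hi0: "H i0 = v ! 0" "H (nx i0) = v ! 2" using closed[OF i0(1)] i0(2) j(2) by simp_all
  let ?a = "A i0"
  let ?y = "last (sweep X ?a (v ! 0))"
  define mid where "mid = cyc (n - 2) @ [(ptree v (parF (n - 2)), {v ! 2, v ! 3}), (bridge, {v ! 0, v ! (n - 1)})]"
  define cn where "cn i = (if i = i0 then (stage_tree ?a (v ! 0) (N - 1), {v ! 0, ?y}) # mid
    else conn (A i) (H i) (H (nx i)))" for i
  interpret m1: move X ?a "v ! 0" using move[OF arc[OF i0(1)]] Hi0 by simp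
  interpret m2: move X "v ! 0" "v ! 2" using move[OF start] .
  have mid_trees: "map fst mid = map fst (cyc (n - 1)) @ [bridge]"
  proof -
    have "[2..<n - 1] = [2..<n - 2] @ [n - 2]"
    proof -
      have "n - 1 = Suc (n - 2)" "2 \<le> n - 2" using card6 by auto
      then show ?thesis by (metis upt_Suc)
    qed
    then show ?thesis by (simp add: mid_def cyc_def)
  qed
  have cn_tl: "tl (cn i) = (if i = i0 then mid else tl (conn (A i) (H i) (H (nx i))))" for i
    by (simp add: cn_def)
  have cls: "cyc_class T \<or> T = bridge" if "T \<in> set (map fst mid)" for T
    using that cyc_class_cyc[OF card6, of T] unfolding mid_trees by auto
  have snd_cyc: "count_list (map snd mid) f = count_list (map snd (cyc (n - 1))) f + (if f = {v ! 2, v ! 3} then 1 else 0)" for f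
  proof -
    have "[2..<n - 1] = [2..<n - 2] @ [n - 2]"
    proof -
      have "n - 1 = Suc (n - 2)" "2 \<le> n - 2" using card6 by auto
      then show ?thesis by (metis upt_Suc)
    qed
    moreover have "Suc (n - 2) = n - 1" using card6 by simp
    ultimately have "map snd (cyc (n - 1)) = map snd (cyc (n - 2)) @ [{v ! 0, v ! (n - 1)}]"
      by (simp add: cyc_def insert_commute)
    then show ?thesis by (simp add: mid_def count_list_append)
  qed
  have y: "?y \<in> X" "?y \<noteq> ?a" "?y \<noteq> v ! 0"
  proof -
    have "N - 1 < N" using card6 by simp
    then show "?y \<in> X" "?y \<noteq> ?a" "?y \<noteq> v ! 0" using m1.sw_nth[of "N - 1"] m1.hd_last_sw by auto
  qed
  show ?thesis
  proof (rule tour_rainbow[where cn = cn and ex = "\<lambda>i f. if i = i0 then 1 else 0"])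
    fix i assume i: "i < ?L"
    show "cn i \<noteq> [] \<and> fst (hd (cn i)) = stage_tree (A i) (H i) (N - 1)"
      using hd_conn[of "A i" "H i" "H (nx i)"] Hi0 by (simp add: cn_def)
    show "flip_path X (cn i) (stage_tree (H i) (H (nx i)) 1)"
    proof (cases "i = i0")
      case True
      have 1: "flip (stage_tree ?a (v ! 0) (N - 1)) {v ! 0, ?y} (star (v ! 0) (X - {v ! 0}))"
        unfolding m1.stage_tree_last using y m1.ab by (intro flip_near_star_star) auto
      have src: "source (cyc (n - 2)) T = star (v ! 0) (X - {v ! 0})" for T
      proof -
        have "cyc (n - 2) \<noteq> []" by (simp add: cyc_def)
        then have "source (cyc (n - 2)) T = fst (hd (cyc (n - 2)))" by (cases "cyc (n - 2)") auto
        then show ?thesis using parF_star parA_star by (simp add: hd_cyc star_def)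
      qed
      have 2: "flip_path X (cyc (n - 2)) (ptree v (parF (n - 2)))" using card6 by (intro flip_path_cyc) auto
      have 3: "flip (ptree v (parF (n - 2))) {v ! 2, v ! 3} bridge"
        unfolding parF_near_star bridge_def by (rule flip_near_star_detour[OF bridge_points])
      have 4: "flip bridge {v ! 0, v ! (n - 1)} (stage_tree (v ! 0) (v ! 2) 1)"
        unfolding m2.stage_tree_first hd_sweep_root[OF card6] bridge_def
        by (rule flip_detour_near_star[OF bridge_points])
      show ?thesis
        using True 1 2 3 4 src m1.plane_stage_tree plane_parF plane_bridge Hi0
        by (simp add: cn_def mid_def flip_path_append)
    next
      case False
      then show ?thesis
        using flip_path_conn[OF move[OF arc[OF i]] move[OF arc_nx[OF i]] A_neq[OF i]] by (simp add: cn_def)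
    qed
    show "distinct (map fst (tl (cn i)))"
    proof (cases "i = i0")
      case True
      have "distinct (map fst (cyc (n - 1)))" using card6 by (intro distinct_cyc) auto
      moreover have "bridge \<notin> set (map fst (cyc (n - 1)))" using cyc_class_cyc[OF card6] bridge_not_class by blast
      ultimately have "distinct (map fst mid)" unfolding mid_trees by simp
      then show ?thesis using True cn_tl by simp
    qed (simp add: cn_tl conn_def)
    fix T a b assume T: "T \<in> set (map fst (tl (cn i)))" and ab: "(a, b) \<in> set es"
    show "spine T \<noteq> {a, b} \<and> T \<noteq> link_tree a b"
    proof (cases "i = i0")
      case True
      then have "cyc_class T \<or> T = bridge" using T cls cn_tl by simp
      then show ?thesis
      proof
        assume "T = bridge"
        moreover have "card {a, b} = 2" using es_X[OF ab] by simp
        ultimately show ?thesis using bridge_not_link[OF ab] bridge_spine(3) by auto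
      qed (use class_not_arc class_not_link ab in blast)
    next
      case False
      then show ?thesis using conn_not_stage[OF i _ ab, of T] T cn_tl by simp
    qed
  next
    fix i j T assume ij: "i < j" "j < ?L" and T: "T \<in> set (map fst (tl (cn i)))"
    have i: "i < ?L" using ij by simp
    have mc: "T \<notin> set (map fst (tl (conn (A k) (H k) (H (nx k)))))" if "T \<in> set (map fst mid)" "k < ?L" for k T
      using cls[OF that(1)] class_not_conn[OF _ that(2)] bridge_not_conn[OF that(2)] by blast
    consider "i = i0" "j \<noteq> i0" | "j = i0" "i \<noteq> i0" | "i \<noteq> i0" "j \<noteq> i0" using ij by auto
    then show "T \<notin> set (map fst (tl (cn j)))"
    proof cases
      case 1
      then show ?thesis using mc[of T j] T ij cn_tl by simp
    next
      case 2
      then show ?thesis using mc[of T i] T i cn_tl by auto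
    next
      case 3
      then show ?thesis using conn_disjoint[OF i ij(2), of T] ij T cn_tl by simp
    qed
  next
    fix i f assume i: "i < ?L" and f: "f \<in> point_pairs X"
    show "count_list (map snd (cn i)) f = (if f = {H i, last (sweep X (A i) (H i))} then 1 else 0) +
      (if f = {H (nx i), hd (sweep X (H i) (H (nx i)))} then 1 else 0) + (if i = i0 then 1 else 0)"
    proof (cases "i = i0")
      case True
      then show ?thesis
        using snd_cyc[of f] count_cyc[OF f] Hi0 hd_sweep_root[OF card6] by (simp add: cn_def)
    next
      case False
      then show ?thesis using count_conn[of "A i" "H i" "H (nx i)" f] by (simp add: cn_def)
    qed
  next
    fix f assume "f \<in> point_pairs X"
    then show "card {(a, b) \<in> set es. b \<in> f \<and> (True \<or> f \<noteq> {a, b})} + (\<Sum>i<?L. if i = i0 then 1 else 0) = Suc r"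
      using r i0(1) by (simp add: sum.delta)
  qed
qed

end

section \<open>Labellings that avoid prescribed pairs\<close>

lemma ex_bij_extending:
  assumes "finite A" "S \<subseteq> A" "inj_on g S" "g ` S \<subseteq> A"
  shows "\<exists>h. bij_betw h A A \<and> (\<forall>x\<in>S. h x = g x)"
proof -
  have "card (A - S) = card (A - g ` S)"
    using assms by (simp add: card_Diff_subset finite_subset card_image)
  then obtain k where k: "bij_betw k (A - S) (A - g ` S)"
    using finite_same_card_bij[of "A - S" "A - g ` S"] assms(1) by auto
  define h where "h x = (if x \<in> S then g x else k x)" for x
  have "bij_betw h S (g ` S)"
    using assms(3) by (auto simp: bij_betw_def h_def inj_on_def)
  moreover have "bij_betw h (A - S) (A - g ` S)"
    using k by (rule bij_betw_cong[THEN iffD1, rotated]) (auto simp: h_def)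
  ultimately have "bij_betw h (S \<union> (A - S)) (g ` S \<union> (A - g ` S))"
    by (rule bij_betw_combine) auto
  moreover have "S \<union> (A - S) = A" "g ` S \<union> (A - g ` S) = A" using assms by auto
  ultimately show ?thesis by (intro exI[of _ h]) (simp add: h_def)
qed

text \<open>The root has label 0 and \<open>v ! 2\<close> label 1. The labels \<open>d + 1\<close>,
  \<open>d + 2\<close> and \<open>d + 3\<close> are at cyclic distance more than \<open>d\<close>
  from 0, and \<open>2 * d + 4 \<le> n\<close> is exactly the condition for that; they go to
  \<open>v ! (n - 1)\<close>, \<open>v ! 1\<close> and \<open>v ! (n - 2)\<close>. The middle one is
  also far from 1 and \<open>n - 1\<close>, the labels of \<open>v ! 2\<close> and
  \<open>v ! 3\<close>.\<close>

lemma (in hull_points) rainbow_odd: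
  assumes d: "1 \<le> d" "2 * d + 4 \<le> n"
  shows "\<exists>p. rainbow_cycle X (2 * d + 1) p"
proof -
  define S where "S = {0, 1, n - 1, d + 1, d + 2, d + 3}"
  define g where "g x = (if x = 0 then 0 else if x = 1 then 2 else if x = n - 1 then 3 else
    if x = d + 1 then n - 1 else if x = d + 2 then 1 else n - 2)" for x :: nat
  have "inj_on g S" using d unfolding S_def inj_on_def g_def by auto
  moreover have "S \<subseteq> {..<n}" "g ` S \<subseteq> {..<n}" using d unfolding S_def g_def by auto
  ultimately obtain h where h: "bij_betw h {..<n} {..<n}" "\<And>x. x \<in> S \<Longrightarrow> h x = g x"
    using ex_bij_extending[of "{..<n}" S g] by auto
  define w where "w i = v ! h i" for i
  have "bij_betw ((!) v) {..<n} X"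
    using v by (auto simp: bij_betw_def inj_on_def in_set_conv_nth)
  then have "bij_betw w {..<n} X"
    using bij_betw_trans[OF h(1)] by (simp add: w_def comp_def cong: bij_betw_cong)
  then interpret labelled_points X w d
    using d by unfold_locales auto
  obtain es where es: "tour X es" "set es = warcs" using ex_tour by blast
  interpret t: tour X es True by (rule es(1))
  have w: "v ! 0 = w 0" "v ! 2 = w 1" "v ! 3 = w (n - 1)" "v ! (n - 1) = w (d + 1)" "v ! 1 = w (d + 2)" "v ! (n - 2) = w (d + 3)"
    unfolding w_def using h(2) d by (auto simp: S_def g_def)
  have non: "(w i, w j) \<notin> set es \<and> (w j, w i) \<notin> set es"
    if "i < n" "j < n" "(i, j) \<notin> circ n d" "(j, i) \<notin> circ n d" for i j
    using that warcs_iff es(2) by simp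
  interpret merge X es v Or
  proof
    show "(v ! 0, v ! 2) \<in> set es"
      unfolding w es(2) using d by (subst warcs_iff) (auto simp: circ_def)
    fix x y assume "(x, y) \<in> {(v ! 0, v ! 1), (v ! 1, v ! 2), (v ! 1, v ! 3), (v ! 0, v ! (n - 2)),
      (v ! 2, v ! (n - 2)), (v ! 0, v ! (n - 1))}"
    then have "(x, y) \<in> {(w 0, w (d + 2)), (w (d + 2), w 1), (w (d + 2), w (n - 1)), (w 0, w (d + 3)),
      (w 1, w (d + 3)), (w 0, w (d + 1))}" unfolding w .
    then obtain i j where "x = w i" "y = w j" "(i, j) \<in> {(0, d + 2), (d + 2, 1), (d + 2, n - 1), (0, d + 3), (1, d + 3), (0, d + 1)}"
      by auto
    moreover from this(3) have "i < n" "j < n" "(i, j) \<notin> circ n d" "(j, i) \<notin> circ n d"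
      using d by (auto simp: circ_def)
    ultimately show "(x, y) \<notin> set es \<and> (y, x) \<notin> set es" using non by simp
  qed
  have "\<exists>p. rainbow_cycle X (Suc (2 * d)) p"
    by (rule rainbow_merge) (use card_warcs(1) es(2) in simp)
  then show ?thesis by simp
qed

subsection \<open>Four and five points\<close>

text \<open>Four or five points can be labelled so that only those edges cross that would cross if the
  points were in convex position in the order of the labels. Hence cycles found by a computer search
  for convex position serve all configurations.\<close>

definition interleaved :: "nat \<times> nat \<Rightarrow> nat \<times> nat \<Rightarrow> bool" where
  "interleaved e f \<longleftrightarrow> fst e < fst f \<and> fst f < snd e \<and> snd e < snd f \<or>
     fst f < fst e \<and> fst e < snd f \<and> snd f < snd e"

definition sorted_edge :: "nat \<times> nat \<Rightarrow> nat \<times> nat" where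
  "sorted_edge e = (min (fst e) (snd e), max (fst e) (snd e))"

text \<open>Edges are listed as (child, parent), each child being new and each parent already
  reached; such a list certifies a tree.\<close>

fun grows :: "nat list \<Rightarrow> (nat \<times> nat) list \<Rightarrow> bool" where
  "grows vs [] \<longleftrightarrow> True"
| "grows vs (e # es) \<longleftrightarrow> snd e \<in> set vs \<and> fst e \<notin> set vs \<and> grows (fst e # vs) es"

definition edges_upto :: "nat \<Rightarrow> (nat \<times> nat) list" where
  "edges_upto n = concat (map (\<lambda>j. map (\<lambda>i. (i, j)) [0..<j]) [0..<n])"

definition tree_ok :: "nat \<Rightarrow> (nat \<times> nat) list \<Rightarrow> bool" where
  "tree_ok n es \<longleftrightarrow> grows [snd (hd es)] es \<and> list_all (\<lambda>i. i \<in> set (snd (hd es) # map fst es)) [0..<n] \<and>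
     list_all (\<lambda>e. fst e < n \<and> snd e < n) es \<and> es \<noteq> [] \<and>
     list_all (\<lambda>e. list_all (\<lambda>f. \<not> interleaved (sorted_edge e) (sorted_edge f)) es) es"

definition flip_ok :: "(nat \<times> nat) list \<Rightarrow> nat \<times> nat \<Rightarrow> (nat \<times> nat) list \<Rightarrow> bool" where
  "flip_ok s l t \<longleftrightarrow> (let S = map sorted_edge s; T = map sorted_edge t in
     l \<notin> set S \<and> list_ex (\<lambda>e. list_all (\<lambda>x. x \<in> set T) (l # removeAll e S) \<and>
       list_all (\<lambda>x. x \<in> set (l # removeAll e S)) T) S)"

fun path_ok :: "nat \<Rightarrow> ((nat \<times> nat) list \<times> nat \<times> nat) list \<Rightarrow> (nat \<times> nat) list \<Rightarrow> bool" where
  "path_ok n [] t' \<longleftrightarrow> True"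
| "path_ok n (x # xs) t' \<longleftrightarrow> tree_ok n (fst x) \<and> flip_ok (fst x) (snd x) (source xs t') \<and> path_ok n xs t'"

text \<open>A tree has many lists of edges, so distinctness is tested on characteristic vectors over
  all edges.\<close>

definition cycle_ok :: "nat \<Rightarrow> nat \<Rightarrow> ((nat \<times> nat) list \<times> nat \<times> nat) list \<Rightarrow> bool" where
  "cycle_ok n r xs \<longleftrightarrow> xs \<noteq> [] \<and> path_ok n xs (fst (hd xs)) \<and>
     distinct (map (\<lambda>x. map (\<lambda>e. e \<in> set (map sorted_edge (fst x))) (edges_upto n)) xs) \<and>
     list_all (\<lambda>e. count_list (map snd xs) e = r) (edges_upto n) \<and>
     list_all (\<lambda>x. snd x \<in> set (edges_upto n)) xs"

definition rooted_tree :: "'a set \<Rightarrow> 'a set set \<Rightarrow> bool" where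
  "rooted_tree V T \<longleftrightarrow> (\<exists>r par (rank :: 'a \<Rightarrow> nat). r \<in> V \<and>
     (\<forall>v\<in>V - {r}. par v \<in> V \<and> rank (par v) < rank v) \<and> T = (\<lambda>v. {v, par v}) ` (V - {r}))"

lemma rooted_tree_insert:
  assumes "rooted_tree V T" "q \<in> V" "c \<notin> V"
  shows "rooted_tree (insert c V) (insert {c, q} T)"
proof -
  obtain r par and rank :: "'a \<Rightarrow> nat" where *: "r \<in> V" "\<forall>v\<in>V - {r}. par v \<in> V \<and> rank (par v) < rank v"
    "T = (\<lambda>v. {v, par v}) ` (V - {r})"
    using assms(1) unfolding rooted_tree_def by blast
  have c: "c \<noteq> r" "insert c V - {r} = insert c (V - {r})" using assms * by auto
  have "(\<lambda>v. {v, (par(c := q)) v}) ` (V - {r}) = T"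
    unfolding *(3) using assms(3) by (intro image_cong) auto
  then have "insert {c, q} T = (\<lambda>v. {v, (par(c := q)) v}) ` (insert c V - {r})"
    unfolding c(2) image_insert by simp
  moreover have "\<forall>v\<in>insert c V - {r}. (par(c := q)) v \<in> insert c V \<and>
      (rank(c := Suc (rank q))) ((par(c := q)) v) < (rank(c := Suc (rank q))) v"
    using *(2) assms(2,3) by auto
  ultimately show ?thesis
    unfolding rooted_tree_def using *(1) by blast
qed

lemma rooted_tree_spanning: "rooted_tree X T \<Longrightarrow> spanning_tree_on X T"
proof -
  assume "rooted_tree X T"
  then obtain r par and rank :: "'a \<Rightarrow> nat" where *: "r \<in> X" "\<forall>v\<in>X - {r}. par v \<in> X \<and> rank (par v) < rank v"
    "T = (\<lambda>v. {v, par v}) ` (X - {r})"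
    unfolding rooted_tree_def by blast
  show ?thesis by (rule spanning_tree_parentI[OF *(1) _ *(3), where rank = rank]) (use *(2) in blast)
qed

definition pedge :: "(nat \<Rightarrow> 'a) \<Rightarrow> nat \<times> nat \<Rightarrow> 'a set" where
  "pedge p e = {p (fst e), p (snd e)}"

lemma pedge_sorted [simp]: "pedge p (sorted_edge e) = pedge p e"
  by (auto simp: pedge_def sorted_edge_def min_def max_def)

lemma grows_rooted_tree:
  assumes "grows vs es" "rooted_tree (p ` set vs) T" "inj_on p (set vs \<union> fst ` set es)"
  shows "rooted_tree (p ` (set vs \<union> fst ` set es)) (T \<union> pedge p ` set es)"
  using assms
proof (induction es arbitrary: vs T)
  case (Cons e es)
  have "p (fst e) \<notin> p ` set vs"
    using Cons.prems by (auto simp: inj_on_def)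
  then have "rooted_tree (insert (p (fst e)) (p ` set vs)) (insert {p (fst e), p (snd e)} T)"
    using Cons.prems by (intro rooted_tree_insert) auto
  then have "rooted_tree (p ` set (fst e # vs)) (insert (pedge p e) T)" by (simp add: pedge_def)
  then have "rooted_tree (p ` (set (fst e # vs) \<union> fst ` set es)) (insert (pedge p e) T \<union> pedge p ` set es)"
    using Cons.prems by (intro Cons.IH) auto
  then show ?case by simp
qed simp

lemma set_edges_upto: "set (edges_upto n) = {(i, j). i < j \<and> j < n}"
  by (auto simp: edges_upto_def)

text \<open>By \<open>cr\<close>, trees without interleaved edges are plane on \<open>X\<close>. The
  rest of the certificate is combinatorial and is carried over by \<open>pedge p\<close>, which is
  injective on normalised edges.\<close>

lemma (in points) rainbow_if_cycle_ok:
  assumes p: "bij_betw p {..<n} X"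
    and cr: "\<And>i j k l. i < j \<Longrightarrow> j < n \<Longrightarrow> k < l \<Longrightarrow> l < n \<Longrightarrow> crossing {p i, p j} {p k, p l} \<Longrightarrow> interleaved (i, j) (k, l)"
    and ok: "cycle_ok n r xs"
  shows "\<exists>q. rainbow_cycle X r q"
proof -
  define tree where "tree es = pedge p ` set es" for es
  have pin: "p i = p j \<longleftrightarrow> i = j" if "i < n" "j < n" for i j
    using p that by (auto simp: bij_betw_def inj_on_def)
  have inj: "inj_on (pedge p) {(i, j). i < j \<and> j < n}"
    by (rule inj_onI) (auto simp: pedge_def doubleton_eq_iff pin)
  have tree_sorted: "tree es = pedge p ` sorted_edge ` set es" for es
    unfolding tree_def image_image by simp
  have srt: "sorted_edge e \<in> {(i, j). i < j \<and> j < n}" if "fst e < n" "snd e < n" "fst e \<noteq> snd e" for e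
    using that by (auto simp: sorted_edge_def)
  have grow_ne: "grows vs es \<Longrightarrow> e \<in> set es \<Longrightarrow> fst e \<noteq> snd e" for vs es and e :: "nat \<times> nat"
    by (induction vs es rule: grows.induct) auto
  have sorted_sub: "sorted_edge ` set es \<subseteq> {(i, j). i < j \<and> j < n}" if "tree_ok n es" for es
  proof
    fix x assume "x \<in> sorted_edge ` set es"
    then obtain e where e: "e \<in> set es" "x = sorted_edge e" by blast
    have "fst e < n" "snd e < n" "fst e \<noteq> snd e"
      using that e(1) grow_ne[of "[snd (hd es)]" es e] by (auto simp: tree_ok_def list_all_iff)
    then show "x \<in> {(i, j). i < j \<and> j < n}" unfolding e(2) by (rule srt)
  qed
  have pst: "plane_spanning_tree X (tree es)" if t: "tree_ok n es" for es
  proof (rule plane_spanning_treeI)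
    let ?r = "snd (hd es)"
    have V: "{?r} \<union> fst ` set es = {..<n}"
      using t by (cases es) (auto simp: tree_ok_def list_all_iff)
    have "rooted_tree (p ` set [?r]) {}" by (auto simp: rooted_tree_def)
    moreover have "inj_on p (set [?r] \<union> fst ` set es)" using p V by (simp add: bij_betw_def)
    ultimately have "rooted_tree (p ` (set [?r] \<union> fst ` set es)) ({} \<union> pedge p ` set es)"
      using t by (intro grows_rooted_tree) (auto simp: tree_ok_def)
    moreover have "set [?r] \<union> fst ` set es = {..<n}" using V by simp
    moreover have "p ` {..<n} = X" using p by (rule bij_betw_imp_surj_on)
    ultimately have "rooted_tree X (tree es)" unfolding tree_def by (simp only: Un_empty_left)
    then show "spanning_tree_on X (tree es)" by (rule rooted_tree_spanning)
    fix e f assume ef: "e \<in> tree es" "f \<in> tree es"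
    then obtain x y where xy: "x \<in> set es" "y \<in> set es" "e = pedge p (sorted_edge x)" "f = pedge p (sorted_edge y)"
      by (auto simp: tree_def)
    then have "\<not> interleaved (sorted_edge x) (sorted_edge y)" using t by (auto simp: tree_ok_def list_all_iff)
    moreover have "sorted_edge x \<in> {(i, j). i < j \<and> j < n}" "sorted_edge y \<in> {(i, j). i < j \<and> j < n}"
      using sorted_sub[OF t] xy by auto
    ultimately show "\<not> crossing e f"
      using cr[of "fst (sorted_edge x)" "snd (sorted_edge x)" "fst (sorted_edge y)" "snd (sorted_edge y)"] xy(3,4)
      by (auto simp: pedge_def)
  qed
  have flp: "flip (tree s) (pedge p l) (tree t)"
    if s: "tree_ok n s" and l: "l \<in> {(i, j). i < j \<and> j < n}" and st: "flip_ok s l t" for s l t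
  proof -
    let ?S = "sorted_edge ` set s"
    have l_notin: "l \<notin> ?S" using st by (simp add: flip_ok_def Let_def)
    obtain e where "e \<in> set (map sorted_edge s)"
      "\<forall>x\<in>set (l # removeAll e (map sorted_edge s)). x \<in> set (map sorted_edge t)"
      "\<forall>x\<in>set (map sorted_edge t). x \<in> set (l # removeAll e (map sorted_edge s))"
      using st unfolding flip_ok_def Let_def list_ex_iff list_all_iff by blast
    moreover from this(2,3) have "set (map sorted_edge t) = set (l # removeAll e (map sorted_edge s))" by blast
    ultimately have e: "e \<in> ?S" "sorted_edge ` set t = insert l (?S - {e})" by simp_all
    have sub: "?S \<subseteq> {(i, j). i < j \<and> j < n}" using sorted_sub[OF s] .
    have "pedge p l \<notin> tree s"
      unfolding tree_sorted using inj_on_image_mem_iff[OF inj l sub] l_notin by simp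
    moreover have "pedge p e \<in> tree s" unfolding tree_sorted using e(1) by blast
    moreover have "tree t = insert (pedge p l) (tree s - {pedge p e})"
    proof -
      have "pedge p ` (?S - {e}) = pedge p ` ?S - pedge p ` {e}"
        using e(1) by (intro inj_on_image_set_diff[OF inj_on_subset[OF inj sub]]) auto
      then show ?thesis unfolding tree_sorted e(2) by simp
    qed
    ultimately show ?thesis unfolding flip_def by blast
  qed
  define ys where "ys = map (\<lambda>x. (tree (fst x), pedge p (snd x))) xs"
  have lab: "snd x \<in> {(i, j). i < j \<and> j < n}" if "x \<in> set xs" for x
    using ok that unfolding cycle_ok_def list_all_iff set_edges_upto[symmetric] by simp
  have src: "source (map (\<lambda>x. (tree (fst x), pedge p (snd x))) zs) (tree t) = tree (source zs t)" for zs t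
    by (cases zs) auto
  have fp: "flip_path X (map (\<lambda>x. (tree (fst x), pedge p (snd x))) zs) (tree t)"
    if "path_ok n zs t" "set zs \<subseteq> set xs" for zs t
    using that
  proof (induction zs)
    case (Cons z zs)
    then show ?case using pst flp lab[of z] by (auto simp: src)
  qed simp
  show ?thesis
  proof (rule rainbow_cycleI[of ys])
    show "ys \<noteq> []" using ok by (simp add: ys_def cycle_ok_def)
    have "fst (hd ys) = tree (fst (hd xs))" using ok by (simp add: ys_def cycle_ok_def hd_map)
    then show "flip_path X ys (fst (hd ys))" using fp[of xs] ok by (simp add: ys_def cycle_ok_def)
    have tok: "tree_ok n (fst x)" if "x \<in> set xs" for x
    proof -
      have "path_ok n zs t \<Longrightarrow> x \<in> set zs \<Longrightarrow> tree_ok n (fst x)" for zs t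
        by (induction zs) auto
      then show ?thesis using ok that by (auto simp: cycle_ok_def)
    qed
    define vec where "vec = (\<lambda>x :: (nat \<times> nat) list \<times> nat \<times> nat.
      map (\<lambda>e. e \<in> set (map sorted_edge (fst x))) (edges_upto n))"
    have d: "distinct (map vec xs)" using ok by (simp add: cycle_ok_def vec_def)
    have vec_eq: "vec x = vec y" if "x \<in> set xs" "y \<in> set xs" "tree (fst x) = tree (fst y)" for x y
    proof -
      have "sorted_edge ` set (fst x) = sorted_edge ` set (fst y)"
        by (rule iffD1[OF inj_on_image_eq_iff[OF inj sorted_sub[OF tok[OF that(1)]] sorted_sub[OF tok[OF that(2)]]]
              that(3)[unfolded tree_sorted]])
      then show ?thesis by (simp add: vec_def)
    qed
    have "inj_on vec (set xs)" using d by (simp add: distinct_map)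
    then have "inj_on (\<lambda>x. tree (fst x)) (set xs)" using vec_eq by (intro inj_onI) (rule inj_onD)
    then show "distinct (map fst ys)"
      using d by (simp add: ys_def comp_def distinct_map)
    fix f assume "f \<in> point_pairs X"
    then obtain x y where "f = {x, y}" "x \<noteq> y" "x \<in> X" "y \<in> X" by (auto simp: point_pairs_def card_2_iff)
    moreover have "X = p ` {..<n}" using bij_betw_imp_surj_on[OF p] by simp
    ultimately obtain i j where ij: "i < n" "j < n" "i \<noteq> j" "f = pedge p (i, j)"
      by (auto simp: pedge_def)
    define e where "e = sorted_edge (i, j)"
    have e: "e \<in> {(i, j). i < j \<and> j < n}" "f = pedge p e" using srt[of "(i, j)"] ij by (auto simp: e_def)
    have cl: "count_list (map (pedge p) ls) (pedge p e) = count_list ls e" if "set ls \<subseteq> {(i, j). i < j \<and> j < n}" for ls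
      using that
    proof (induction ls)
      case (Cons l ls)
      then have "pedge p l = pedge p e \<longleftrightarrow> l = e" using inj_on_eq_iff[OF inj _ e(1), of l] by simp
      then show ?case using Cons by simp
    qed simp
    have m: "map snd ys = map (pedge p) (map snd xs)" by (simp add: ys_def)
    have "set (map snd xs) \<subseteq> {(i, j). i < j \<and> j < n}" using lab by auto
    then have "count_list (map snd ys) f = count_list (map snd xs) e" unfolding e(2) m by (rule cl)
    then show "count_list (map snd ys) f = r"
      using ok e(1) unfolding cycle_ok_def list_all_iff set_edges_upto[symmetric] by simp
  qed
qed

text \<open>Four labels can be split into two pairs in three ways. \<open>nc\<close> deals with the
  two that do not interleave, and edges with a common end point never cross.\<close>

lemma (in points) interleaved_if_crossing:
  assumes p: "\<And>i. i < n \<Longrightarrow> p i \<in> X" "inj_on p {..<n}"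
    and nc: "\<And>i j k l. i < j \<Longrightarrow> j < k \<Longrightarrow> k < l \<Longrightarrow> l < n \<Longrightarrow>
      \<not> crossing {p i, p j} {p k, p l} \<and> \<not> crossing {p i, p l} {p j, p k}"
    and ij: "i < j" "j < n" "k < l" "l < n" and cr: "crossing {p i, p j} {p k, p l}"
  shows "interleaved (i, j) (k, l)"
proof (rule ccontr)
  assume ni: "\<not> interleaved (i, j) (k, l)"
  have pp: "{p a, p b} \<in> point_pairs X" if "a < b" "b < n" for a b
  proof -
    have "p a \<noteq> p b" using inj_onD[OF p(2), of a b] that by auto
    then show ?thesis using p(1)[of a] p(1)[of b] that by (simp add: point_pairs_def)
  qed
  have "{p i, p j} \<inter> {p k, p l} = {}" using not_crossing_meet[OF pp pp] ij cr by blast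
  then have ne: "i \<noteq> k" "i \<noteq> l" "j \<noteq> k" "j \<noteq> l" by auto
  consider "j < k" | "i < k" "l < j" | "l < i" | "k < i" "j < l"
    using ni ne ij by (auto simp: interleaved_def)
  then show False
  proof cases
    case 1
    then show False using nc[of i j k l] ij cr by blast
  next
    case 2
    then show False using nc[of i k l j] ij cr by blast
  next
    case 3
    then show False using nc[of k l i j] ij cr crossing_commute by blast
  next
    case 4
    then show False using nc[of k i j l] ij cr crossing_commute by blast
  qed
qed

section \<open>Labelling four or five points as if in convex position\<close>

definition convex_labelling :: "(real^2) set \<Rightarrow> (nat \<Rightarrow> real^2) \<Rightarrow> bool" where
  "convex_labelling X p \<longleftrightarrow> bij_betw p {..<card X} X \<and>
     (\<forall>i j k l. i < j \<longrightarrow> j < card X \<longrightarrow> k < l \<longrightarrow> l < card X \<longrightarrow> crossing {p i, p j} {p k, p l} \<longrightarrow>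
       interleaved (i, j) (k, l))"

context hull_points
begin

lemma bij_v: "bij_betw ((!) v) {..<n} X"
  using v by (auto simp: bij_betw_def inj_on_def in_set_conv_nth)

lemma convex_labellingI:
  assumes s: "bij_betw s {..<n} {..<n}"
    and nc: "\<And>i j k l. i < j \<Longrightarrow> j < k \<Longrightarrow> k < l \<Longrightarrow> l < n \<Longrightarrow>
      \<not> crossing {v ! s i, v ! s j} {v ! s k, v ! s l} \<and> \<not> crossing {v ! s i, v ! s l} {v ! s j, v ! s k}"
  shows "\<exists>p. convex_labelling X p"
proof -
  define p where "p i = v ! s i" for i
  have b: "bij_betw p {..<n} X"
    using bij_betw_trans[OF s bij_v] by (simp add: p_def comp_def cong: bij_betw_cong)
  have "convex_labelling X p"
    unfolding convex_labelling_def
  proof (intro conjI allI impI)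
    fix i j k l assume *: "i < j" "j < n" "k < l" "l < n" "crossing {p i, p j} {p k, p l}"
    show "interleaved (i, j) (k, l)"
    proof (rule interleaved_if_crossing[OF _ _ _ *])
      show "p i \<in> X" if "i < n" for i using b that by (auto simp: bij_betw_def)
      show "inj_on p {..<n}" using b by (simp add: bij_betw_def)
    qed (use nc in \<open>auto simp: p_def\<close>)
  qed (rule b)
  then show ?thesis by blast
qed

lemma nc_disjoint: "i < j \<Longrightarrow> j \<le> k \<Longrightarrow> k < l \<Longrightarrow> l < n \<Longrightarrow> \<not> crossing {v ! i, v ! j} {v ! k, v ! l}"
  using hull_order_not_crossing[OF hull] v(3) by simp

lemma nc_nested_root: "1 \<le> k \<Longrightarrow> k < l \<Longrightarrow> l < j \<Longrightarrow> j < n \<Longrightarrow> \<not> crossing {v ! 0, v ! j} {v ! k, v ! l}"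
  using hull_order_not_crossing_root[OF hull, of k l j] v(3) by simp

text \<open>The angular order itself works unless a nested pair without the root crosses, which
  requires five points and means \<open>v ! 1\<close>, \<open>v ! 4\<close> against
  \<open>v ! 2\<close>, \<open>v ! 3\<close>. Then \<open>v ! 2\<close> and \<open>v ! 3\<close> are
  on different sides of the line through \<open>v ! 1\<close> and \<open>v ! 4\<close>, and the one
  on the side of the root changes places with its neighbour on that line.\<close>

lemma ex_convex_labelling:
  assumes n: "n = 4 \<or> n = 5"
  shows "\<exists>p. convex_labelling X p"
proof (cases "n = 5 \<and> crossing {v ! 1, v ! 4} {v ! 2, v ! 3}")
  case False
  show ?thesis
  proof (rule convex_labellingI[of "\<lambda>i. i"])
    fix i j k l :: nat assume *: "i < j" "j < k" "k < l" "l < n"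
    have "\<not> crossing {v ! i, v ! l} {v ! j, v ! k}"
    proof (cases "i = 0")
      case True
      then show ?thesis using nc_nested_root[of j k l] * by simp
    next
      case i: False
      then have "i = 1" "j = 2" "k = 3" "l = 4" "n = 5" using * n by linarith+
      then show ?thesis using False by simp
    qed
    then show "\<not> crossing {v ! i, v ! j} {v ! k, v ! l} \<and> \<not> crossing {v ! i, v ! l} {v ! j, v ! k}"
      using nc_disjoint[of i j k l] * by simp
  qed (simp add: bij_betw_def)
next
  case True
  then have n5: "n = 5" and cr: "crossing {v ! 1, v ! 4} {v ! 2, v ! 3}" by auto
  define o' where "o' k = orient (v ! 1) (v ! 4) (v ! k)" for k
  have neg: "orient (v ! 4) (v ! 1) x = - orient (v ! 1) (v ! 4) x" for x by (simp add: orient_def algebra_simps)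
  have z: "o' 1 = 0" "o' 4 = 0" by (simp_all add: o'_def)
  have pos0: "o' 0 > 0"
    using hull n5 v(3) orient_rotate[of "v ! 1" "v ! 4" "v ! 0"] unfolding hull_order_def o'_def by auto
  have nz: "o' 2 \<noteq> 0" "o' 3 \<noteq> 0"
    using orient_nonzero[of "v ! 1" "v ! 4" "v ! 2"] orient_nonzero[of "v ! 1" "v ! 4" "v ! 3"] n5
    unfolding o'_def by simp_all
  have strict: "\<not> crossing {v ! a, v ! b} {v ! c, v ! d} \<and> \<not> crossing {v ! c, v ! d} {v ! a, v ! b}"
    if "o' a > 0" "o' b > 0" "o' c \<le> 0" "o' d \<le> 0" for a b c d
    using that not_crossing_strict[of "v ! 4" "v ! 1" "v ! a" "v ! b" "v ! c" "v ! d"] crossing_commute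
    unfolding o'_def neg by auto
  have strict': "\<not> crossing {v ! a, v ! b} {v ! c, v ! d} \<and> \<not> crossing {v ! c, v ! d} {v ! a, v ! b}"
    if "o' a < 0" "o' b < 0" "o' c \<ge> 0" "o' d \<ge> 0" for a b c d
    using that not_crossing_strict[of "v ! 1" "v ! 4" "v ! a" "v ! b" "v ! c" "v ! d"] crossing_commute
    unfolding o'_def by auto
  have weak: "\<not> crossing {v ! a, v ! b} {v ! c, v ! d} \<and> \<not> crossing {v ! c, v ! d} {v ! a, v ! b}"
    if "o' a \<le> 0" "o' b < 0" "o' c \<ge> 0" "o' d > 0" for a b c d
    using that not_crossing_weak[of "v ! 1" "v ! 4" "v ! a" "v ! b" "v ! c" "v ! d"] crossing_commute
    unfolding o'_def by auto
  have quad: "(i, j, k, l) \<in> {(0, 1, 2, 3), (0, 1, 2, 4), (0, 1, 3, 4), (0, 2, 3, 4), (1, 2, 3, 4)}"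
    if "i < j" "j < k" "k < l" "l < n" for i j k l :: nat
  proof -
    have "l = 3 \<or> l = 4" "k = 2 \<or> k = 3" "j = 1 \<or> j = 2" "i = 0 \<or> i = 1" using that n5 by linarith+
    then show ?thesis using that by auto
  qed
  have ic: "{v ! a, v ! b} = {v ! b, v ! a}" for a b by (rule insert_commute)
  consider "o' 2 < 0" "o' 3 > 0" | "o' 2 > 0" "o' 3 < 0"
  proof -
    have "\<not> (o' 2 > 0 \<and> o' 3 > 0)" using strict[of 2 3 1 4] z cr by auto
    moreover have "\<not> (o' 2 < 0 \<and> o' 3 < 0)" using strict'[of 2 3 1 4] z cr by auto
    ultimately show thesis using nz that by linarith
  qed
  then show ?thesis
  proof cases
    case 1
    \<comment> \<open>\<open>v ! 3\<close> lies inside the triangle of \<open>v ! 0\<close>,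
      \<open>v ! 1\<close> and \<open>v ! 4\<close> and is treated as if it came after
      \<open>v ! 4\<close>.\<close>
    define s where "s = (!) [0, 1, 2, 4, 3::nat]"
    have s: "s 0 = 0" "s 1 = 1" "s 2 = 2" "s 3 = 4" "s 4 = 3" by (simp_all add: s_def numeral_eq_Suc)
    have f5: "{..<5::nat} = {0, 1, 2, 3, 4}" by auto
    show ?thesis
    proof (rule convex_labellingI[of s])
      show "bij_betw s {..<n} {..<n}" unfolding n5 f5 bij_betw_def inj_on_def by (auto simp: s s[unfolded One_nat_def])
      fix i j k l assume "i < j" "j < k" "k < l" "l < n"
      then have "(i, j, k, l) \<in> {(0, 1, 2, 3), (0, 1, 2, 4), (0, 1, 3, 4), (0, 2, 3, 4), (1, 2, 3, 4)}" by (rule quad)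
      moreover have "\<not> crossing {v ! 0, v ! 1} {v ! 2, v ! 4}" "\<not> crossing {v ! 0, v ! 4} {v ! 1, v ! 2}"
        "\<not> crossing {v ! 0, v ! 1} {v ! 2, v ! 3}" "\<not> crossing {v ! 0, v ! 3} {v ! 1, v ! 2}"
        "\<not> crossing {v ! 0, v ! 1} {v ! 4, v ! 3}" "\<not> crossing {v ! 0, v ! 2} {v ! 4, v ! 3}"
        "\<not> crossing {v ! 1, v ! 2} {v ! 4, v ! 3}"
        unfolding ic[of 4 3] using n5 by (simp_all add: nc_disjoint nc_nested_root)
      moreover have "\<not> crossing {v ! 0, v ! 3} {v ! 1, v ! 4}" using strict[of 0 3 1 4] 1 pos0 z by auto
      moreover have "\<not> crossing {v ! 0, v ! 3} {v ! 2, v ! 4}" using strict[of 0 3 2 4] 1 pos0 z by auto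
      moreover have "\<not> crossing {v ! 1, v ! 3} {v ! 2, v ! 4}" using weak[of 4 2 1 3] 1 z ic[of 4 2] by auto
      ultimately show "\<not> crossing {v ! s i, v ! s j} {v ! s k, v ! s l} \<and> \<not> crossing {v ! s i, v ! s l} {v ! s j, v ! s k}"
        by (elim insertE emptyE) (simp_all add: s s[unfolded One_nat_def])
    qed
  next
    case 2
    \<comment> \<open>Now \<open>v ! 2\<close> lies inside that triangle and is treated as if it
      came before \<open>v ! 1\<close>.\<close>
    define s where "s = (!) [0, 2, 1, 3, 4::nat]"
    have s: "s 0 = 0" "s 1 = 2" "s 2 = 1" "s 3 = 3" "s 4 = 4" by (simp_all add: s_def numeral_eq_Suc)
    have f5: "{..<5::nat} = {0, 1, 2, 3, 4}" by auto
    show ?thesis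
    proof (rule convex_labellingI[of s])
      show "bij_betw s {..<n} {..<n}" unfolding n5 f5 bij_betw_def inj_on_def by (auto simp: s s[unfolded One_nat_def])
      fix i j k l assume "i < j" "j < k" "k < l" "l < n"
      then have "(i, j, k, l) \<in> {(0, 1, 2, 3), (0, 1, 2, 4), (0, 1, 3, 4), (0, 2, 3, 4), (1, 2, 3, 4)}" by (rule quad)
      moreover have "\<not> crossing {v ! 0, v ! 3} {v ! 2, v ! 1}" "\<not> crossing {v ! 0, v ! 4} {v ! 2, v ! 1}"
        "\<not> crossing {v ! 0, v ! 2} {v ! 3, v ! 4}" "\<not> crossing {v ! 0, v ! 4} {v ! 2, v ! 3}"
        "\<not> crossing {v ! 0, v ! 1} {v ! 3, v ! 4}" "\<not> crossing {v ! 0, v ! 4} {v ! 1, v ! 3}"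
        "\<not> crossing {v ! 2, v ! 1} {v ! 3, v ! 4}"
        unfolding ic[of 2 1] using n5 by (simp_all add: nc_disjoint nc_nested_root)
      moreover have "\<not> crossing {v ! 0, v ! 2} {v ! 1, v ! 3}" using strict[of 0 2 1 3] 2 pos0 z by auto
      moreover have "\<not> crossing {v ! 0, v ! 2} {v ! 1, v ! 4}" using strict[of 0 2 1 4] 2 pos0 z by auto
      moreover have "\<not> crossing {v ! 2, v ! 4} {v ! 1, v ! 3}" using weak[of 1 3 4 2] 2 z ic[of 4 2] by auto
      ultimately show "\<not> crossing {v ! s i, v ! s j} {v ! s k, v ! s l} \<and> \<not> crossing {v ! s i, v ! s l} {v ! s j, v ! s k}"
        by (elim insertE emptyE) (simp_all add: s s[unfolded One_nat_def])
    qed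
  qed
qed

lemma rainbow_small:
  assumes "n = 4 \<or> n = 5" "cycle_ok n r xs"
  shows "\<exists>p. rainbow_cycle X r p"
proof -
  obtain p where p: "convex_labelling X p" using ex_convex_labelling[OF assms(1)] by blast
  show ?thesis
    by (rule rainbow_if_cycle_ok[of p n]) (use p assms card3 in \<open>auto simp: convex_labelling_def\<close>)
qed

end

text \<open>The cycles for five points are invariant under rotation of a pentagon: a path from the
  star at 0 to the star at 1 is repeated in its five rotations. Sides and diagonals form two orbits
  of length five, so it is enough that the path has \<open>r\<close> labels of each kind.\<close>

definition rotations :: "((nat \<times> nat) list \<times> nat \<times> nat) list \<Rightarrow> ((nat \<times> nat) list \<times> nat \<times> nat) list" where
  "rotations xs = concat (map (\<lambda>k. map (\<lambda>x. (map (\<lambda>e. ((fst e + k) mod 5, (snd e + k) mod 5)) (fst x),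
     sorted_edge ((fst (snd x) + k) mod 5, (snd (snd x) + k) mod 5))) xs) [0..<5])"

lemma cycle_ok_4_2: "cycle_ok 4 2
    [([(1, 0), (2, 0), (3, 0)], (2, 3)),
     ([(1, 0), (2, 0), (3, 2)], (0, 3)),
     ([(1, 0), (3, 0), (2, 3)], (1, 3)),
     ([(1, 0), (3, 1), (2, 3)], (1, 2)),
     ([(1, 0), (2, 1), (3, 1)], (2, 3)),
     ([(1, 0), (2, 1), (3, 2)], (0, 2)),
     ([(2, 0), (1, 2), (3, 2)], (0, 3)),
     ([(3, 0), (2, 3), (1, 2)], (1, 3)),
     ([(3, 0), (1, 3), (2, 3)], (1, 2)),
     ([(3, 0), (1, 3), (2, 1)], (0, 1)),
     ([(1, 0), (3, 0), (2, 1)], (0, 2)),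
     ([(2, 0), (3, 0), (1, 2)], (0, 1))]"
  by code_simp

lemma cycle_ok_5_2: "cycle_ok 5 2 (rotations
    [([(1, 0), (2, 0), (3, 0), (4, 0)], (3, 4)),
     ([(1, 0), (2, 0), (3, 0), (4, 3)], (1, 2)),
     ([(1, 0), (3, 0), (2, 1), (4, 3)], (1, 3)),
     ([(1, 0), (2, 1), (3, 1), (4, 3)], (1, 4))])"
  by code_simp

lemma cycle_ok_5_3: "cycle_ok 5 3 (rotations
    [([(1, 0), (2, 0), (3, 0), (4, 0)], (3, 4)),
     ([(1, 0), (2, 0), (3, 0), (4, 3)], (0, 4)),
     ([(1, 0), (2, 0), (4, 0), (3, 4)], (2, 4)),
     ([(1, 0), (2, 0), (4, 2), (3, 4)], (1, 2)),
     ([(1, 0), (2, 1), (4, 2), (3, 4)], (1, 3)),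
     ([(1, 0), (2, 1), (3, 1), (4, 3)], (1, 4))])"
  by code_simp

lemma cycle_ok_5_4: "cycle_ok 5 4 (rotations
    [([(1, 0), (2, 0), (3, 0), (4, 0)], (3, 4)),
     ([(1, 0), (2, 0), (3, 0), (4, 3)], (0, 4)),
     ([(1, 0), (2, 0), (4, 0), (3, 4)], (2, 3)),
     ([(1, 0), (2, 0), (4, 0), (3, 2)], (0, 3)),
     ([(1, 0), (3, 0), (4, 0), (2, 3)], (1, 3)),
     ([(1, 0), (4, 0), (3, 1), (2, 3)], (1, 2)),
     ([(1, 0), (4, 0), (2, 1), (3, 2)], (1, 4)),
     ([(1, 0), (2, 1), (4, 1), (3, 2)], (1, 3))])"
  by code_simp

section \<open>The range of r for six or more points\<close>

lemma (in points) rainbow_large: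
  assumes n: "card X \<ge> 6" and r: "2 \<le> r" "r \<le> (if odd (card X) then card X - 1 else card X - 2)"
  shows "\<exists>p. rainbow_cycle X r p"
proof -
  obtain v Or where "hull_points X v Or" using ex_hull_points n by auto
  then interpret hull_points X v Or .
  have lab: "labelled_points X ((!) v) d" if "1 \<le> d" "2 * d < card X" for d
    using that n bij_v by unfold_locales auto
  show ?thesis
  proof (cases "even r")
    case True
    then obtain d where d: "r = 2 * d" by blast
    then have "1 \<le> d" "2 * d < card X" using r n by (auto split: if_splits)
    then show ?thesis using labelled_points.rainbow_even[OF lab] d by blast
  next
    case False
    then obtain d where d: "r = 2 * d + 1" using oddE by blast
    show ?thesis
    proof (cases "card X = r + 2")
      case True
      then have "card X = 2 * (d + 1) + 1" "r = 2 * (d + 1) - 1" using d by auto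
      moreover have "2 * (d + 1) < card X" using calculation by simp
      ultimately show ?thesis using labelled_points.rainbow_tournament[OF lab[of "d + 1"]] by simp
    next
      case ne: False
      \<comment> \<open>The upper bound on \<open>r\<close> is even in both cases, so an odd
        \<open>r\<close> stays below it; for odd \<open>card X\<close> the value
        \<open>card X - 2\<close> has been dealt with.\<close>
      have "r + 3 \<le> card X"
      proof (cases "odd (card X)")
        case True
        then have "r \<noteq> card X - 1" using \<open>odd r\<close> n by auto
        then show ?thesis using r True ne by auto
      next
        case even: False
        then have "r \<noteq> card X - 2" using \<open>odd r\<close> n by auto
        then show ?thesis using r even by auto
      qed
      then show ?thesis using rainbow_odd[of d] d r by auto
    qed
  qed
qed

theorem theorem2:
  fixes X :: "(real^2) set"
  assumes "finite X" and "general_position X"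
  shows "(card X \<ge> 3 \<longrightarrow> (\<exists>p. rainbow_cycle X 1 p)) \<and>
         (card X \<ge> 4 \<longrightarrow>
           (\<forall>r \<in> {2..(if odd (card X) then card X - 1 else card X - 2)}.
              \<exists>p. rainbow_cycle X r p))"
proof (intro conjI impI ballI)
  interpret points X using assms by unfold_locales
  show "\<exists>p. rainbow_cycle X 1 p" if "card X \<ge> 3"
    using ex_hull_points[OF that] hull_points.rainbow_one by blast
  fix r assume X4: "card X \<ge> 4" and r: "r \<in> {2..(if odd (card X) then card X - 1 else card X - 2)}"
  obtain v Or where "hull_points X v Or" using ex_hull_points X4 by auto
  then interpret hull_points X v Or .
  consider "card X = 4" "r = 2" | "card X = 5" "r = 2" | "card X = 5" "r = 3" | "card X = 5" "r = 4" | "card X \<ge> 6"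
  proof -
    have "card X = 4 \<or> card X = 5 \<or> card X \<ge> 6" using X4 by linarith
    moreover have "r = 2" if "card X = 4" using r that by auto
    moreover have "r = 2 \<or> r = 3 \<or> r = 4" if "card X = 5" using r that by auto
    ultimately show thesis using that by blast
  qed
  then show "\<exists>p. rainbow_cycle X r p"
  proof cases
    case 1
    then show ?thesis using rainbow_small[of 2] cycle_ok_4_2 by metis
  next
    case 2
    then show ?thesis using rainbow_small[of 2] cycle_ok_5_2 by metis
  next
    case 3
    then show ?thesis using rainbow_small[of 3] cycle_ok_5_3 by metis
  next
    case 4
    then show ?thesis using rainbow_small[of 4] cycle_ok_5_4 by metis
  next
    case 5
    then show ?thesis using r by (intro rainbow_large) auto
  qed
qed

end
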